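(* Let $a_n$ be the number of regular combinatorial $n+n$ symbic trees (with the convention $a_0=1$). The exponential generating function $E(x)=\sum_{n\ge0}a_n\frac{x^n}{n!}$ is $$E(x)=\frac34-\frac{\sqrt{1-4x+2x^2}}4+\frac1{1+\sqrt{1-4x+2x^2}}.$$
   Context: A split of a tree is a partition of the leaf labels obtained by removing an internal (non-leaf) edge. A combinatorial $n+n$ symbic tree is a tree with leaves labelled $1,\dots,n,1',\dots,n'$ (unprimed and primed labels are two colors; no unlabelled vertices of degree 2) such that (1) each split contains both colors on both sides; (2) the tree is symmetric with respect to the involution swapping $i$ and $i'$ for all $i$; (3) the fixed points of this involution (acting isometrically on the geometric realization) form a path, called the trunk (possibly a single point, possibly the midpoint of an edge). For $n=1$ there is exactly one symbic tree (leaves $1,1'$, no internal edges). Trees are counted up to isomorphism of leaf-labelled trees. A symbic tree is regular if it has $n-1$ internal edges up to symmetry (i.e. $n-1$ orbits of splits under the involution). *)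

theory Defs
  imports "HOL-Analysis.Analysis" "HOL-Computational_Algebra.Formal_Power_Series"
begin

section \<open>Finite trees with labelled leaves\<close>

datatype label = Unprimed nat | Primed nat

fun swap :: "label \<Rightarrow> label" where
  "swap (Unprimed i) = Primed i"
| "swap (Primed i) = Unprimed i"

definition labels :: "nat \<Rightarrow> label set" where
  "labels n = Unprimed ` {1..n} \<union> Primed ` {1..n}"

text \<open>Vertices are natural numbers; trees are only considered up to isomorphism, so this is no
  restriction on finite trees. Only the values of \<open>leaf\<close> on \<open>labels n\<close> are meaningful.\<close>

record ltree =
  verts :: "nat set"
  edges :: "nat set set"
  leaf :: "label \<Rightarrow> nat"

definition simple_graph :: "nat set \<Rightarrow> nat set set \<Rightarrow> bool" where
  "simple_graph V E \<longleftrightarrow> finite V \<and> (\<forall>e\<in>E. e \<subseteq> V \<and> card e = 2)"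

definition reach :: "nat set set \<Rightarrow> (nat \<times> nat) set" where
  "reach E = {(u, v). {u, v} \<in> E}\<^sup>*"

definition cycle_in :: "nat set set \<Rightarrow> nat list \<Rightarrow> bool" where
  "cycle_in E vs \<longleftrightarrow> 3 \<le> length vs \<and> distinct vs \<and>
     (\<forall>i. Suc i < length vs \<longrightarrow> {vs ! i, vs ! Suc i} \<in> E) \<and> {last vs, hd vs} \<in> E"

definition tree :: "nat set \<Rightarrow> nat set set \<Rightarrow> bool" where
  "tree V E \<longleftrightarrow> simple_graph V E \<and> V \<noteq> {} \<and>
     (\<forall>u\<in>V. \<forall>v\<in>V. (u, v) \<in> reach E) \<and> (\<nexists>vs. cycle_in E vs)"

definition degree :: "nat set set \<Rightarrow> nat \<Rightarrow> nat" where
  "degree E v = card {e \<in> E. v \<in> e}"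

definition leaves :: "ltree \<Rightarrow> nat set" where
  "leaves T = {v \<in> verts T. degree (edges T) v = 1}"

text \<open>Every leaf carries exactly one label. All other vertices are unlabelled, so forbidding
  unlabelled vertices of degree 2 amounts to forbidding vertices of degree 2.\<close>

definition leaf_labelled_tree :: "nat \<Rightarrow> ltree \<Rightarrow> bool" where
  "leaf_labelled_tree n T \<longleftrightarrow> tree (verts T) (edges T) \<and>
     bij_betw (leaf T) (labels n) (leaves T) \<and>
     (\<forall>v\<in>verts T. degree (edges T) v \<noteq> 2)"

definition graph_iso :: "ltree \<Rightarrow> ltree \<Rightarrow> (nat \<Rightarrow> nat) \<Rightarrow> bool" where
  "graph_iso T T' \<phi> \<longleftrightarrow>
     bij_betw \<phi> (verts T) (verts T') \<and> (\<lambda>e. \<phi> ` e) ` edges T = edges T'"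

definition labelled_iso :: "nat \<Rightarrow> ltree \<Rightarrow> ltree \<Rightarrow> bool" where
  "labelled_iso n T T' \<longleftrightarrow>
     (\<exists>\<phi>. graph_iso T T' \<phi> \<and> (\<forall>l\<in>labels n. \<phi> (leaf T l) = leaf T' l))"


section \<open>Splits\<close>

definition internal_edges :: "ltree \<Rightarrow> nat set set" where
  "internal_edges T = {e \<in> edges T. e \<inter> leaves T = {}}"

definition split_of :: "nat \<Rightarrow> ltree \<Rightarrow> nat set \<Rightarrow> label set set" where
  "split_of n T e =
     labels n // {(l, m). l \<in> labels n \<and> m \<in> labels n \<and>
                          (leaf T l, leaf T m) \<in> reach (edges T - {e})}"

definition splits :: "nat \<Rightarrow> ltree \<Rightarrow> label set set set" where
  "splits n T = split_of n T ` internal_edges T"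

definition swap_split :: "label set set \<Rightarrow> label set set" where
  "swap_split s = (\<lambda>A. swap ` A) ` s"

definition split_orbits :: "nat \<Rightarrow> ltree \<Rightarrow> label set set set set" where
  "split_orbits n T = (\<lambda>s. {s, swap_split s}) ` splits n T"


section \<open>Geometric realization and trunk\<close>

text \<open>Barycentric coordinates: the support of a point is a single vertex or an edge. The topology
  is the product topology on \<open>nat \<Rightarrow> real\<close>, which on a finite graph is the usual one.\<close>

definition realization :: "ltree \<Rightarrow> (nat \<Rightarrow> real) set" where
  "realization T = {p. (\<forall>v. 0 \<le> p v) \<and>
     {v. p v \<noteq> 0} \<in> (\<lambda>v. {v}) ` verts T \<union> edges T \<and> (\<Sum>v\<in>verts T. p v) = 1}"

text \<open>An automorphism \<open>\<sigma>\<close> sends a point \<open>p\<close> to the point with coordinate \<open>p v\<close> at \<open>\<sigma> v\<close>.\<close>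

definition fixed_points :: "ltree \<Rightarrow> (nat \<Rightarrow> nat) \<Rightarrow> (nat \<Rightarrow> real) set" where
  "fixed_points T \<sigma> = {p \<in> realization T. \<forall>v\<in>verts T. p (\<sigma> v) = p v}"

text \<open>The case \<open>a = b\<close> is the path consisting of a single point.\<close>

definition is_path :: "(nat \<Rightarrow> real) set \<Rightarrow> bool" where
  "is_path S \<longleftrightarrow> (\<exists>a b :: real. a \<le> b \<and> S homeomorphic {a..b})"


section \<open>Symbic trees\<close>

text \<open>An automorphism of a tree is determined by its values on the leaves, so the \<open>\<sigma>\<close> below is
  unique on the vertices and is an involution there.\<close>

definition symbic_tree :: "nat \<Rightarrow> ltree \<Rightarrow> bool" where
  "symbic_tree n T \<longleftrightarrow> leaf_labelled_tree n T \<and>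
     (\<forall>s\<in>splits n T. \<forall>A\<in>s. (\<exists>i. Unprimed i \<in> A) \<and> (\<exists>i. Primed i \<in> A)) \<and>
     (\<exists>\<sigma>. graph_iso T T \<sigma> \<and> (\<forall>l\<in>labels n. \<sigma> (leaf T l) = leaf T (swap l)) \<and>
          is_path (fixed_points T \<sigma>))"

definition regular_symbic_trees :: "nat \<Rightarrow> ltree set" where
  "regular_symbic_trees n = {T. symbic_tree n T \<and> card (split_orbits n T) = n - 1}"

definition num_regular_symbic_trees :: "nat \<Rightarrow> nat" where
  "num_regular_symbic_trees n =
     (if n = 0 then 1
      else card (regular_symbic_trees n //
             {(T, T'). T \<in> regular_symbic_trees n \<and> T' \<in> regular_symbic_trees n \<and>
                       labelled_iso n T T'}))"


section \<open>Exponential generating functions\<close>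

definition egf :: "(nat \<Rightarrow> nat) \<Rightarrow> real fps" where
  "egf a = Abs_fps (\<lambda>n. of_nat (a n) / fact n)"

text \<open>For constant coefficient 1 this is the square root with constant coefficient 1.\<close>

definition fps_sqrt :: "real fps \<Rightarrow> real fps" where
  "fps_sqrt f = fps_radical root 2 f"

end

theory Submission
  imports Defs "HOL-Combinatorics.Multiset_Permutations"
begin

text \<open>A leaf-labelled tree is determined by the sides of its edges, that is, by the label sets of the
  components left after removing an edge. The involution of a symbic tree sorts these sides: up to
  complement, a side is either swap-invariant (its edge lies on the trunk) or disjoint from its
  mirror image. Twice the number of split orbits plus \<open>2n\<close> is the number of sides of these two
  kinds. The trunk is a path exactly if the invariant sides form a chain together with its
  complements, and a laminar family on \<open>m\<close> points has at most \<open>2m - 1\<close> members, with equality only for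
  binary trees. So a regular symbic tree is a sequence of \<open>k\<close> binary trees, one for each pair of mirror
  images attached to the trunk, where \<open>k = 1\<close> means that the trunk is the midpoint of an edge.
  In every binary tree no two siblings are leaves of the same colour.

  Each plane drawing of such a sequence determines the tree, and a tree has \<open>2^n\<close> drawings for \<open>k = 1\<close>
  and \<open>2^(n+1)\<close> drawings otherwise, since subtrees can be exchanged, each binary tree can be replaced
  by its mirror image, and the sequence can be reversed. Counting plane drawings by cutting them at
  the root, the series \<open>B\<close> of single binary trees satisfies \<open>B = x + B^2 - x^2/2\<close>, so that
  \<open>1 - 2B\<close> is the square root of \<open>1 - 4x + 2x^2\<close>, and \<open>E = 1 + (B + B/(1 - B))/2\<close>.\<close>

text \<open>Regularity is an extremal condition. The \<open>2 * n\<close> labels fall into k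
  invariant blocks, one per mirror pair at the trunk. A block of size b carries at most 2b - 2 small
  sides, and k - 1 trunk edges separate the blocks and give 2k - 2 invariant sides. The total is at
  most \<open>4 * n - 2\<close> whatever k is, and n - 1 orbits ask for exactly
  \<open>2 * (n - 1) + 2 * n\<close> sides. Equality in every estimate forces all the parts to be
  binary. Families of sides are preferred to trees because the involution acts on them simply by
  images under \<open>swap\<close>, and isomorphism becomes equality of families. Topology enters
  twice: a path excludes three disjoint invariant sides, and a tree built from a code must be shown
  to have a path as its trunk. In the count, B has the coefficients
  \<open>num_trees n / 2 ^ n\<close>, where \<open>num_trees n\<close> counts coloured drawings over
  a fixed word of n indices. The term x^2/2 removes the two monochromatic colourings among the four
  colourings of a cherry. Trees with k = 1 have half as many drawings as the others, so their
  drawings are counted twice; this is why B is added to B/(1 - B).\<close>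

section \<open>The involution on labels\<close>

lemma swap_swap [simp]: "swap (swap x) = x" by (cases x) auto

lemma swap_neq [simp]: "swap x \<noteq> x" "x \<noteq> swap x" by (cases x; simp)+

lemma swap_eq_iff [simp]: "swap x = swap y \<longleftrightarrow> x = y"
  by (metis swap_swap)

lemma inj_swap: "inj_on swap A"
  by (simp add: inj_on_def)

lemma swap_image_image [simp]: "swap ` swap ` A = A"
  by (simp add: image_image)

lemma swap_image_iff: "x \<in> swap ` A \<longleftrightarrow> swap x \<in> A"
  by (metis imageE imageI swap_swap)

lemma card_swap_image [simp]: "card (swap ` A) = card A"
  by (simp add: card_image inj_swap)

lemma swap_image_subset: "swap ` A \<subseteq> swap ` B \<longleftrightarrow> A \<subseteq> B"
  by (metis image_mono swap_image_image)

lemma swap_image_eq [simp]: "swap ` A = swap ` B \<longleftrightarrow> A = B"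
  by (metis swap_image_image)

lemma swap_image_Int: "swap ` (A \<inter> B) = swap ` A \<inter> swap ` B"
  by (simp add: image_Int inj_swap)

lemma swap_image_Diff: "swap ` (A - B) = swap ` A - swap ` B"
  by (simp add: image_set_diff inj_swap)

lemma swap_in_labels [simp]: "swap l \<in> labels n \<longleftrightarrow> l \<in> labels n"
  by (cases l) (auto simp: labels_def)

lemma swap_labels [simp]: "swap ` labels n = labels n"
  by (auto simp: swap_image_iff)

lemma finite_labels [simp]: "finite (labels n)"
  by (simp add: labels_def)

lemma card_labels [simp]: "card (labels n) = 2 * n"
proof -
  have "card (labels n) = card (Unprimed ` {1..n}) + card (Primed ` {1..n})"
    unfolding labels_def by (rule card_Un_disjoint) auto
  then show ?thesis by (simp add: card_image inj_on_def)
qed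

section \<open>Rooted trees\<close>

lemma sym_reach: "(x, y) \<in> reach E \<Longrightarrow> (y, x) \<in> reach E"
proof -
  have "sym {(u, v). {u, v} \<in> E}"
    by (auto simp: sym_def insert_commute)
  then show "(x, y) \<in> reach E \<Longrightarrow> (y, x) \<in> reach E"
    unfolding reach_def by (meson sym_rtrancl symD)
qed

lemma reach_trans: "(x, y) \<in> reach E \<Longrightarrow> (y, z) \<in> reach E \<Longrightarrow> (x, z) \<in> reach E"
  unfolding reach_def by (rule rtrancl_trans)

lemma reach_refl [simp]: "(x, x) \<in> reach E"
  unfolding reach_def by simp

lemma reach_edge: "{x, y} \<in> E \<Longrightarrow> (x, y) \<in> reach E"
  unfolding reach_def by (rule r_into_rtrancl) simp

lemma reach_distinct_path:
  assumes "(x, y) \<in> reach E"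
  shows "\<exists>vs. vs \<noteq> [] \<and> hd vs = x \<and> last vs = y \<and> distinct vs \<and> successively (\<lambda>a b. {a, b} \<in> E) vs"
  using assms unfolding reach_def
proof (induction rule: converse_rtrancl_induct)
  case base
  show ?case by (rule exI[of _ "[y]"]) simp
next
  case (step x z)
  then obtain vs where vs: "vs \<noteq> []" "hd vs = z" "last vs = y" "distinct vs"
      "successively (\<lambda>a b. {a, b} \<in> E) vs"
    by blast
  show ?case
  proof (cases "x \<in> set vs")
    \<comment> \<open>If \<open>x\<close> already lies on the path from \<open>z\<close>, the detour
      is cut off by starting at that occurrence.\<close>
    case True
    then obtain as bs where "vs = as @ x # bs" by (meson split_list)
    with vs show ?thesis
      by (intro exI[of _ "x # bs"]) (auto simp: successively_append_iff)
  next
    case False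
    with vs step.hyps(1) show ?thesis
      by (intro exI[of _ "x # vs"]) (auto simp: successively_Cons)
  qed
qed

text \<open>A path avoiding the edge \<open>{x, y}\<close> has at least three vertices, since a path
  with two would be that edge. The edge then closes the cycle.\<close>

lemma cycle_from_path:
  assumes "(x, y) \<in> reach F" "F \<subseteq> E - {{x, y}}" "{x, y} \<in> E" "x \<noteq> y"
  shows "\<exists>vs. cycle_in E vs"
proof -
  obtain vs where vs: "vs \<noteq> []" "hd vs = x" "last vs = y" "distinct vs"
      "successively (\<lambda>a b. {a, b} \<in> F) vs"
    using reach_distinct_path[OF assms(1)] by blast
  have "3 \<le> length vs"
  proof (rule ccontr)
    assume "\<not> 3 \<le> length vs"
    then consider "length vs = 1" | "length vs = 2"
      using vs(1) by (cases vs) (auto simp: le_Suc_eq not_le numeral_3_eq_3 less_Suc_eq)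
    then show False
    proof cases
      case 1
      then show False using vs assms(4) by (auto simp: length_Suc_conv)
    next
      case 2
      then obtain a b where "vs = [a, b]"
        by (auto simp: length_Suc_conv numeral_2_eq_2)
      then show False using vs assms(2) by auto
    qed
  qed
  moreover have "\<forall>i. Suc i < length vs \<longrightarrow> {vs ! i, vs ! Suc i} \<in> E"
    using vs(5) assms(2) by (auto simp: successively_conv_nth)
  moreover have "{last vs, hd vs} \<in> E" using vs assms(3) by (simp add: insert_commute)
  ultimately show ?thesis using vs(4) unfolding cycle_in_def by blast
qed

text \<open>\<open>d\<close> is any measure that decreases towards the root and serves for
  induction. It is the distance to the root in \<open>tree_rooted\<close>, but a different measure
  \<open>dep\<close> in \<open>joined_forest\<close>.\<close>

locale rooted =
  fixes V :: "nat set" and r :: nat and par d :: "nat \<Rightarrow> nat"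
  assumes fin: "finite V" and root: "r \<in> V"
    and par_in: "v \<in> V \<Longrightarrow> v \<noteq> r \<Longrightarrow> par v \<in> V"
    and par_less: "v \<in> V \<Longrightarrow> v \<noteq> r \<Longrightarrow> d (par v) < d v"
begin

definition P :: "(nat \<times> nat) set" where "P = {(w, par w) | w. w \<in> V \<and> w \<noteq> r}"
definition E :: "nat set set" where "E = (\<lambda>v. {v, par v}) ` (V - {r})"
definition desc :: "nat \<Rightarrow> nat set" where "desc v = {w \<in> V. (w, v) \<in> P\<^sup>*}"

lemma desc_self: "v \<in> V \<Longrightarrow> v \<in> desc v"
  by (simp add: desc_def)

lemma desc_sub: "desc v \<subseteq> V"
  by (auto simp: desc_def)

lemma desc_root: "desc r = V"
proof -
  have "w \<in> V \<Longrightarrow> (w, r) \<in> P\<^sup>*" for w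
  proof (induction "d w" arbitrary: w rule: less_induct)
    case less
    show ?case
    proof (cases "w = r")
      case False
      then have "(par w, r) \<in> P\<^sup>*" using less.hyps[of "par w"] less.prems par_in[of w] par_less[of w] by simp
      moreover have "(w, par w) \<in> P" using False less by (auto simp: P_def)
      ultimately show ?thesis by (rule converse_rtrancl_into_rtrancl[rotated])
    qed simp
  qed
  then show ?thesis by (auto simp: desc_def)
qed

lemma desc_step:
  assumes "w \<in> V" "w \<noteq> r" "w \<noteq> v"
  shows "w \<in> desc v \<longleftrightarrow> par w \<in> desc v"
proof -
  have "(w, v) \<in> P\<^sup>* \<longleftrightarrow> (par w, v) \<in> P\<^sup>*"
  proof
    assume "(w, v) \<in> P\<^sup>*"
    then show "(par w, v) \<in> P\<^sup>*"
      by (rule converse_rtranclE) (use assms in \<open>auto simp: P_def\<close>)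
  next
    assume "(par w, v) \<in> P\<^sup>*"
    then show "(w, v) \<in> P\<^sup>*"
      by (rule converse_rtrancl_into_rtrancl[rotated]) (use assms in \<open>auto simp: P_def\<close>)
  qed
  then show ?thesis using assms par_in by (simp add: desc_def)
qed

lemma desc_d: "w \<in> desc v \<Longrightarrow> w = v \<or> d v < d w"
proof -
  assume "w \<in> desc v"
  then have "(w, v) \<in> P\<^sup>*" by (simp add: desc_def)
  then show ?thesis
    by (induction rule: converse_rtrancl_induct) (use par_less in \<open>auto simp: P_def intro: less_trans\<close>)
qed

lemma desc_trans: "w \<in> desc v \<Longrightarrow> desc w \<subseteq> desc v"
  by (auto simp: desc_def)

lemma par_notin_desc: "v \<in> V \<Longrightarrow> v \<noteq> r \<Longrightarrow> par v \<notin> desc v"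
  using desc_d par_less by (metis less_asym less_irrefl)

lemma child_in_desc: "w \<in> V \<Longrightarrow> w \<noteq> r \<Longrightarrow> w \<in> desc (par w)"
  using desc_step[of w "par w"] desc_self par_in par_less by (metis less_irrefl)

lemma root_notin_desc: "v \<in> V \<Longrightarrow> v \<noteq> r \<Longrightarrow> r \<notin> desc v"
proof
  assume "v \<in> V" "v \<noteq> r" "r \<in> desc v"
  then have "(r, v) \<in> P\<^sup>*" by (simp add: desc_def)
  then show False by (rule converse_rtranclE) (use \<open>v \<noteq> r\<close> in \<open>auto simp: P_def\<close>)
qed

text \<open>Parents are unique, so two ancestors of a common vertex lie on one upward path and are
  comparable.\<close>

lemma desc_laminar: "desc v \<subseteq> desc w \<or> desc w \<subseteq> desc v \<or> desc v \<inter> desc w = {}"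
proof (cases "desc v \<inter> desc w = {}")
  case False
  then obtain x where x: "(x, v) \<in> P\<^sup>*" "(x, w) \<in> P\<^sup>*" by (auto simp: desc_def)
  have "single_valued P" by (auto simp: single_valued_def P_def)
  from single_valued_confluent[OF this x] show ?thesis
    by (auto simp: desc_def intro: rtrancl_trans)
qed simp

lemma par_neq: "v \<in> V \<Longrightarrow> v \<noteq> r \<Longrightarrow> par v \<noteq> v"
  using par_less by (metis less_irrefl)

text \<open>Two different vertices with the same parent edge would be parents of each other, against
  the strict decrease of \<open>d\<close>.\<close>

lemma edge_inj:
  assumes "v \<in> V" "v \<noteq> r" "w \<in> V" "w \<noteq> r" "{v, par v} = {w, par w}"
  shows "v = w"
  using assms par_less by (metis doubleton_eq_iff less_asym)

lemma edge_iff: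
  "{x, y} \<in> E \<longleftrightarrow> (x \<in> V \<and> x \<noteq> r \<and> y = par x) \<or> (y \<in> V \<and> y \<noteq> r \<and> x = par y)"
  by (auto simp: E_def doubleton_eq_iff)

text \<open>The only edge that leaves \<open>desc v\<close> is the removed one. Conversely, every
  vertex inside climbs to \<open>v\<close> and every vertex outside climbs to \<open>r\<close>
  without using it.\<close>

lemma reach_cut:
  assumes v: "v \<in> V" "v \<noteq> r" and "x \<in> V" "y \<in> V"
  shows "(x, y) \<in> reach (E - {{v, par v}}) \<longleftrightarrow> (x \<in> desc v \<longleftrightarrow> y \<in> desc v)"
proof
  assume "(x, y) \<in> reach (E - {{v, par v}})"
  then show "x \<in> desc v \<longleftrightarrow> y \<in> desc v"
    unfolding reach_def
  proof (induction rule: rtrancl_induct)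
    case (step y z)
    then have "{y, z} \<in> E" and ne: "{y, z} \<noteq> {v, par v}" by auto
    then consider "y \<in> V" "y \<noteq> r" "z = par y" | "z \<in> V" "z \<noteq> r" "y = par z"
      unfolding edge_iff by blast
    then have "y \<in> desc v \<longleftrightarrow> z \<in> desc v"
    proof cases
      case 1
      then show ?thesis using ne desc_step[of y v] by metis
    next
      case 2
      then show ?thesis using ne desc_step[of z v] by (metis insert_commute)
    qed
    with step show ?case by simp
  qed simp
next
  have down: "(x, v) \<in> reach (E - {{v, par v}})" if "x \<in> desc v" for x
  proof -
    from that have "(x, v) \<in> P\<^sup>*" by (simp add: desc_def)
    then show ?thesis
    proof (induction rule: converse_rtrancl_induct)
      case (step y z)
      show ?case
      proof (cases "y = v")
        case False
        from step.hyps(1) have "y \<in> V" "y \<noteq> r" "z = par y" by (auto simp: P_def)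
        then have "{y, z} \<in> E - {{v, par v}}" using edge_inj[of y v] v False by (auto simp: E_def)
        then have "(y, z) \<in> reach (E - {{v, par v}})" by (rule reach_edge)
        then show ?thesis using step.IH by (rule reach_trans)
      qed simp
    qed simp
  qed
  have up: "(x, r) \<in> reach (E - {{v, par v}})" if "x \<in> V" "x \<notin> desc v" for x
    using that
  proof (induction "d x" arbitrary: x rule: less_induct)
    case less
    show ?case
    proof (cases "x = r")
      case False
      have "x \<noteq> v" using less desc_self by blast
      then have "par x \<notin> desc v" using desc_step False less by blast
      then have "(par x, r) \<in> reach (E - {{v, par v}})"
        using less.hyps[of "par x"] less.prems False par_in[of x] par_less[of x] by simp
      moreover have "{x, par x} \<in> E - {{v, par v}}"
        using less.prems False \<open>x \<noteq> v\<close> edge_inj[of x v] v by (auto simp: E_def)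
      ultimately show ?thesis by (metis reach_edge reach_trans)
    qed simp
  qed
  assume "x \<in> desc v \<longleftrightarrow> y \<in> desc v"
  then show "(x, y) \<in> reach (E - {{v, par v}})"
    using down[of x] down[of y] up[of x] up[of y] assms
      sym_reach[of y _ "E - {{v, par v}}"] reach_trans[of x _ "E - {{v, par v}}" y] by metis
qed

lemma reach_root: "x \<in> V \<Longrightarrow> (x, r) \<in> reach E"
proof (induction "d x" arbitrary: x rule: less_induct)
  case less
  show ?case
  proof (cases "x = r")
    case False
    then have "(par x, r) \<in> reach E" "{x, par x} \<in> E"
      using less.hyps[of "par x"] less.prems par_in[of x] par_less[of x] by (auto simp: E_def)
    then show ?thesis by (metis reach_edge reach_trans)
  qed simp
qed

text \<open>On a cycle, a vertex of maximal depth would have two distinct parents.\<close>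

lemma acyclic: "\<not> cycle_in E vs"
proof
  assume cyc: "cycle_in E vs"
  define L where "L = length vs"
  have L: "3 \<le> L" and dist: "distinct vs" using cyc by (auto simp: cycle_in_def L_def)
  have edge: "{vs ! j, vs ! ((j + 1) mod L)} \<in> E" if "j < L" for j
  proof (cases "j + 1 = L")
    case True
    then have "last vs = vs ! j" using L by (metis L_def add_diff_cancel_right' last_conv_nth list.size(3) not_numeral_le_zero)
    moreover have "hd vs = vs ! 0" using L L_def by (metis hd_conv_nth list.size(3) not_numeral_le_zero)
    ultimately show ?thesis using cyc True by (simp add: cycle_in_def)
  next
    case False
    then show ?thesis using cyc that by (simp add: cycle_in_def L_def)
  qed
  define M where "M = Max ((\<lambda>j. d (vs ! j)) ` {..<L})"
  have "M \<in> (\<lambda>j. d (vs ! j)) ` {..<L}" unfolding M_def by (rule Max_in) (use L in \<open>auto simp: lessThan_empty_iff\<close>)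
  then obtain i where i: "i < L" "d (vs ! i) = M" by auto
  have max: "d (vs ! j) \<le> d (vs ! i)" if "j < L" for j
    unfolding i M_def by (rule Max_ge) (use that in auto)
  have parent: "vs ! j = par (vs ! i)" if "j < L" "{vs ! i, vs ! j} \<in> E" for j
    using that(2) max[OF that(1)] par_less[of "vs ! j"] unfolding edge_iff by auto
  define j where "j = (i + 1) mod L"
  define k where "k = (if i = 0 then L - 1 else i - 1)"
  have jk: "j < L" "k < L" "(k + 1) mod L = i" using L i by (auto simp: j_def k_def)
  have "j \<noteq> k"
    using L i by (cases "i + 1 = L") (auto simp: j_def k_def split: if_splits)
  have "vs ! j = par (vs ! i)" using parent[OF jk(1)] edge[OF i(1)] by (simp add: j_def)
  moreover have "vs ! k = par (vs ! i)"
    using parent[OF jk(2)] edge[OF jk(2)] jk(3) by (simp add: insert_commute)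
  ultimately show False using dist \<open>j \<noteq> k\<close> jk nth_eq_iff_index_eq[OF dist, of j k]
    by (simp add: L_def)
qed

lemma tree_E: "tree V E"
  unfolding tree_def simple_graph_def
proof (intro conjI ballI)
  show "\<nexists>vs. cycle_in E vs" using acyclic by blast
  show "V \<noteq> {}" using root by blast
  show "finite V" by (rule fin)
  fix e assume "e \<in> E"
  then obtain v where v: "v \<in> V" "v \<noteq> r" "e = {v, par v}" by (auto simp: E_def)
  then show "e \<subseteq> V" "card e = 2"
    using par_in[of v] par_neq[of v] by auto
next
  show "(u, v) \<in> reach E" if "u \<in> V" "v \<in> V" for u v
    by (rule reach_trans[OF reach_root[OF that(1)] sym_reach[OF reach_root[OF that(2)]]])
qed

lemma degree_E:
  assumes "v \<in> V"
  shows "degree E v = card {w \<in> V. w \<noteq> r \<and> par w = v} + (if v = r then 0 else 1)"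
proof -
  let ?C = "{w \<in> V. w \<noteq> r \<and> par w = v}"
  let ?S = "if v = r then {} else {v}"
  have "{e \<in> E. v \<in> e} = (\<lambda>w. {w, par w}) ` (?C \<union> ?S)"
    using assms by (auto simp: E_def)
  moreover have "inj_on (\<lambda>w. {w, par w}) (?C \<union> ?S)"
    using edge_inj assms by (auto simp: inj_on_def split: if_splits)
  moreover have "?C \<inter> ?S = {}" using par_neq by auto
  ultimately show ?thesis
    unfolding degree_def using fin by (simp add: card_image card_Un_disjoint)
qed

text \<open>A vertex of maximal depth below \<open>v\<close> has no child. This supplies a leaf,
  hence a label, below every vertex.\<close>

lemma childless:
  assumes "v \<in> V"
  shows "\<exists>x \<in> desc v. \<forall>w \<in> V. w \<noteq> r \<longrightarrow> par w \<noteq> x"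
proof -
  have "finite (desc v)" using desc_sub fin finite_subset by blast
  moreover have "desc v \<noteq> {}" using desc_self assms by blast
  ultimately have "Max (d ` desc v) \<in> d ` desc v" by (intro Max_in) auto
  then obtain x where "x \<in> desc v" "d x = Max (d ` desc v)" by auto
  then have x: "x \<in> desc v" "\<forall>y\<in>desc v. d y \<le> d x"
    using \<open>finite (desc v)\<close> by auto
  have False if "w \<in> V" "w \<noteq> r" "par w = x" for w
  proof -
    have "w \<in> desc v"
      using that desc_step[of w v] x desc_self assms by (cases "w = v") auto
    then show False using x(2) par_less[OF that(1,2)] that by force
  qed
  with x show ?thesis by blast
qed

end

text \<open>The parent of a vertex is the first step of a shortest walk to \<open>r\<close>. An edge
  of another kind would close a cycle with the path that the parent edges already provide between
  its ends.\<close>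

lemma tree_rooted:
  assumes T: "tree V E" and r: "r \<in> V"
  shows "\<exists>par d. rooted V r par d \<and> rooted.E V r par = E"
proof -
  define R where "R = {(u, v). {u, v} \<in> E}"
  have EV: "e \<subseteq> V" "card e = 2" if "e \<in> E" for e
    using T that by (auto simp: tree_def simple_graph_def)
  define d where "d x = (LEAST k. (x, r) \<in> R ^^ k)" for x
  have dI: "(x, r) \<in> R ^^ d x" if "x \<in> V" for x
  proof -
    have "(x, r) \<in> R\<^sup>*" using T r that by (auto simp: tree_def reach_def R_def)
    then show ?thesis unfolding d_def by (metis LeastI rtrancl_power)
  qed
  have "\<exists>y. {x, y} \<in> E \<and> d y < d x" if x: "x \<in> V" "x \<noteq> r" for x
  proof -
    have "d x \<noteq> 0"
    proof
      assume "d x = 0"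
      with dI[OF x(1)] x(2) show False by simp
    qed
    then obtain m where m: "d x = Suc m" by (cases "d x") auto
    with dI[OF x(1)] have "(x, r) \<in> R ^^ Suc m" by simp
    then obtain y where "(x, y) \<in> R" "(y, r) \<in> R ^^ m" by (meson relpow_Suc_E2)
    then show ?thesis using m Least_le[of "\<lambda>k. (y, r) \<in> R ^^ k" m]
      by (auto simp: R_def d_def[of y])
  qed
  then obtain par where par: "\<And>x. x \<in> V \<Longrightarrow> x \<noteq> r \<Longrightarrow> {x, par x} \<in> E \<and> d (par x) < d x"
    by metis
  interpret rt: rooted V r par d
  proof
    show "finite V" using T by (simp add: tree_def simple_graph_def)
  qed (use r par EV in blast)+
  have sub: "rt.E \<subseteq> E" using par by (auto simp: rt.E_def)
  moreover have "e \<in> rt.E" if "e \<in> E" for e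
  proof (rule ccontr)
    assume ne: "e \<notin> rt.E"
    obtain x y where e: "e = {x, y}" "x \<noteq> y" using EV(2)[OF \<open>e \<in> E\<close>] by (auto simp: card_2_iff)
    then have "x \<in> V" "y \<in> V" using EV(1)[OF \<open>e \<in> E\<close>] by auto
    then have "(x, y) \<in> reach rt.E" using rt.tree_E by (simp add: tree_def)
    moreover have "rt.E \<subseteq> E - {{x, y}}" using sub ne e by auto
    ultimately have "\<exists>vs. cycle_in E vs" using cycle_from_path e that by blast
    then show False using T by (simp add: tree_def)
  qed
  ultimately show ?thesis using rt.rooted_axioms by blast
qed

section \<open>Sides of edges determine a labelled tree\<close>

text \<open>In contrast to \<open>splits\<close>, pendant edges are included, so singletons and
  their complements are sides as well. This lets the leaves be read off from the family.\<close>

definition sides :: "nat \<Rightarrow> ltree \<Rightarrow> label set set" where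
  "sides n T = \<Union> (split_of n T ` edges T)"

text \<open>The last clause is the usual compatibility of two splits: one of the four intersections
  formed from \<open>A\<close>, \<open>B\<close> and their complements is empty.\<close>

definition split_system :: "nat \<Rightarrow> label set set \<Rightarrow> bool" where
  "split_system n S \<longleftrightarrow> (\<forall>A\<in>S. A \<subseteq> labels n \<and> A \<noteq> {} \<and> labels n - A \<in> S) \<and>
     (\<forall>l\<in>labels n. {l} \<in> S) \<and>
     (\<forall>A\<in>S. \<forall>B\<in>S. A \<subseteq> B \<or> B \<subseteq> A \<or> A \<inter> B = {} \<or> A \<union> B = labels n)"

lemma quotient_two_classes:
  assumes "A \<subseteq> L" "A \<noteq> {}" "A \<noteq> L"
  shows "L // {(l, m). l \<in> L \<and> m \<in> L \<and> (l \<in> A \<longleftrightarrow> m \<in> A)} = {A, L - A}"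
proof -
  have cls: "{(l, m). l \<in> L \<and> m \<in> L \<and> (l \<in> A \<longleftrightarrow> m \<in> A)} `` {l} = (if l \<in> A then A else L - A)"
    if "l \<in> L" for l
    using that assms(1) by auto
  obtain a b where "a \<in> A" "b \<in> L - A" using assms by blast
  then show ?thesis
    unfolding quotient_def using cls assms(1)
    by (auto simp: cls) (metis (full_types) DiffD1 DiffD2 subsetD)+
qed

locale rooted_ltree = rooted "verts T" r par d for T :: ltree and r par d +
  fixes n :: nat
  assumes edges_E: "edges T = E" and lt: "leaf_labelled_tree n T"
begin

definition cl :: "nat \<Rightarrow> label set" where
  "cl v = {l \<in> labels n. leaf T l \<in> desc v}"

lemma leaf_in: "l \<in> labels n \<Longrightarrow> leaf T l \<in> leaves T"
  and leaf_inj: "l \<in> labels n \<Longrightarrow> m \<in> labels n \<Longrightarrow> leaf T l = leaf T m \<longleftrightarrow> l = m"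
  and leaf_surj: "v \<in> leaves T \<Longrightarrow> \<exists>l\<in>labels n. leaf T l = v"
proof -
  have "inj_on (leaf T) (labels n)" "leaf T ` labels n = leaves T"
    using lt by (simp_all add: leaf_labelled_tree_def bij_betw_def)
  then show "l \<in> labels n \<Longrightarrow> leaf T l \<in> leaves T"
    "l \<in> labels n \<Longrightarrow> m \<in> labels n \<Longrightarrow> leaf T l = leaf T m \<longleftrightarrow> l = m"
    "v \<in> leaves T \<Longrightarrow> \<exists>l\<in>labels n. leaf T l = v"
    by (auto simp: inj_on_eq_iff) (metis imageE)
qed

lemma leaf_vert: "l \<in> labels n \<Longrightarrow> leaf T l \<in> verts T"
  using leaf_in by (auto simp: leaves_def)

lemma cl_sub: "cl v \<subseteq> labels n"
  by (auto simp: cl_def)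

lemma split_of_cl:
  assumes "v \<in> verts T" "v \<noteq> r" "cl v \<noteq> {}" "cl v \<noteq> labels n"
  shows "split_of n T {v, par v} = {cl v, labels n - cl v}"
proof -
  have "{(l, m). l \<in> labels n \<and> m \<in> labels n \<and> (leaf T l, leaf T m) \<in> reach (edges T - {{v, par v}})}
     = {(l, m). l \<in> labels n \<and> m \<in> labels n \<and> (l \<in> cl v \<longleftrightarrow> m \<in> cl v)}"
    using reach_cut[OF assms(1,2)] leaf_vert by (auto simp: edges_E cl_def)
  then show ?thesis
    unfolding split_of_def using quotient_two_classes[OF cl_sub assms(3,4)] by simp
qed

lemma degree_eq:
  "v \<in> verts T \<Longrightarrow> degree (edges T) v = card {w \<in> verts T. w \<noteq> r \<and> par w = v} + (if v = r then 0 else 1)"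
  using degree_E edges_E by simp

lemma degree_neq_2: "v \<in> verts T \<Longrightarrow> degree (edges T) v \<noteq> 2"
  using lt by (simp add: leaf_labelled_tree_def)

lemma child_toward:
  assumes "w \<in> desc v" "w \<noteq> v"
  shows "\<exists>c\<in>verts T. c \<noteq> r \<and> par c = v \<and> w \<in> desc c"
proof -
  have "(w, v) \<in> P\<^sup>*" "w \<in> verts T" using assms by (auto simp: desc_def)
  from this(1) show ?thesis
    by (rule rtranclE) (use assms(2) \<open>w \<in> verts T\<close> in \<open>auto simp: P_def desc_def\<close>)
qed

lemma siblings_disjoint:
  assumes "c \<in> verts T" "c \<noteq> r" "c' \<in> verts T" "c' \<noteq> r" "par c = par c'" "c \<noteq> c'"
  shows "desc c \<inter> desc c' = {}"
proof -
  have "\<not> desc a \<subseteq> desc b" if "a \<in> verts T" "a \<noteq> r" "b \<in> verts T" "b \<noteq> r" "par a = par b" "a \<noteq> b" for a b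
    using that desc_step[of a b] par_notin_desc[of b] desc_self[of a] by auto
  then show ?thesis using assms desc_laminar[of c c'] by metis
qed

text \<open>A childless vertex below \<open>v\<close> is not the root, so its only edge goes to its
  parent. Degree 1 makes it a leaf, which carries a label.\<close>

lemma cl_nonempty:
  assumes "v \<in> verts T" "v \<noteq> r"
  shows "cl v \<noteq> {}"
proof -
  obtain x where x: "x \<in> desc v" "\<forall>w\<in>verts T. w \<noteq> r \<longrightarrow> par w \<noteq> x"
    using childless[OF assms(1)] by blast
  then have "x \<noteq> r" "x \<in> verts T" using root_notin_desc[OF assms] desc_sub by auto
  moreover have "{w \<in> verts T. w \<noteq> r \<and> par w = x} = {}" using x by blast
  ultimately have "degree (edges T) x = 1" using degree_eq[of x] by (simp only:) simp
  then have "x \<in> leaves T" using \<open>x \<in> verts T\<close> by (simp add: leaves_def)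
  then show ?thesis using leaf_surj x(1) by (fastforce simp: cl_def)
qed

lemma cl_mono: "desc v \<subseteq> desc w \<Longrightarrow> cl v \<subseteq> cl w"
  by (auto simp: cl_def)

lemma cl_disjoint: "desc v \<inter> desc w = {} \<Longrightarrow> cl v \<inter> cl w = {}"
  by (auto simp: cl_def)

lemma cl_laminar: "cl v \<subseteq> cl w \<or> cl w \<subseteq> cl v \<or> cl v \<inter> cl w = {}"
  using desc_laminar[of v w] cl_mono cl_disjoint by blast

text \<open>A non-root vertex with a child has a second one, since its degree is not 2.\<close>

lemma cl_strict:
  assumes "v \<in> verts T" "v \<noteq> r" "w \<in> desc v" "w \<noteq> v"
  shows "\<not> cl v \<subseteq> cl w"
proof -
  obtain c where c: "c \<in> verts T" "c \<noteq> r" "par c = v" "w \<in> desc c"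
    using child_toward[OF assms(3,4)] by blast
  let ?C = "{w \<in> verts T. w \<noteq> r \<and> par w = v}"
  have "card ?C \<noteq> 1" using degree_eq[OF assms(1)] degree_neq_2[OF assms(1)] assms(2) by simp
  then have "?C \<noteq> {c}" by (metis is_singletonI is_singleton_altdef)
  then obtain c' where c': "c' \<in> verts T" "c' \<noteq> r" "par c' = v" "c' \<noteq> c" using c by blast
  have "desc c \<inter> desc c' = {}" using siblings_disjoint[of c c'] c c' by simp
  then have "desc w \<inter> desc c' = {}" using desc_trans[OF c(4)] by blast
  then have "cl w \<inter> cl c' = {}" by (rule cl_disjoint)
  moreover have "cl c' \<subseteq> cl v" using cl_mono desc_trans child_in_desc c' by metis
  ultimately show ?thesis using cl_nonempty[OF c'(1,2)] by blast
qed

text \<open>Converse of \<open>cl_mono\<close>. Laminarity leaves two bad cases: disjointness,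
  excluded by \<open>cl_nonempty\<close>, and \<open>w\<close> strictly below \<open>v\<close>,
  excluded by \<open>cl_strict\<close>. Clusters thereby become faithful names of vertices.\<close>

lemma cl_subset_desc:
  assumes "v \<in> verts T" "v \<noteq> r" "w \<in> verts T" "w \<noteq> r" "cl v \<subseteq> cl w"
  shows "desc v \<subseteq> desc w"
proof -
  have False if "desc v \<inter> desc w = {}"
    using cl_disjoint[OF that] assms(5) cl_nonempty[OF assms(1,2)] by blast
  moreover have "v = w" if "desc w \<subseteq> desc v"
    using cl_strict[OF assms(1,2), of w] that desc_self[OF assms(3)] assms(5) by blast
  ultimately show ?thesis using desc_laminar[of v w] by blast
qed

lemma cl_inj:
  assumes "v \<in> verts T" "v \<noteq> r" "w \<in> verts T" "w \<noteq> r" "cl v = cl w"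
  shows "v = w"
proof -
  have "v \<in> desc w" "w \<in> desc v"
    using cl_subset_desc[of v w] cl_subset_desc[of w v] desc_self assms by blast+
  then show ?thesis using desc_d by (metis less_asym)
qed

lemma desc_leaf:
  assumes "v \<in> leaves T" "v \<noteq> r"
  shows "desc v = {v}"
proof -
  have v: "v \<in> verts T" "degree (edges T) v = 1" using assms by (auto simp: leaves_def)
  then have "card {w \<in> verts T. w \<noteq> r \<and> par w = v} = 0" using degree_eq assms(2) by simp
  then have "{w \<in> verts T. w \<noteq> r \<and> par w = v} = {}" using fin by simp
  then show ?thesis using child_toward[of _ v] desc_self[OF v(1)] by blast
qed

lemma cl_leaf:
  assumes "l \<in> labels n" "leaf T l \<noteq> r"
  shows "cl (leaf T l) = {l}"
  using desc_leaf[OF leaf_in[OF assms(1)] assms(2)] leaf_inj assms(1) by (auto simp: cl_def)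

end

text \<open>With a labelled leaf as root, every edge has exactly one side without \<open>l0\<close>,
  namely the cluster of its lower end. So clusters of non-root vertices are nonempty and proper, and
  these vertices correspond to the sides that avoid \<open>l0\<close>.\<close>

locale leaf_rooted = rooted_ltree +
  fixes l0 :: label
  assumes l0: "l0 \<in> labels n" and leaf_l0: "leaf T l0 = r"
begin

lemma l0_notin_cl: "v \<in> verts T \<Longrightarrow> v \<noteq> r \<Longrightarrow> l0 \<notin> cl v"
  using root_notin_desc leaf_l0 by (auto simp: cl_def)

lemma sides_eq: "sides n T = (\<Union>v\<in>verts T - {r}. {cl v, labels n - cl v})"
proof -
  have "split_of n T {v, par v} = {cl v, labels n - cl v}" if "v \<in> verts T - {r}" for v
    using that cl_nonempty l0_notin_cl l0 by (intro split_of_cl) blast+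
  then show ?thesis by (simp add: sides_def edges_E E_def image_image)
qed

lemma cl_in_sides: "v \<in> verts T \<Longrightarrow> v \<noteq> r \<Longrightarrow> cl v \<in> sides n T"
  using sides_eq by blast

lemma sides_cases:
  assumes "A \<in> sides n T"
  obtains v where "v \<in> verts T" "v \<noteq> r" "A = cl v" | v where "v \<in> verts T" "v \<noteq> r" "A = labels n - cl v"
  using assms sides_eq by blast

lemma root_child: "\<exists>c. {w \<in> verts T. w \<noteq> r \<and> par w = r} = {c} \<and> cl c = labels n - {l0}"
proof -
  have "r \<in> leaves T" using leaf_in[OF l0] leaf_l0 by simp
  then have "card {w \<in> verts T. w \<noteq> r \<and> par w = r} = 1"
    using degree_eq[OF root] by (simp add: leaves_def)
  then obtain c where c: "{w \<in> verts T. w \<noteq> r \<and> par w = r} = {c}"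
    by (auto simp: card_1_singleton_iff)
  then have cr: "c \<in> verts T" "c \<noteq> r" by blast+
  have "x \<in> desc c" if x: "x \<in> verts T" "x \<noteq> r" for x
  proof -
    obtain c' where "c' \<in> verts T" "c' \<noteq> r" "par c' = r" "x \<in> desc c'"
      using child_toward[of x r] x desc_root by blast
    moreover from this have "c' \<in> {c}" unfolding c[symmetric] by simp
    ultimately show ?thesis by simp
  qed
  then have "cl c = labels n - {l0}"
    using l0_notin_cl[OF cr] leaf_vert leaf_l0 leaf_inj l0 by (auto simp: cl_def)
  with c show ?thesis by blast
qed

lemma singleton_in_sides: "l \<in> labels n \<Longrightarrow> {l} \<in> sides n T"
proof (cases "l = l0")
  case True
  obtain c where "{w \<in> verts T. w \<noteq> r \<and> par w = r} = {c}" "cl c = labels n - {l0}"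
    using root_child by blast
  then have "c \<in> verts T - {r}" "labels n - cl c = {l0}" using l0 by blast+
  then show ?thesis using sides_eq True by blast
next
  case False
  assume l: "l \<in> labels n"
  then have "leaf T l \<noteq> r" using False leaf_inj l0 leaf_l0 by blast
  then show ?thesis using cl_leaf cl_in_sides[of "leaf T l"] leaf_vert l by simp
qed

lemma split_system_sides: "split_system n (sides n T)"
  unfolding split_system_def
proof (intro conjI ballI)
  fix A assume A: "A \<in> sides n T"
  then show "A \<subseteq> labels n" by (rule sides_cases) (use cl_sub in auto)
  show "A \<noteq> {}" using A by (rule sides_cases) (use cl_nonempty l0_notin_cl l0 in auto)
  show "labels n - A \<in> sides n T" using A
    by (rule sides_cases) (use cl_in_sides cl_sub in \<open>auto simp: sides_eq double_diff\<close>)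
next
  fix A B assume "A \<in> sides n T" "B \<in> sides n T"
  then obtain v w where "A = cl v \<or> A = labels n - cl v" "B = cl w \<or> B = labels n - cl w"
    using sides_eq by auto
  then show "A \<subseteq> B \<or> B \<subseteq> A \<or> A \<inter> B = {} \<or> A \<union> B = labels n"
    using cl_laminar[of v w] cl_sub[of v] cl_sub[of w] by blast
qed (rule singleton_in_sides)

lemma leaf_iff_cl:
  assumes "v \<in> verts T" "v \<noteq> r"
  shows "v \<in> leaves T \<longleftrightarrow> card (cl v) = 1"
proof
  assume "v \<in> leaves T"
  then show "card (cl v) = 1" using leaf_surj cl_leaf assms by fastforce
next
  assume "card (cl v) = 1"
  then obtain l where l: "cl v = {l}" by (auto simp: card_1_singleton_iff)
  then have "l \<in> labels n" "leaf T l \<noteq> r"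
    using cl_sub l0_notin_cl[OF assms] leaf_inj l0 leaf_l0 by blast+
  then have "v = leaf T l" using cl_inj[OF assms, of "leaf T l"] leaf_vert cl_leaf l by simp
  then show "v \<in> leaves T" using leaf_in \<open>l \<in> labels n\<close> by simp
qed

text \<open>A vertex other than the root that has a child is not a leaf, so the upper end of an edge
  is a leaf only if it is the root.\<close>

lemma par_leaf_iff_cl:
  assumes "v \<in> verts T" "v \<noteq> r"
  shows "par v \<in> leaves T \<longleftrightarrow> card (labels n - cl v) = 1"
proof -
  obtain c where c: "{w \<in> verts T. w \<noteq> r \<and> par w = r} = {c}" "cl c = labels n - {l0}"
    using root_child by blast
  have rl: "r \<in> leaves T" using leaf_in[OF l0] leaf_l0 by simp
  show ?thesis
  proof
    assume "par v \<in> leaves T"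
    then have "par v = r" using desc_leaf child_in_desc par_neq assms by (metis singletonD)
    then have "v = c" using c assms by blast
    then have "labels n - cl v = {l0}" using c l0 by blast
    then show "card (labels n - cl v) = 1" by simp
  next
    assume "card (labels n - cl v) = 1"
    then obtain l where "labels n - cl v = {l}" by (auto simp: card_1_singleton_iff)
    moreover have "l0 \<in> labels n - cl v" using l0 l0_notin_cl[OF assms] by blast
    ultimately have "labels n - cl v = {l0}" by simp
    then have "cl v = labels n - {l0}" using cl_sub[of v] by (metis double_diff subset_refl)
    moreover have "c \<in> verts T" "c \<noteq> r" "par c = r" using c by blast+
    ultimately have "v = c" using cl_inj[OF assms] c by simp
    then show "par v \<in> leaves T" using rl \<open>par c = r\<close> by simp
  qed
qed

lemma internal_iff_cl:
  assumes "v \<in> verts T" "v \<noteq> r"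
  shows "{v, par v} \<in> internal_edges T \<longleftrightarrow> 2 \<le> card (cl v) \<and> 2 \<le> card (labels n - cl v)"
proof -
  have "finite (cl v)" using cl_sub finite_labels finite_subset by blast
  then have "card (cl v) \<noteq> 0" "card (labels n - cl v) \<noteq> 0"
    using cl_nonempty[OF assms] l0_notin_cl[OF assms] l0 by auto
  then have "card (cl v) = 1 \<or> 2 \<le> card (cl v)" "card (labels n - cl v) = 1 \<or> 2 \<le> card (labels n - cl v)"
    by linarith+
  moreover have "{v, par v} \<in> edges T" using assms edges_E E_def by blast
  ultimately show ?thesis
    using leaf_iff_cl[OF assms] par_leaf_iff_cl[OF assms] unfolding internal_edges_def by auto
qed

text \<open>Expresses the splits through \<open>sides\<close> alone, so that regularity and the
  colour condition become statements about a family of label sets.\<close>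

lemma splits_eq:
  "splits n T = {{A, labels n - A} | A. A \<in> sides n T \<and> 2 \<le> card A \<and> 2 \<le> card (labels n - A)}"
proof -
  have sp: "split_of n T {v, par v} = {cl v, labels n - cl v}" if "v \<in> verts T" "v \<noteq> r" for v
    using that cl_nonempty l0_notin_cl l0 by (intro split_of_cl) blast+
  show ?thesis
  proof (intro set_eqI iffI)
    fix s assume "s \<in> splits n T"
    then obtain e where e: "e \<in> internal_edges T" "s = split_of n T e" by (auto simp: splits_def)
    then obtain v where v: "v \<in> verts T" "v \<noteq> r" "e = {v, par v}"
      by (auto simp: internal_edges_def edges_E E_def)
    then show "s \<in> {{A, labels n - A} | A. A \<in> sides n T \<and> 2 \<le> card A \<and> 2 \<le> card (labels n - A)}"
      using e sp[OF v(1,2)] internal_iff_cl[OF v(1,2)] cl_in_sides[OF v(1,2)] by blast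
  next
    fix s assume "s \<in> {{A, labels n - A} | A. A \<in> sides n T \<and> 2 \<le> card A \<and> 2 \<le> card (labels n - A)}"
    then obtain A where A: "A \<in> sides n T" "2 \<le> card A" "2 \<le> card (labels n - A)" "s = {A, labels n - A}"
      by blast
    obtain v where v: "v \<in> verts T" "v \<noteq> r" "A = cl v \<or> A = labels n - cl v"
      using A(1) sides_eq by blast
    have "labels n - (labels n - cl v) = cl v" using cl_sub by blast
    then have "2 \<le> card (cl v) \<and> 2 \<le> card (labels n - cl v)" "s = {cl v, labels n - cl v}"
      using v A by auto
    then show "s \<in> splits n T" using internal_iff_cl[OF v(1,2)] sp[OF v(1,2)] by (auto simp: splits_def)
  qed
qed

lemma cl_image: "cl ` (verts T - {r}) = {A \<in> sides n T. l0 \<notin> A}"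
  using sides_eq l0_notin_cl l0 by auto

lemma cl_par:
  assumes "v \<in> verts T" "v \<noteq> r" "par v \<noteq> r"
  shows "cl v \<subset> cl (par v)"
    and "w \<in> verts T \<Longrightarrow> w \<noteq> r \<Longrightarrow> cl v \<subset> cl w \<Longrightarrow> cl (par v) \<subseteq> cl w"
proof -
  have "par v \<in> verts T" "v \<in> desc (par v)" using assms par_in child_in_desc by auto
  then show "cl v \<subset> cl (par v)"
    using cl_strict[of "par v" v] par_neq assms cl_mono desc_trans by (metis psubsetI subset_refl)
  assume w: "w \<in> verts T" "w \<noteq> r" "cl v \<subset> cl w"
  then have "v \<in> desc w" using cl_subset_desc desc_self assms by blast
  moreover have "v \<noteq> w" using w by blast
  ultimately have "par v \<in> desc w" using desc_step assms by blast
  then show "cl (par v) \<subseteq> cl w" using desc_trans cl_mono by blast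
qed

lemma cl_par_root:
  assumes "v \<in> verts T" "v \<noteq> r" "par v = r" "w \<in> verts T" "w \<noteq> r"
  shows "\<not> cl v \<subset> cl w"
proof -
  obtain c where c: "{w \<in> verts T. w \<noteq> r \<and> par w = r} = {c}" "cl c = labels n - {l0}"
    using root_child by blast
  then have "v = c" using assms(1-3) by blast
  then have "cl v = labels n - {l0}" using c by simp
  then show ?thesis using l0_notin_cl[OF assms(4,5)] cl_sub[of w] by blast
qed

end

lemma leaf_rooted_exists:
  assumes "leaf_labelled_tree n T" "l \<in> labels n"
  shows "\<exists>par d. leaf_rooted T (leaf T l) par d n l"
proof -
  have "leaf T l \<in> verts T"
    using assms bij_betwE unfolding leaf_labelled_tree_def leaves_def by blast
  then obtain par d where "rooted (verts T) (leaf T l) par d" "rooted.E (verts T) (leaf T l) par = edges T"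
    using tree_rooted assms(1) unfolding leaf_labelled_tree_def by blast
  then have "leaf_rooted T (leaf T l) par d n l"
    using assms unfolding leaf_rooted_def leaf_rooted_axioms_def rooted_ltree_def rooted_ltree_axioms_def by simp
  then show ?thesis by blast
qed

text \<open>The isomorphism sends a vertex to the vertex with the same cluster. Parents are preserved
  because the cluster of a parent is the least cluster properly containing that of the child.\<close>

lemma labelled_iso_if_sides_eq:
  assumes T: "leaf_labelled_tree n T" and T': "leaf_labelled_tree n T'" and "l \<in> labels n"
    and sides: "sides n T = sides n T'"
  shows "labelled_iso n T T'"
proof -
  obtain par d where "leaf_rooted T (leaf T l) par d n l"
    using leaf_rooted_exists[OF T \<open>l \<in> labels n\<close>] by blast
  then interpret A: leaf_rooted T "leaf T l" par d n l .
  obtain par' d' where "leaf_rooted T' (leaf T' l) par' d' n l"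
    using leaf_rooted_exists[OF T' \<open>l \<in> labels n\<close>] by blast
  then interpret B: leaf_rooted T' "leaf T' l" par' d' n l .
  let ?r = "leaf T l" and ?r' = "leaf T' l"
  have bA: "bij_betw A.cl (verts T - {?r}) {C \<in> sides n T. l \<notin> C}"
    using A.cl_inj A.cl_image by (auto simp: bij_betw_def inj_on_def)
  have bB: "bij_betw B.cl (verts T' - {?r'}) {C \<in> sides n T. l \<notin> C}"
    using B.cl_inj B.cl_image sides by (auto simp: bij_betw_def inj_on_def)
  define \<psi> where "\<psi> = inv_into (verts T' - {?r'}) B.cl \<circ> A.cl"
  define \<phi> where "\<phi> v = (if v = ?r then ?r' else \<psi> v)" for v
  have b\<psi>: "bij_betw \<psi> (verts T - {?r}) (verts T' - {?r'})"
    unfolding \<psi>_def using bA bij_betw_inv_into[OF bB] by (rule bij_betw_trans)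
  then have b\<phi>0: "bij_betw \<phi> (verts T - {?r}) (verts T' - {?r'})"
    by (rule bij_betw_cong[THEN iffD1, rotated]) (simp add: \<phi>_def)
  have b\<phi>: "bij_betw \<phi> (verts T) (verts T')"
  proof -
    have "bij_betw \<phi> (insert ?r (verts T - {?r})) (insert ?r' (verts T' - {?r'}))"
      using b\<phi>0 notIn_Un_bij_betw[of ?r "verts T - {?r}" \<phi> "verts T' - {?r'}"] by (simp add: \<phi>_def)
    then show ?thesis using A.root B.root by (simp add: insert_absorb)
  qed
  have \<phi>: "\<phi> v \<in> verts T'" "\<phi> v \<noteq> ?r'" "B.cl (\<phi> v) = A.cl v" if "v \<in> verts T" "v \<noteq> ?r" for v
  proof -
    have "\<phi> v \<in> verts T' - {?r'}" using b\<phi>0 that bij_betwE by blast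
    then show "\<phi> v \<in> verts T'" "\<phi> v \<noteq> ?r'" by auto
    have "A.cl v \<in> B.cl ` (verts T' - {?r'})" using bA bB that by (auto simp: bij_betw_def)
    then show "B.cl (\<phi> v) = A.cl v" using that by (simp add: \<phi>_def \<psi>_def f_inv_into_f)
  qed
  have \<phi>r: "\<phi> ?r = ?r'" by (simp add: \<phi>_def)
  have onto: "\<exists>v\<in>verts T. v \<noteq> ?r \<and> \<phi> v = w" if "w \<in> verts T'" "w \<noteq> ?r'" for w
    proof -
    have "w \<in> \<phi> ` (verts T - {?r})" using b\<phi>0 that by (simp add: bij_betw_def)
    then show ?thesis by blast
  qed
  have par: "\<phi> (par v) = par' (\<phi> v)" if v: "v \<in> verts T" "v \<noteq> ?r" for v
  proof (cases "par v = ?r")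
    case True
    have "par' (\<phi> v) = ?r'"
    proof (rule ccontr)
      assume ne: "par' (\<phi> v) \<noteq> ?r'"
      have "par' (\<phi> v) \<in> verts T'" using B.par_in \<phi> v by blast
      then obtain u where u: "u \<in> verts T" "u \<noteq> ?r" "\<phi> u = par' (\<phi> v)" using onto ne by blast
      then have "A.cl v \<subset> A.cl u" using B.cl_par(1)[OF \<phi>(1,2)[OF v] ne] \<phi>(3) v by metis
      then show False using A.cl_par_root[OF v True u(1,2)] by blast
    qed
    then show ?thesis using True \<phi>r by simp
  next
    case False
    then have pv: "par v \<in> verts T" "A.cl v \<subset> A.cl (par v)" using A.par_in A.cl_par(1) v by auto
    have sub: "B.cl (\<phi> v) \<subset> B.cl (\<phi> (par v))" using \<phi>(3)[OF v] \<phi>(3)[OF pv(1) False] pv(2) by simp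
    have ne: "par' (\<phi> v) \<noteq> ?r'"
      using B.cl_par_root[OF \<phi>(1,2)[OF v] _ \<phi>(1,2)[OF pv(1) False]] sub by blast
    have p': "par' (\<phi> v) \<in> verts T'" using B.par_in \<phi> v by blast
    then obtain u where u: "u \<in> verts T" "u \<noteq> ?r" "\<phi> u = par' (\<phi> v)" using onto ne by blast
    have "B.cl (par' (\<phi> v)) \<subseteq> B.cl (\<phi> (par v))"
      using B.cl_par(2)[OF \<phi>(1,2)[OF v] ne \<phi>(1,2)[OF pv(1) False] sub] .
    moreover have "A.cl v \<subset> A.cl u"
      using B.cl_par(1)[OF \<phi>(1,2)[OF v] ne] \<phi>(3)[OF v] \<phi>(3)[OF u(1,2)] u(3) by simp
    then have "A.cl (par v) \<subseteq> A.cl u" using A.cl_par(2)[OF v False u(1,2)] by blast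
    ultimately have "A.cl (par v) = A.cl u" using \<phi>(3)[OF u(1,2)] \<phi>(3)[OF pv(1) False] u(3) by simp
    then show ?thesis using A.cl_inj[OF pv(1) False u(1,2)] u(3) by simp
  qed
  have "(\<lambda>e. \<phi> ` e) ` edges T = edges T'"
  proof -
    have "(\<lambda>e. \<phi> ` e) ` edges T = (\<lambda>v. {\<phi> v, par' (\<phi> v)}) ` (verts T - {?r})"
      unfolding A.edges_E A.E_def image_image by (rule image_cong) (use par in auto)
    also have "\<dots> = (\<lambda>w. {w, par' w}) ` \<phi> ` (verts T - {?r})" by (simp add: image_image)
    also have "\<dots> = edges T'" using b\<phi>0 unfolding B.edges_E B.E_def by (simp add: bij_betw_def)
    finally show ?thesis .
  qed
  moreover have "\<phi> (leaf T m) = leaf T' m" if m: "m \<in> labels n" for m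
  proof (cases "m = l")
    case False
    then have ne: "leaf T m \<noteq> ?r" "leaf T' m \<noteq> ?r'" using m A.leaf_inj B.leaf_inj A.l0 by auto
    have "B.cl (\<phi> (leaf T m)) = B.cl (leaf T' m)"
      using \<phi>(3) A.leaf_vert[OF m] A.cl_leaf[OF m ne(1)] B.cl_leaf[OF m ne(2)] ne by simp
    then show ?thesis
      using B.cl_inj \<phi>(1,2)[OF A.leaf_vert[OF m] ne(1)] B.leaf_vert[OF m] ne(2) by blast
  qed (simp add: \<phi>_def)
  ultimately show ?thesis using b\<phi> unfolding labelled_iso_def graph_iso_def by blast
qed

lemma leaf_labelled_tree_edges:
  "leaf_labelled_tree n T \<Longrightarrow> e \<in> edges T \<Longrightarrow> e \<subseteq> verts T \<and> card e = 2"
  by (auto simp: leaf_labelled_tree_def tree_def simple_graph_def)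

text \<open>One direction maps a walk forward; the other lifts it edge by edge, as every edge of
  \<open>T'\<close> is the image of an edge of \<open>T\<close>.\<close>

lemma reach_graph_iso:
  assumes iso: "graph_iso T T' \<phi>" and edges: "\<And>f. f \<in> edges T \<Longrightarrow> f \<subseteq> verts T \<and> card f = 2"
    and e: "e \<in> edges T" and x: "x \<in> verts T" and y: "y \<in> verts T"
  shows "(\<phi> x, \<phi> y) \<in> reach (edges T' - {\<phi> ` e}) \<longleftrightarrow> (x, y) \<in> reach (edges T - {e})"
proof -
  have inj: "inj_on \<phi> (verts T)" and im: "edges T' = (\<lambda>e. \<phi> ` e) ` edges T"
    using iso by (auto simp: graph_iso_def bij_betw_def)
  show ?thesis
  proof
    assume "(x, y) \<in> reach (edges T - {e})"
    then show "(\<phi> x, \<phi> y) \<in> reach (edges T' - {\<phi> ` e})"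
      unfolding reach_def
    proof (induction rule: rtrancl_induct)
      case (step a b)
      then have ab: "{a, b} \<in> edges T" "{a, b} \<noteq> e" by auto
      then have "\<phi> ` {a, b} \<noteq> \<phi> ` e" using inj_on_image_eq_iff[OF inj] edges e by meson
      moreover have "\<phi> ` {a, b} \<in> edges T'" using ab im by blast
      ultimately have "(\<phi> a, \<phi> b) \<in> {(u, v). {u, v} \<in> edges T' - {\<phi> ` e}}" by simp
      with step.IH show ?case by (rule rtrancl_into_rtrancl)
    qed simp
  next
    assume "(\<phi> x, \<phi> y) \<in> reach (edges T' - {\<phi> ` e})"
    \<comment> \<open>The induction lifts the end of the walk to some preimage \<open>z\<close>;
      injectivity identifies it with \<open>y\<close> afterwards.\<close>
    then have "\<exists>z\<in>verts T. \<phi> z = \<phi> y \<and> (x, z) \<in> reach (edges T - {e})"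
      unfolding reach_def
    proof (induction rule: rtrancl_induct)
      case base
      show ?case using x by blast
    next
      case (step a b)
      then obtain z where z: "z \<in> verts T" "\<phi> z = a" "(x, z) \<in> reach (edges T - {e})"
        by (auto simp: reach_def)
      from step.hyps(2) have "{a, b} \<in> edges T'" "{a, b} \<noteq> \<phi> ` e" by simp_all
      then obtain f where f: "f \<in> edges T" "\<phi> ` f = {a, b}" "{a, b} \<noteq> \<phi> ` e" unfolding im by (metis imageE)
      obtain u v where uv: "f = {u, v}" "u \<noteq> v" using edges[OF f(1)] by (auto simp: card_2_iff)
      have uvV: "u \<in> verts T" "v \<in> verts T" using edges[OF f(1)] uv by auto
      have "\<exists>w. f = {z, w} \<and> \<phi> w = b"
      proof -
        have "\<phi> u = a \<and> \<phi> v = b \<or> \<phi> u = b \<and> \<phi> v = a"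
          using f(2) uv by (auto simp: doubleton_eq_iff)
        then show ?thesis using inj uvV z(1,2) uv(1) by (metis inj_onD insert_commute)
      qed
      then obtain w where w: "f = {z, w}" "\<phi> w = b" by blast
      then have "{z, w} \<in> edges T - {e}" using f by auto
      then have "(x, w) \<in> reach (edges T - {e})" using z(3) by (meson reach_edge reach_trans)
      moreover have "w \<in> verts T" using w uv uvV by auto
      ultimately show ?case using w(2) by (auto simp: reach_def)
    qed
    then show "(x, y) \<in> reach (edges T - {e})" using inj y by (metis inj_onD)
  qed
qed

text \<open>The relabelling \<open>\<pi>\<close> is the identity when isomorphic labelled trees are
  compared, and \<open>swap\<close> when the involution acts on a single tree.\<close>

lemma split_of_graph_iso:
  assumes iso: "graph_iso T T' \<phi>" and T: "leaf_labelled_tree n T" and e: "e \<in> edges T"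
    and \<pi>: "bij_betw \<pi> (labels n) (labels n)"
    and leaf: "\<And>l. l \<in> labels n \<Longrightarrow> \<phi> (leaf T l) = leaf T' (\<pi> l)"
  shows "split_of n T' (\<phi> ` e) = (\<lambda>A. \<pi> ` A) ` split_of n T e"
proof -
  let ?R = "{(l, m). l \<in> labels n \<and> m \<in> labels n \<and> (leaf T l, leaf T m) \<in> reach (edges T - {e})}"
  let ?R' = "{(l, m). l \<in> labels n \<and> m \<in> labels n \<and> (leaf T' l, leaf T' m) \<in> reach (edges T' - {\<phi> ` e})}"
  have lv: "leaf T l \<in> verts T" if "l \<in> labels n" for l
    using T that bij_betwE unfolding leaf_labelled_tree_def leaves_def by blast
  have im: "\<pi> ` labels n = labels n" using \<pi> by (simp add: bij_betw_def)
  have iff: "(\<pi> l, \<pi> m) \<in> ?R' \<longleftrightarrow> (l, m) \<in> ?R" if "l \<in> labels n" "m \<in> labels n" for l m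
  proof -
    have "\<pi> l \<in> labels n" "\<pi> m \<in> labels n" using im that by auto
    moreover have "(leaf T' (\<pi> l), leaf T' (\<pi> m)) \<in> reach (edges T' - {\<phi> ` e}) \<longleftrightarrow>
        (leaf T l, leaf T m) \<in> reach (edges T - {e})"
      using reach_graph_iso[OF iso leaf_labelled_tree_edges[OF T] e lv[OF that(1)] lv[OF that(2)]]
        leaf that by simp
    ultimately show ?thesis using that by simp
  qed
  have cls: "?R' `` {\<pi> l} = \<pi> ` (?R `` {l})" if l: "l \<in> labels n" for l
  proof (intro set_eqI iffI)
    fix m assume m: "m \<in> ?R' `` {\<pi> l}"
    then have "m \<in> labels n" by simp
    then obtain k where k: "k \<in> labels n" "m = \<pi> k" using im by blast
    have "(\<pi> l, \<pi> k) \<in> ?R'" using m unfolding k(2) by (rule ImageE) simp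
    then have "(l, k) \<in> ?R" using iff[OF l k(1)] by blast
    then show "m \<in> \<pi> ` (?R `` {l})" using k by blast
  next
    fix m assume "m \<in> \<pi> ` (?R `` {l})"
    then obtain k where k: "m = \<pi> k" "(l, k) \<in> ?R" by blast
    then have "k \<in> labels n" by simp
    then have "(\<pi> l, m) \<in> ?R'" using iff[OF l] k by blast
    then show "m \<in> ?R' `` {\<pi> l}" by blast
  qed
  have "split_of n T' (\<phi> ` e) = (\<lambda>l. ?R' `` {l}) ` labels n"
    unfolding split_of_def quotient_def by blast
  also have "\<dots> = (\<lambda>l. ?R' `` {l}) ` \<pi> ` labels n" by (simp add: im)
  also have "\<dots> = (\<lambda>A. \<pi> ` A) ` (\<lambda>l. ?R `` {l}) ` labels n"
    unfolding image_image by (rule image_cong[OF refl cls])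
  also have "(\<lambda>l. ?R `` {l}) ` labels n = split_of n T e"
    unfolding split_of_def quotient_def by blast
  finally show ?thesis .
qed

lemma sides_graph_iso:
  assumes "graph_iso T T' \<phi>" "leaf_labelled_tree n T" "bij_betw \<pi> (labels n) (labels n)"
    and "\<And>l. l \<in> labels n \<Longrightarrow> \<phi> (leaf T l) = leaf T' (\<pi> l)"
  shows "sides n T' = (\<lambda>A. \<pi> ` A) ` sides n T"
proof -
  have "edges T' = (\<lambda>e. \<phi> ` e) ` edges T" using assms(1) by (simp add: graph_iso_def)
  then have "sides n T' = (\<Union>e\<in>edges T. split_of n T' (\<phi> ` e))" by (auto simp: sides_def)
  also have "\<dots> = (\<Union>e\<in>edges T. (\<lambda>A. \<pi> ` A) ` split_of n T e)"
    using split_of_graph_iso[OF assms(1,2) _ assms(3,4)] by auto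
  finally show ?thesis by (auto simp: sides_def)
qed

lemma labelled_iso_iff_sides:
  assumes "leaf_labelled_tree n T" "leaf_labelled_tree n T'" "1 \<le> n"
  shows "labelled_iso n T T' \<longleftrightarrow> sides n T = sides n T'"
proof
  assume "labelled_iso n T T'"
  then obtain \<phi> where "graph_iso T T' \<phi>" "\<And>l. l \<in> labels n \<Longrightarrow> \<phi> (leaf T l) = leaf T' (id l)"
    by (auto simp: labelled_iso_def)
  from sides_graph_iso[OF this(1) assms(1) bij_betw_id this(2)] show "sides n T = sides n T'" by simp
next
  have "Unprimed 1 \<in> labels n" using assms(3) by (simp add: labels_def)
  then show "sides n T = sides n T' \<Longrightarrow> labelled_iso n T T'"
    using labelled_iso_if_sides_eq assms by blast
qed

section \<open>Orbits of splits and the trunk\<close>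

text \<open>A side and its complement are both small only if they are mirror images of each other,
  that is, if the involution flips the edge.\<close>

definition small_sides :: "label set set \<Rightarrow> label set set" where
  "small_sides S = {A \<in> S. A \<inter> swap ` A = {}}"

definition trunk_sides :: "label set set \<Rightarrow> label set set" where
  "trunk_sides S = {A \<in> S. swap ` A = A}"

lemma card_eq_fibres:
  assumes "finite X" "\<And>a. a \<in> X \<Longrightarrow> card {b \<in> X. f b = f a} = m"
  shows "card X = m * card (f ` X)"
proof -
  have "card X = (\<Sum>y\<in>f ` X. sum (\<lambda>_. 1) {b \<in> X. f b = y})"
    using sum.image_gen[OF assms(1), of "\<lambda>_. 1 :: nat" f] by simp
  also have "\<dots> = (\<Sum>y\<in>f ` X. m)"
    by (rule sum.cong[OF refl]) (use assms(2) in auto)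
  finally show ?thesis by (simp add: mult.commute)
qed

lemma split_systemD:
  assumes "split_system n S" "A \<in> S"
  shows "A \<subseteq> labels n" "A \<noteq> {}" "labels n - A \<in> S" "labels n - (labels n - A) = A" "labels n - A \<noteq> {}"
proof -
  show "A \<subseteq> labels n" "A \<noteq> {}" and c: "labels n - A \<in> S"
    using assms by (simp_all add: split_system_def)
  then show "labels n - (labels n - A) = A" by (simp add: double_diff)
  have "\<forall>B\<in>S. B \<noteq> {}" using assms(1) by (simp add: split_system_def)
  with c show "labels n - A \<noteq> {}" by blast
qed

lemma split_system_compat:
  assumes "split_system n S" "A \<in> S" "B \<in> S"
  shows "A \<subseteq> B \<or> B \<subseteq> A \<or> A \<inter> B = {} \<or> A \<union> B = labels n"
  using assms unfolding split_system_def by blast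

lemma swap_compl: "swap ` (labels n - A) = labels n - swap ` A"
  by (simp add: swap_image_Diff)

lemma split_system_finite: "split_system n S \<Longrightarrow> finite S"
  by (rule finite_subset[of _ "Pow (labels n)"]) (auto simp: split_system_def)

text \<open>This is compatibility of \<open>A\<close> with its own mirror image: both have the same
  finite size, so an inclusion between them is an equality.\<close>

lemma split_system_cases:
  assumes S: "split_system n S" and swap_closed: "\<And>A. A \<in> S \<Longrightarrow> swap ` A \<in> S" and A: "A \<in> S"
  shows "A \<in> trunk_sides S \<or> A \<in> small_sides S \<or> labels n - A \<in> small_sides S"
proof -
  have fin: "finite A" using split_systemD(1)[OF S A] finite_labels finite_subset by blast
  have eq: "swap ` A = A" if "A \<subseteq> swap ` A \<or> swap ` A \<subseteq> A"
    using that card_subset_eq[of "swap ` A" A] card_subset_eq[of A "swap ` A"] fin by auto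
  from split_system_compat[OF S A swap_closed[OF A]]
  consider "swap ` A = A" | "A \<inter> swap ` A = {}" | "A \<union> swap ` A = labels n" using eq by blast
  then show ?thesis
  proof cases
    case 3
    then have "(labels n - A) \<inter> swap ` (labels n - A) = {}" unfolding swap_compl by blast
    then show ?thesis using split_systemD(3)[OF S A] by (simp add: small_sides_def)
  qed (use A in \<open>auto simp: trunk_sides_def small_sides_def\<close>)
qed

text \<open>Every orbit of nontrivial splits has exactly two sides that are either swap-invariant or
  disjoint from their mirror image.\<close>

lemma card_split_orbits:
  assumes S: "split_system n S" and swap_closed: "\<And>A. A \<in> S \<Longrightarrow> swap ` A \<in> S"
  shows "2 * card ((\<lambda>s. {s, swap_split s}) ` {{A, labels n - A} | A. A \<in> S \<and> 2 \<le> card A \<and> 2 \<le> card (labels n - A)})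
      + 2 * n = card (trunk_sides S) + card (small_sides S)"
proof -
  define c where "c A = labels n - A" for A
  \<comment> \<open>\<open>f A\<close> is the orbit of the split with side \<open>A\<close>. Its
    possible sides are \<open>A\<close>, its mirror image and the complements of these two. Within
    \<open>X\<close> each fibre has two elements: a trunk side with its complement, or a small side
    with its mirror image.\<close>
  define f where "f A = {{A, c A}, {swap ` A, c (swap ` A)}}" for A
  define S2 where "S2 = {A \<in> S. 2 \<le> card A \<and> 2 \<le> card (c A)}"
  define X where "X = trunk_sides S \<union> {A \<in> small_sides S. 2 \<le> card A}"
  have cc: "c (c A) = A" and cS: "c A \<in> S" and ne: "A \<noteq> {}" and sub: "A \<subseteq> labels n" and finA: "finite A"
    if "A \<in> S" for A
    using split_systemD[OF S that] finite_subset[OF _ finite_labels] by (simp_all add: c_def)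
  have swc: "swap ` c A = c (swap ` A)" for A by (simp add: c_def swap_compl)
  have finS: "finite S" using S by (rule split_system_finite)
  have fc: "f (c A) = f A" if "A \<in> S" for A
    using cc[OF that] cc[OF swap_closed[OF that]] by (simp add: f_def swc insert_commute)
  have fs: "f (swap ` A) = f A" for A by (simp add: f_def insert_commute)
  have "{{A, labels n - A} | A. A \<in> S \<and> 2 \<le> card A \<and> 2 \<le> card (labels n - A)} = (\<lambda>A. {A, c A}) ` S2"
    by (auto simp: S2_def c_def)
  then have orb: "(\<lambda>s. {s, swap_split s}) ` {{A, labels n - A} | A. A \<in> S \<and> 2 \<le> card A \<and> 2 \<le> card (labels n - A)} = f ` S2"
    by (simp add: image_image f_def swap_split_def swc)
  have inv2: "2 \<le> card A" if "A \<in> trunk_sides S" for A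
  proof -
    have A: "A \<in> S" "swap ` A = A" using that by (auto simp: trunk_sides_def)
    obtain x where "x \<in> A" using ne[OF A(1)] by blast
    then have "{x, swap x} \<subseteq> A" using A(2) by blast
    then have "card {x, swap x} \<le> card A" using finA[OF A(1)] by (intro card_mono)
    then show ?thesis by simp
  qed
  have cTr: "c A \<in> trunk_sides S" if "A \<in> trunk_sides S" for A
    using that cS by (auto simp: trunk_sides_def swc)
  have SmS: "A \<in> S" "A \<inter> swap ` A = {}" "A \<noteq> {}" if "A \<in> small_sides S" for A
    using that ne by (auto simp: small_sides_def)
  have swSm: "swap ` A \<in> small_sides S" if "A \<in> small_sides S" for A
    using that swap_closed by (auto simp: small_sides_def)
  have TrS: "A \<in> S" "swap ` A = A" if "A \<in> trunk_sides S" for A using that by (auto simp: trunk_sides_def)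
  have c2: "2 \<le> card (c A)" if "A \<in> small_sides S" "2 \<le> card A" for A
  proof -
    have "swap ` A \<subseteq> c A" using SmS(2)[OF that(1)] sub[OF swap_closed[OF SmS(1)[OF that(1)]]] by (auto simp: c_def)
    then have "card (swap ` A) \<le> card (c A)" by (intro card_mono) (auto simp: c_def)
    then show ?thesis using that(2) by simp
  qed
  have XS2: "X \<subseteq> S2"
    using inv2 cTr c2 TrS SmS by (auto simp: X_def S2_def)
  have "f ` S2 \<subseteq> f ` X"
  proof
    fix y assume "y \<in> f ` S2"
    then obtain A where A: "A \<in> S2" "y = f A" by blast
    then have "A \<in> S" "2 \<le> card A" "2 \<le> card (c A)" by (auto simp: S2_def)
    moreover from split_system_cases[OF S swap_closed \<open>A \<in> S\<close>]
    have "A \<in> trunk_sides S \<or> A \<in> small_sides S \<or> c A \<in> small_sides S" by (simp add: c_def)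
    ultimately have "A \<in> X \<or> c A \<in> X" by (auto simp: X_def)
    then show "y \<in> f ` X" using A(2) fc[OF \<open>A \<in> S\<close>] by (metis imageI)
  qed
  then have fX: "f ` S2 = f ` X" using XS2 by blast
  have fB: "B = A \<or> B = c A \<or> B = swap ` A \<or> B = c (swap ` A)" if "f B = f A" for A B
  proof -
    have "B \<in> \<Union> (f B)" by (simp add: f_def)
    then have "B \<in> \<Union> (f A)" by (simp only: that)
    then show ?thesis by (auto simp: f_def)
  qed
  have "card {B \<in> X. f B = f A} = 2" if AX: "A \<in> X" for A
  proof (cases "A \<in> trunk_sides S")
    case True
    have "{B \<in> X. f B = f A} = {A, c A}"
      using fB[of _ A] fc[OF TrS(1)[OF True]] TrS(2)[OF True] cTr[OF True] True by (auto simp: X_def)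
    moreover have "A \<noteq> c A" using ne[OF TrS(1)[OF True]] by (auto simp: c_def)
    ultimately show ?thesis by simp
  next
    case False
    then have Sm: "A \<in> small_sides S" "2 \<le> card A" using AX by (auto simp: X_def)
    \<comment> \<open>If the complement of the small side \<open>B\<close> also lies in
      \<open>X\<close>, the edge is flipped and the complement is the mirror image, so the fibre
      does not grow.\<close>
    have key: "c B = swap ` B" if B: "B \<in> small_sides S" "c B \<in> X" for B
    proof -
      have "c B \<notin> trunk_sides S"
      proof
        assume "c B \<in> trunk_sides S"
        then have "B \<in> trunk_sides S" using cTr cc SmS(1)[OF B(1)] by metis
        then show False using TrS(2) SmS(2,3)[OF B(1)] by blast
      qed
      then have "c B \<in> small_sides S" using B(2) by (auto simp: X_def)
      then have "c B \<inter> c (swap ` B) = {}" using SmS(2) swc by metis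
      then show ?thesis using SmS[OF B(1)] sub[OF swap_closed[OF SmS(1)[OF B(1)]]] by (auto simp: c_def)
    qed
    have "B = A \<or> B = swap ` A" if B: "B \<in> X" "f B = f A" for B
    proof -
      consider "B = A" | "B = swap ` A" | "B = c A" | "B = c (swap ` A)" using fB[OF B(2)] by blast
      then show ?thesis
        using key[OF Sm(1)] key[OF swSm[OF Sm(1)]] B(1) by cases auto
    qed
    moreover have "swap ` A \<in> X" using swSm[OF Sm(1)] Sm(2) by (simp add: X_def)
    ultimately have "{B \<in> X. f B = f A} = {A, swap ` A}" using AX fs by blast
    moreover have "A \<noteq> swap ` A" using SmS(2,3)[OF Sm(1)] by blast
    ultimately show ?thesis by simp
  qed
  moreover have finX: "finite X" using finS by (auto simp: X_def trunk_sides_def small_sides_def)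
  ultimately have "card X = 2 * card (f ` X)" using card_eq_fibres[of X f 2] by blast
  moreover have "card X = card (trunk_sides S) + card {A \<in> small_sides S. 2 \<le> card A}"
    unfolding X_def
  proof (rule card_Un_disjoint)
    show "finite (trunk_sides S)" "finite {A \<in> small_sides S. 2 \<le> card A}" using finS by (simp_all add: trunk_sides_def small_sides_def)
    show "trunk_sides S \<inter> {A \<in> small_sides S. 2 \<le> card A} = {}"
    proof (rule equals0I)
      fix A assume "A \<in> trunk_sides S \<inter> {A \<in> small_sides S. 2 \<le> card A}"
      then have "A \<in> trunk_sides S" "A \<in> small_sides S" by simp_all
      then show False using TrS(2)[of A] SmS(2,3)[of A] by simp
    qed
  qed
  \<comment> \<open>The one-element small sides belong to pendant edges and account for the summand
    \<open>2 * n\<close>.\<close>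
  moreover have "card (small_sides S) = card {A \<in> small_sides S. 2 \<le> card A} + card ((\<lambda>l. {l}) ` labels n)"
  proof -
    have one: "A \<in> (\<lambda>l. {l}) ` labels n" if A: "A \<in> small_sides S" "\<not> 2 \<le> card A" for A
    proof -
      have "card A \<noteq> 0" using SmS[OF A(1)] finA by auto
      then have "card A = 1" using A(2) by simp
      then obtain l where "A = {l}" by (auto simp: card_1_singleton_iff)
      then show ?thesis using sub[OF SmS(1)[OF A(1)]] by auto
    qed
    have "{l} \<in> small_sides S" if "l \<in> labels n" for l
      using that S by (auto simp: small_sides_def split_system_def)
    then have "small_sides S = {A \<in> small_sides S. 2 \<le> card A} \<union> (\<lambda>l. {l}) ` labels n" using one by blast
    moreover have "card ({A \<in> small_sides S. 2 \<le> card A} \<union> (\<lambda>l. {l}) ` labels n)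
        = card {A \<in> small_sides S. 2 \<le> card A} + card ((\<lambda>l. {l}) ` labels n)"
      by (rule card_Un_disjoint) (use finS in \<open>auto simp: small_sides_def\<close>)
    ultimately show ?thesis by simp
  qed
  moreover have "card ((\<lambda>l. {l}) ` labels n) = 2 * n" by (subst card_image) auto
  ultimately show ?thesis unfolding orb fX by simp
qed

section \<open>The trunk as a path, and what this excludes for invariant sides\<close>

text \<open>If \<open>g\<close> were at most \<open>c\<close> at both ends, the intermediate value
  theorem would give a point of level \<open>c\<close> on either side of \<open>s\<close>. By
  uniqueness both equal \<open>s\<close>, where \<open>g\<close> exceeds \<open>c\<close>.\<close>

lemma interval_level:
  fixes g :: "real \<Rightarrow> real"
  assumes g: "continuous_on {a..b} g" and "s \<in> {a..b}" "g s > c"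
    and unique: "\<And>x y. x \<in> {a..b} \<Longrightarrow> y \<in> {a..b} \<Longrightarrow> g x = c \<Longrightarrow> g y = c \<Longrightarrow> x = y"
  shows "g a > c \<or> g b > c"
proof (rule ccontr)
  assume "\<not> (g a > c \<or> g b > c)"
  then have le: "g a \<le> c" "g b \<le> c" by auto
  have "continuous_on {a..s} g" "continuous_on {s..b} g"
    using g assms(2) by (auto intro: continuous_on_subset)
  then obtain x y where "a \<le> x" "x \<le> s" "g x = c" "s \<le> y" "y \<le> b" "g y = c"
    using IVT'[of g a c s] IVT2'[of g b c s] le assms(2,3) by auto
  then have "x = y" using unique assms(2) by auto
  then show False using \<open>x \<le> s\<close> \<open>s \<le> y\<close> \<open>g x = c\<close> assms(3) by auto
qed

lemma is_pathE:
  assumes "is_path X"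
  obtains a b \<gamma> where "a \<le> b" "continuous_on {a..b :: real} \<gamma>" "\<gamma> ` {a..b} = X" "inj_on \<gamma> {a..b}"
proof -
  obtain a b :: real where ab: "a \<le> b" "X homeomorphic {a..b}" using assms by (auto simp: is_path_def)
  then obtain f g where "homeomorphism {a..b} X f g"
    using homeomorphic_def homeomorphic_sym by metis
  then show ?thesis
    using that[of a b f] ab(1) unfolding homeomorphism_def by (metis inj_on_inverseI)
qed

context leaf_rooted
begin

text \<open>An edge is determined by its split, so an invariant split makes \<open>\<sigma>\<close>
  preserve the edge. It does not exchange the ends: that would move the leaf of a label in
  \<open>cl v\<close> above the edge, while the mirror label is again in
  \<open>cl v\<close>.\<close>

lemma trunk_side:
  assumes iso: "graph_iso T T \<sigma>" and leaf: "\<forall>l\<in>labels n. \<sigma> (leaf T l) = leaf T (swap l)"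
    and v: "v \<in> verts T" "v \<noteq> r" and inv: "swap ` cl v = cl v"
  shows "\<sigma> v = v" "\<sigma> (par v) = par v"
proof -
  have inj: "inj_on \<sigma> (verts T)" and im: "edges T = (\<lambda>e. \<sigma> ` e) ` edges T"
    using iso by (auto simp: graph_iso_def bij_betw_def)
  have bij: "bij_betw swap (labels n) (labels n)" by (simp add: bij_betw_def inj_swap)
  have sp: "split_of n T {v, par v} = {cl v, labels n - cl v}" if "v \<in> verts T" "v \<noteq> r" for v
    using that cl_nonempty l0_notin_cl l0 by (intro split_of_cl) blast+
  have e: "{v, par v} \<in> edges T" using v by (auto simp: edges_E E_def)
  then have "\<sigma> ` {v, par v} \<in> edges T" using im by blast
  then obtain w where w: "w \<in> verts T" "w \<noteq> r" "\<sigma> ` {v, par v} = {w, par w}"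
    by (auto simp: edges_E E_def)
  have "split_of n T (\<sigma> ` {v, par v}) = (\<lambda>A. swap ` A) ` split_of n T {v, par v}"
    using split_of_graph_iso[OF iso lt e bij bspec[OF leaf]] .
  then have "{cl w, labels n - cl w} = {cl v, labels n - cl v}"
    using sp[OF w(1,2)] sp[OF v] w(3) inv by (simp add: swap_compl)
  then have "cl w = cl v" using l0_notin_cl[OF v] l0_notin_cl[OF w(1,2)] l0
    by (auto simp: doubleton_eq_iff)
  then have wv: "w = v" using cl_inj v w by blast
  have pv: "par v \<in> verts T" using v par_in by blast
  have "\<sigma> v \<noteq> par v"
  proof
    assume \<sigma>v: "\<sigma> v = par v"
    obtain l where l: "l \<in> cl v" using cl_nonempty[OF v] by blast
    then have ll: "l \<in> labels n" "leaf T l \<in> desc v" by (auto simp: cl_def)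
    have "swap l \<in> cl v" using l inv by blast
    then have sl: "leaf T (swap l) \<in> desc v" by (simp add: cl_def)
    have "(leaf T l, v) \<in> reach (edges T - {{v, par v}})"
      using reach_cut[OF v leaf_vert[OF ll(1)] v(1)] ll(2) desc_self[OF v(1)] by (simp add: edges_E)
    then have "(\<sigma> (leaf T l), \<sigma> v) \<in> reach (edges T - {\<sigma> ` {v, par v}})"
      using reach_graph_iso[OF iso leaf_labelled_tree_edges[OF lt] e leaf_vert[OF ll(1)] v(1)] by simp
    then have "(leaf T (swap l), par v) \<in> reach (E - {{v, par v}})"
      using bspec[OF leaf ll(1)] \<sigma>v w(3) wv by (simp add: edges_E)
    then have "par v \<in> desc v"
      using reach_cut[OF v leaf_vert pv, of "swap l"] ll(1) sl by simp
    then show False using par_notin_desc[OF v] by blast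
  qed
  then show "\<sigma> v = v" using w(3) wv by auto
  then show "\<sigma> (par v) = par v" using w(3) wv par_neq[OF v] inj v(1) pv
    by (metis doubleton_eq_iff image_empty image_insert)
qed

text \<open>\<open>W\<close> is the component carrying the labels \<open>A\<close> after removal of
  the edge \<open>{q, q'}\<close>. Stating this with \<open>W\<close> treats sides with and without
  \<open>l0\<close> alike, although only the latter are clusters.\<close>

lemma trunk_component:
  assumes iso: "graph_iso T T \<sigma>" and leaf: "\<forall>l\<in>labels n. \<sigma> (leaf T l) = leaf T (swap l)"
    and A: "A \<in> trunk_sides (sides n T)"
  shows "\<exists>W q q'. W \<subseteq> verts T \<and> q \<in> W \<and> q' \<notin> W \<and> \<sigma> q = q \<and>
    (\<forall>f\<in>edges T. f = {q, q'} \<or> f \<subseteq> W \<or> f \<inter> W = {}) \<and>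
    (\<exists>v\<in>verts T. v \<noteq> r \<and> (A = cl v \<and> W = desc v \<or> A = labels n - cl v \<and> W = verts T - desc v))"
proof -
  obtain v where v: "v \<in> verts T" "v \<noteq> r" "A = cl v \<or> A = labels n - cl v"
    using A sides_eq by (auto simp: trunk_sides_def)
  have "swap ` A = A" using A by (simp add: trunk_sides_def)
  then have inv: "swap ` cl v = cl v"
    using v(3) cl_sub[of v] by (metis double_diff subset_refl swap_compl)
  have pv: "par v \<in> verts T" "par v \<notin> desc v" "v \<in> desc v" using v par_in par_notin_desc desc_self by auto
  have fixed: "\<sigma> v = v" "\<sigma> (par v) = par v" using trunk_side[OF iso leaf v(1,2) inv] by auto
  have D: "f = {v, par v} \<or> f \<subseteq> desc v \<or> f \<inter> desc v = {} \<and> f \<subseteq> verts T" if f: "f \<in> edges T" for f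
  proof -
    obtain w where w: "w \<in> verts T" "w \<noteq> r" "f = {w, par w}" using f by (auto simp: edges_E E_def)
    then show ?thesis using desc_step[OF w(1,2), of v] par_in[OF w(1,2)] by (cases "w = v") auto
  qed
  show ?thesis
  proof (cases "A = cl v")
    case True
    have "\<forall>f\<in>edges T. f = {v, par v} \<or> f \<subseteq> desc v \<or> f \<inter> desc v = {}" using D by blast
    moreover have "\<exists>w\<in>verts T. w \<noteq> r \<and> (A = cl w \<and> desc v = desc w \<or> A = labels n - cl w \<and> desc v = verts T - desc w)"
      using True v by blast
    ultimately show ?thesis using pv fixed desc_sub[of v]
      by (intro exI[of _ "desc v"] exI[of _ v] exI[of _ "par v"] conjI)
  next
    case False
    have "\<forall>f\<in>edges T. f = {par v, v} \<or> f \<subseteq> verts T - desc v \<or> f \<inter> (verts T - desc v) = {}"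
    proof
      fix f assume "f \<in> edges T"
      then show "f = {par v, v} \<or> f \<subseteq> verts T - desc v \<or> f \<inter> (verts T - desc v) = {}"
        using D[of f] by blast
    qed
    moreover have "\<exists>w\<in>verts T. w \<noteq> r \<and> (A = cl w \<and> verts T - desc v = desc w \<or> A = labels n - cl w \<and> verts T - desc v = verts T - desc w)"
      using False v by blast
    moreover have "par v \<in> verts T - desc v" "v \<notin> verts T - desc v" "verts T - desc v \<subseteq> verts T"
      using pv by auto
    ultimately show ?thesis using fixed
      by (intro exI[of _ "verts T - desc v"] exI[of _ "par v"] exI[of _ v] conjI)
  qed
qed

text \<open>Relations between clusters carry over to the vertex sets by
  \<open>cl_subset_desc\<close> and laminarity. Two sides that both contain \<open>l0\<close> cannot
  be disjoint, which settles the last case.\<close>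

lemma trunk_components_disjoint:
  assumes "v \<in> verts T" "v \<noteq> r" "A = cl v \<and> W = desc v \<or> A = labels n - cl v \<and> W = verts T - desc v"
    and "w \<in> verts T" "w \<noteq> r" "B = cl w \<and> U = desc w \<or> B = labels n - cl w \<and> U = verts T - desc w"
    and "A \<inter> B = {}"
  shows "W \<inter> U = {}"
proof -
  have disj: "desc x \<inter> desc y = {}" if "x \<in> verts T" "x \<noteq> r" "y \<in> verts T" "y \<noteq> r" "cl x \<inter> cl y = {}" for x y
    using that desc_laminar[of x y] cl_mono[of x y] cl_mono[of y x] cl_nonempty by blast
  have sub: "desc x \<subseteq> desc y" if "x \<in> verts T" "x \<noteq> r" "y \<in> verts T" "y \<noteq> r" "cl x \<inter> (labels n - cl y) = {}" for x y
    using that cl_subset_desc[of x y] cl_sub[of x] by blast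
  have l0: "l0 \<in> labels n - cl v" "l0 \<in> labels n - cl w" using l0 l0_notin_cl assms by auto
  from assms(3,6) show ?thesis
  proof (elim disjE conjE)
    assume "A = cl v" "W = desc v" "B = cl w" "U = desc w"
    then show ?thesis using disj[OF assms(1,2,4,5)] assms(7) by simp
  next
    assume "A = cl v" "W = desc v" "B = labels n - cl w" "U = verts T - desc w"
    then show ?thesis using sub[OF assms(1,2,4,5)] assms(7) by auto
  next
    assume "A = labels n - cl v" "W = verts T - desc v" "B = cl w" "U = desc w"
    then show ?thesis using sub[OF assms(4,5,1,2)] assms(7) by auto
  next
    assume "A = labels n - cl v" "B = labels n - cl w"
    then show ?thesis using l0 assms(7) by blast
  qed
qed

text \<open>The total mass on the far side of a trunk edge is a continuous function on the trunk that
  takes the value \<open>1/2\<close> only at the midpoint of that edge. So it exceeds \<open>1/2\<close> at one of the two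
  ends of the trunk, which can happen for at most two disjoint sides.\<close>

lemma trunk_no_three_disjoint:
  assumes iso: "graph_iso T T \<sigma>" and leaf: "\<forall>l\<in>labels n. \<sigma> (leaf T l) = leaf T (swap l)"
    and path: "is_path (fixed_points T \<sigma>)"
    and A: "A \<in> trunk_sides (sides n T)" "B \<in> trunk_sides (sides n T)" "C \<in> trunk_sides (sides n T)"
      "A \<inter> B = {}" "A \<inter> C = {}" "B \<inter> C = {}"
  shows False
proof -
  obtain a b :: real and \<gamma> where \<gamma>: "a \<le> b" "continuous_on {a..b} \<gamma>"
      "\<gamma> ` {a..b} = fixed_points T \<sigma>" "inj_on \<gamma> {a..b}"
    using is_pathE[OF path] by metis
  have inj: "inj_on \<sigma> (verts T)" using iso by (simp add: graph_iso_def bij_betw_def)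
  have ends: "sum (\<gamma> a) W > 1 / 2 \<or> sum (\<gamma> b) W > 1 / 2"
    if W: "W \<subseteq> verts T" "q \<in> W" "q' \<notin> W" "\<sigma> q = q"
      and f: "\<forall>f\<in>edges T. f = {q, q'} \<or> f \<subseteq> W \<or> f \<inter> W = {}" for W q q'
  proof -
    have finW: "finite W" using W(1) fin finite_subset by blast
    have "continuous_on {a..b} (\<lambda>t. \<gamma> t w)" for w
      using \<gamma>(2) by (rule continuous_on_product_then_coordinatewise)
    then have cont: "continuous_on {a..b} (\<lambda>t. sum (\<gamma> t) W)" by (intro continuous_on_sum)
    have mid: "p = (\<lambda>x. if x = q \<or> x = q' then 1 / 2 else 0)"
      if p: "p \<in> fixed_points T \<sigma>" "sum p W = 1 / 2" for p
    proof -
      have p1: "sum p (verts T) = 1" and supp: "{x. p x \<noteq> 0} \<in> (\<lambda>v. {v}) ` verts T \<union> edges T"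
        using p(1) by (auto simp: fixed_points_def realization_def)
      define F where "F = {x. p x \<noteq> 0}"
      have Fv: "F \<subseteq> verts T"
      proof -
        have "F \<in> (\<lambda>v. {v}) ` verts T \<union> edges T" using supp by (simp add: F_def)
        then show ?thesis using leaf_labelled_tree_edges[OF lt] by blast
      qed
      have sF: "sum p W = sum p (W \<inter> F)"
        by (rule sum.mono_neutral_right) (use finW in \<open>auto simp: F_def\<close>)
      have sV: "sum p F = 1"
        using p1 sum.mono_neutral_right[OF fin Fv, of p] by (auto simp: F_def)
      \<comment> \<open>If the support is not the crossing edge, it lies inside \<open>W\<close> or
        misses \<open>W\<close>, so the mass on \<open>W\<close> is 1 or 0.\<close>
      have "F = {q, q'}"
      proof (rule ccontr)
        assume "F \<noteq> {q, q'}"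
        moreover have "F \<in> (\<lambda>v. {v}) ` verts T \<union> edges T" using supp by (simp add: F_def)
        ultimately have "F \<subseteq> W \<or> F \<inter> W = {}" using f by blast
        then have "W \<inter> F = F \<or> W \<inter> F = {}" by blast
        then show False using sF sV p(2) by auto
      qed
      moreover from this have "W \<inter> F = {q}" using W by blast
      moreover have "q \<noteq> q'" using W by blast
      ultimately have "p q = 1 / 2" "p q + p q' = 1" using sF sV p(2) \<open>q \<noteq> q'\<close> by auto
      then have "p q' = 1 / 2" by simp
      moreover have "p x = 0" if "x \<noteq> q" "x \<noteq> q'" for x using \<open>F = {q, q'}\<close> that F_def by blast
      ultimately show ?thesis using \<open>p q = 1 / 2\<close> by auto
    qed
    \<comment> \<open>The vertex \<open>q\<close> is itself a point of the trunk with all its mass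
      in \<open>W\<close>, so the level \<open>1 / 2\<close> is exceeded somewhere.\<close>
    have "(\<lambda>x. if x = q then 1 else 0 :: real) \<in> fixed_points T \<sigma>"
    proof -
      have q: "q \<in> verts T" using W by blast
      then have "\<sigma> v = q \<longleftrightarrow> v = q" if "v \<in> verts T" for v
        using inj W(4) that by (metis inj_onD)
      then show ?thesis using q fin by (auto simp: fixed_points_def realization_def)
    qed
    then obtain s where s: "s \<in> {a..b}" "\<gamma> s = (\<lambda>x. if x = q then 1 else 0)"
      using \<gamma>(3) by (metis (no_types, lifting) imageE)
    then have "sum (\<gamma> s) W = 1" using W finW by simp
    moreover have "x = y"
      if "x \<in> {a..b}" "y \<in> {a..b}" "sum (\<gamma> x) W = 1 / 2" "sum (\<gamma> y) W = 1 / 2" for x y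
      using mid[of "\<gamma> x"] mid[of "\<gamma> y"] that \<gamma>(3,4) by (metis (no_types, lifting) image_eqI inj_onD)
    ultimately show ?thesis using interval_level[OF cont s(1), of "1 / 2"] by simp
  qed
  have le: "sum (\<gamma> t) W + sum (\<gamma> t) U \<le> 1"
    if "t \<in> {a..b}" "W \<subseteq> verts T" "U \<subseteq> verts T" "W \<inter> U = {}" for t W U
  proof -
    have "\<gamma> t \<in> realization T" using \<gamma>(3) that(1) by (auto simp: fixed_points_def)
    then have g: "\<And>x. 0 \<le> \<gamma> t x" "sum (\<gamma> t) (verts T) = 1" by (auto simp: realization_def)
    have "sum (\<gamma> t) W + sum (\<gamma> t) U = sum (\<gamma> t) (W \<union> U)"
      by (rule sum.union_disjoint[symmetric]) (use that fin finite_subset in auto)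
    also have "\<dots> \<le> sum (\<gamma> t) (verts T)" by (rule sum_mono2) (use that fin g in auto)
    finally show ?thesis using g(2) by simp
  qed
  have ab: "a \<in> {a..b}" "b \<in> {a..b}" using \<gamma>(1) by auto
  obtain W1 q1 q1' v1 where 1: "W1 \<subseteq> verts T" "q1 \<in> W1" "q1' \<notin> W1" "\<sigma> q1 = q1"
    "\<forall>f\<in>edges T. f = {q1, q1'} \<or> f \<subseteq> W1 \<or> f \<inter> W1 = {}"
    "v1 \<in> verts T" "v1 \<noteq> r" "A = cl v1 \<and> W1 = desc v1 \<or> A = labels n - cl v1 \<and> W1 = verts T - desc v1"
    using trunk_component[OF iso leaf A(1)] by (elim exE conjE bexE) (rule that; assumption)
  obtain W2 q2 q2' v2 where 2: "W2 \<subseteq> verts T" "q2 \<in> W2" "q2' \<notin> W2" "\<sigma> q2 = q2"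
    "\<forall>f\<in>edges T. f = {q2, q2'} \<or> f \<subseteq> W2 \<or> f \<inter> W2 = {}"
    "v2 \<in> verts T" "v2 \<noteq> r" "B = cl v2 \<and> W2 = desc v2 \<or> B = labels n - cl v2 \<and> W2 = verts T - desc v2"
    using trunk_component[OF iso leaf A(2)] by (elim exE conjE bexE) (rule that; assumption)
  obtain W3 q3 q3' v3 where 3: "W3 \<subseteq> verts T" "q3 \<in> W3" "q3' \<notin> W3" "\<sigma> q3 = q3"
    "\<forall>f\<in>edges T. f = {q3, q3'} \<or> f \<subseteq> W3 \<or> f \<inter> W3 = {}"
    "v3 \<in> verts T" "v3 \<noteq> r" "C = cl v3 \<and> W3 = desc v3 \<or> C = labels n - cl v3 \<and> W3 = verts T - desc v3"
    using trunk_component[OF iso leaf A(3)] by (elim exE conjE bexE) (rule that; assumption)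
  have "W1 \<inter> W2 = {}" using trunk_components_disjoint[OF 1(6-8) 2(6-8) A(4)] .
  then have l12: "sum (\<gamma> t) W1 + sum (\<gamma> t) W2 \<le> 1" if "t \<in> {a..b}" for t using le that 1(1) 2(1) by blast
  have "W1 \<inter> W3 = {}" using trunk_components_disjoint[OF 1(6-8) 3(6-8) A(5)] .
  then have l13: "sum (\<gamma> t) W1 + sum (\<gamma> t) W3 \<le> 1" if "t \<in> {a..b}" for t using le that 1(1) 3(1) by blast
  have "W2 \<inter> W3 = {}" using trunk_components_disjoint[OF 2(6-8) 3(6-8) A(6)] .
  then have l23: "sum (\<gamma> t) W2 + sum (\<gamma> t) W3 \<le> 1" if "t \<in> {a..b}" for t using le that 2(1) 3(1) by blast
  show False
    using ends[OF 1(1-5)] ends[OF 2(1-5)] ends[OF 3(1-5)]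
      l12[OF ab(1)] l12[OF ab(2)] l13[OF ab(1)] l13[OF ab(2)] l23[OF ab(1)] l23[OF ab(2)]
    by - (elim disjE; linarith)
qed

end

section \<open>Codes of symbic trees\<close>

datatype bt = Lf label | Nd bt bt

fun leaf_set :: "bt \<Rightarrow> label set" where
  "leaf_set (Lf a) = {a}"
| "leaf_set (Nd s t) = leaf_set s \<union> leaf_set t"

fun clusters :: "bt \<Rightarrow> label set set" where
  "clusters (Lf a) = {{a}}"
| "clusters (Nd s t) = insert (leaf_set s \<union> leaf_set t) (clusters s \<union> clusters t)"

fun index :: "label \<Rightarrow> nat" where
  "index (Unprimed i) = i"
| "index (Primed i) = i"

text \<open>The leaf word without colours. Its distinctness expresses two conditions at once: no
  label is repeated, and no label occurs together with its mirror image.\<close>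

fun indices :: "bt \<Rightarrow> nat list" where
  "indices (Lf a) = [index a]"
| "indices (Nd s t) = indices s @ indices t"

fun primed :: "label \<Rightarrow> bool" where
  "primed (Unprimed i) = False"
| "primed (Primed i) = True"

fun cherry_ok :: "bt \<Rightarrow> bt \<Rightarrow> bool" where
  "cherry_ok (Lf a) (Lf b) \<longleftrightarrow> primed a \<noteq> primed b"
| "cherry_ok s t \<longleftrightarrow> True"

fun no_mono_cherry :: "bt \<Rightarrow> bool" where
  "no_mono_cherry (Lf a) \<longleftrightarrow> True"
| "no_mono_cherry (Nd s t) \<longleftrightarrow> no_mono_cherry s \<and> no_mono_cherry t \<and> cherry_ok s t"

definition bichromatic :: "label set \<Rightarrow> bool" where
  "bichromatic A \<longleftrightarrow> (\<exists>i. Unprimed i \<in> A) \<and> (\<exists>i. Primed i \<in> A)"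

definition sym_clusters :: "bt \<Rightarrow> label set set" where
  "sym_clusters t = clusters t \<union> (\<lambda>A. swap ` A) ` clusters t"

definition base :: "bt \<Rightarrow> label set" where
  "base t = leaf_set t \<union> swap ` leaf_set t"

text \<open>The label sets at one end of the trunk, one for each trunk edge. The empty and the full
  list are left out, as no edge separates them from the rest; so a list of length 1 yields no trunk
  edge.\<close>

definition prefs :: "label set list \<Rightarrow> label set set" where
  "prefs bs = {\<Union> (set (take i bs)) | i. 0 < i \<and> i < length bs}"

definition code_small :: "bt list \<Rightarrow> label set set" where
  "code_small ts = \<Union> (sym_clusters ` set ts)"

definition code_trunk :: "nat \<Rightarrow> bt list \<Rightarrow> label set set" where
  "code_trunk n ts = prefs (map base ts) \<union> (\<lambda>A. labels n - A) ` prefs (map base ts)"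

text \<open>For a code of length 1 the edge joining the two mirror images is covered too: its sides
  are the leaf set of the tree and its mirror image, both members of
  \<open>code_small\<close>.\<close>

definition code_sides :: "nat \<Rightarrow> bt list \<Rightarrow> label set set" where
  "code_sides n ts = code_small ts \<union> (\<lambda>A. labels n - A) ` code_small ts \<union> code_trunk n ts"

text \<open>The entries of a code are the binary trees attached to the trunk, each representing also its
  mirror image; a code of length 1 means that the two mirror images are joined by an edge.\<close>

definition Codes :: "nat \<Rightarrow> bt list set" where
  "Codes n = {ts. ts \<noteq> [] \<and> distinct (concat (map indices ts)) \<and> set (concat (map indices ts)) = {1..n} \<and>
     (\<forall>t\<in>set ts. no_mono_cherry t)}"

lemma index_swap [simp]: "index (swap a) = index a"
  by (cases a) auto

lemma index_eq_iff: "index a = index b \<longleftrightarrow> a = b \<or> a = swap b"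
  by (cases a; cases b) auto

lemma index_labels: "index ` labels n = {1..n}"
  by (force simp: labels_def)

lemma labels_iff_index: "a \<in> labels n \<longleftrightarrow> index a \<in> {1..n}"
  by (cases a) (auto simp: labels_def)

lemma set_indices: "set (indices t) = index ` leaf_set t"
  by (induction t) auto

lemma leaf_set_nonempty [simp]: "leaf_set t \<noteq> {}"
  by (induction t) auto

lemma finite_leaf_set [simp]: "finite (leaf_set t)"
  by (induction t) auto

lemma finite_clusters [simp]: "finite (clusters t)"
  by (induction t) auto

lemma leaf_set_in_clusters [simp]: "leaf_set t \<in> clusters t"
  by (cases t) auto

lemma clusters_sub: "A \<in> clusters t \<Longrightarrow> A \<subseteq> leaf_set t"
  by (induction t) auto

lemma clusters_nonempty: "A \<in> clusters t \<Longrightarrow> A \<noteq> {}"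
  by (induction t) auto

lemma singleton_in_clusters: "a \<in> leaf_set t \<Longrightarrow> {a} \<in> clusters t"
  by (induction t) auto

lemma swap_base [simp]: "swap ` base t = base t"
  by (auto simp: base_def image_Un)

lemma index_base: "index ` base t = set (indices t)"
  by (auto simp: base_def set_indices image_Un image_image)

fun disjoint_leaves :: "bt \<Rightarrow> bool" where
  "disjoint_leaves (Lf a) \<longleftrightarrow> True"
| "disjoint_leaves (Nd s t) \<longleftrightarrow> disjoint_leaves s \<and> disjoint_leaves t \<and> leaf_set s \<inter> leaf_set t = {}"

lemma distinct_indices: "disjoint_leaves t \<Longrightarrow> leaf_set t \<inter> swap ` leaf_set t = {} \<Longrightarrow> distinct (indices t)"
proof (induction t)
  case (Nd s t)
  have "set (indices s) \<inter> set (indices t) = {}"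
  proof -
    have False if "a \<in> leaf_set s" "b \<in> leaf_set t" "index a = index b" for a b
      using that Nd.prems by (auto simp: index_eq_iff swap_image_iff image_Un)
    then show ?thesis by (auto simp: set_indices)
  qed
  with Nd show ?case by (auto simp: image_Un)
qed simp

lemma bichromatic_mono: "bichromatic A \<Longrightarrow> A \<subseteq> B \<Longrightarrow> bichromatic B"
  by (auto simp: bichromatic_def)

lemma bichromatic_if_swap: "A \<noteq> {} \<Longrightarrow> A \<union> swap ` A \<subseteq> B \<Longrightarrow> bichromatic B"
proof -
  assume "A \<noteq> {}" and sub: "A \<union> swap ` A \<subseteq> B"
  then obtain a where "a \<in> B" "swap a \<in> B" by blast
  then show ?thesis by (cases a) (auto simp: bichromatic_def)
qed

text \<open>Excluding monochromatic cherries suffices, as every non-leaf subtree contains a cherry.\<close>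

lemma no_mono_cherry_iff_bichromatic:
  assumes "distinct (indices t)"
  shows "no_mono_cherry t \<longleftrightarrow> (\<forall>A\<in>clusters t. 2 \<le> card A \<longrightarrow> bichromatic A)"
  using assms
proof (induction t)
  case (Nd s t)
  have ne: "leaf_set s \<inter> leaf_set t = {}" using Nd.prems by (auto simp: set_indices)
  have "card (leaf_set s \<union> leaf_set t) = card (leaf_set s) + card (leaf_set t)" using ne by (simp add: card_Un_disjoint)
  moreover have "card (leaf_set s) \<noteq> 0" "card (leaf_set t) \<noteq> 0" by simp_all
  ultimately have c2: "2 \<le> card (leaf_set s \<union> leaf_set t)" by linarith
  have big: "2 \<le> card (leaf_set (Nd a b))" if "distinct (indices (Nd a b))" for a b
  proof -
    have "leaf_set a \<inter> leaf_set b = {}" using that by (auto simp: set_indices)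
    then have "card (leaf_set a \<union> leaf_set b) = card (leaf_set a) + card (leaf_set b)" by (simp add: card_Un_disjoint)
    moreover have "card (leaf_set a) \<noteq> 0" "card (leaf_set b) \<noteq> 0" by simp_all
    ultimately have "2 \<le> card (leaf_set a \<union> leaf_set b)" by linarith
    then show ?thesis by simp
  qed
  have bicU: "bichromatic (leaf_set s \<union> leaf_set t) \<longleftrightarrow> cherry_ok s t" if IH: "\<forall>A\<in>clusters s. 2 \<le> card A \<longrightarrow> bichromatic A" "\<forall>A\<in>clusters t. 2 \<le> card A \<longrightarrow> bichromatic A"
  proof -
    have nd: "bichromatic (leaf_set x)" if "x = Nd a b" "distinct (indices x)" "\<forall>A\<in>clusters x. 2 \<le> card A \<longrightarrow> bichromatic A" for x a b
      using that big[of a b] leaf_set_in_clusters[of x] by blast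
    show ?thesis
    proof (cases s)
      case s: (Lf a)
      show ?thesis
      proof (cases t)
        case t: (Lf b)
        show ?thesis by (cases a; cases b) (auto simp: s t bichromatic_def)
      next
        case (Nd c d)
        then have "bichromatic (leaf_set t)" using nd[of t] IH Nd.prems \<open>distinct (indices (Nd s t))\<close> by simp
        then have "bichromatic (leaf_set s \<union> leaf_set t)" using bichromatic_mono by blast
        then show ?thesis using Nd s by simp
      qed
    next
      case N: (Nd c d)
      have "distinct (indices s)" using Nd.prems by simp
      then have "bichromatic (leaf_set s)" using nd[OF N _ IH(1)] by simp
      then have "bichromatic (leaf_set s \<union> leaf_set t)" using bichromatic_mono by blast
      then show ?thesis using N by simp
    qed
  qed
  have dst: "distinct (indices s)" "distinct (indices t)" using Nd.prems by auto
  have "(\<forall>A\<in>clusters (Nd s t). 2 \<le> card A \<longrightarrow> bichromatic A) \<longleftrightarrow>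
      bichromatic (leaf_set s \<union> leaf_set t) \<and> (\<forall>A\<in>clusters s. 2 \<le> card A \<longrightarrow> bichromatic A) \<and> (\<forall>A\<in>clusters t. 2 \<le> card A \<longrightarrow> bichromatic A)"
    using c2 by auto
  then show ?case using bicU Nd.IH(1)[OF dst(1)] Nd.IH(2)[OF dst(2)] by auto
qed simp

section \<open>Extremal bounds for laminar families\<close>

definition laminar :: "'a set set \<Rightarrow> bool" where
  "laminar F \<longleftrightarrow> (\<forall>A\<in>F. \<forall>B\<in>F. A \<subseteq> B \<or> B \<subseteq> A \<or> A \<inter> B = {})"

lemma laminarD: "laminar F \<Longrightarrow> A \<in> F \<Longrightarrow> B \<in> F \<Longrightarrow> A \<subseteq> B \<or> B \<subseteq> A \<or> A \<inter> B = {}"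
  unfolding laminar_def by blast

lemma laminar_subset: "laminar F \<Longrightarrow> G \<subseteq> F \<Longrightarrow> laminar G"
  unfolding laminar_def by blast

lemma subfamilies_disjoint:
  assumes "{} \<notin> F" "X \<inter> Y = {}"
  shows "{A \<in> F. A \<subseteq> X} \<inter> {A \<in> F. A \<subseteq> Y} = {}"
proof -
  have "A = {}" if "A \<subseteq> X" "A \<subseteq> Y" for A using that assms(2) by blast
  then show ?thesis using assms(1) by blast
qed

text \<open>Splitting off a maximal proper member \<open>M\<close>, the complement of \<open>M\<close> can be added to the family;
  if it was not a member already, the bound is not attained.\<close>

lemma laminar_binary:
  assumes "finite L" "F \<subseteq> Pow L" "L \<in> F" "{} \<notin> F" "\<And>x. x \<in> L \<Longrightarrow> {x} \<in> F" "laminar F"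
  shows "card F + 1 \<le> 2 * card L \<and> (card F + 1 = 2 * card L \<longrightarrow> (\<exists>t. leaf_set t = L \<and> clusters t = F \<and> disjoint_leaves t))"
  using assms
proof (induction "card L" arbitrary: L F rule: less_induct)
  case less
  note fin = less.prems(1) and sub = less.prems(2) and LF = less.prems(3) and ne = less.prems(4)
    and sing = less.prems(5) and lam = less.prems(6)
  have finF: "finite F" using fin sub by (meson finite_Pow_iff finite_subset)
  show ?case
  proof (cases "\<exists>x. L = {x}")
    case True
    then obtain x where L: "L = {x}" by blast
    then have "F = {{x}}" using sub LF ne by (auto simp: subset_singleton_iff)
    then show ?thesis using L by (auto intro: exI[of _ "Lf x"])
  next
    case False
    obtain x where x: "x \<in> L" using LF ne by fastforce
    then have "{x} \<in> F - {L}" using sing False by auto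
    then obtain M where M: "M \<in> F - {L}" and max: "\<And>B. B \<in> F - {L} \<Longrightarrow> M \<subseteq> B \<Longrightarrow> M = B"
      using finite_has_maximal[of "F - {L}"] finF by (metis empty_iff finite_Diff)
    define N where "N = L - M"
    have MsubL: "M \<subset> L" using M sub by blast
    have Nne: "N \<noteq> {}" using MsubL by (auto simp: N_def)
    have Mne: "M \<noteq> {}" using M ne by auto
    have finM: "finite M" "finite N" using MsubL fin finite_subset by (auto simp: N_def)
    have cL: "card L = card M + card N"
      using MsubL card_Un_disjoint[OF finM] by (simp add: N_def Un_absorb1)
    have pos: "card M > 0" "card N > 0" using Mne Nne finM by (auto simp: card_gt_0_iff)
    let ?FM = "{A \<in> F. A \<subseteq> M}" and ?F' = "{A \<in> F. A \<subseteq> N}"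
    let ?FN = "insert N ?F'"
    have part: "A = L \<or> A \<subseteq> M \<or> A \<subseteq> N" if "A \<in> F" for A
    proof (cases "A = L")
      case False
      then show ?thesis using laminarD[OF lam that, of M] M max[of A] that sub by (auto simp: N_def)
    qed simp
    have F: "F = insert L (?FM \<union> ?F')" using part LF by blast
    have cF: "card F = 1 + (card ?FM + card ?F')"
    proof -
      have "L \<notin> ?FM \<union> ?F'" using MsubL Mne by (auto simp: N_def)
      moreover have "card (?FM \<union> ?F') = card ?FM + card ?F'"
        by (rule card_Un_disjoint) (use finF subfamilies_disjoint[OF ne, of M N] in \<open>auto simp: N_def\<close>)
      ultimately show ?thesis using finF by (subst F) simp
    qed
    have IM: "card ?FM + 1 \<le> 2 * card M \<and> (card ?FM + 1 = 2 * card M \<longrightarrow> (\<exists>t. leaf_set t = M \<and> clusters t = ?FM \<and> disjoint_leaves t))"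
    proof (rule less.hyps)
      show "card M < card L" using cL pos by simp
      show "laminar ?FM" by (rule laminar_subset[OF lam]) blast
    qed (use M finM sing MsubL ne in auto)
    have IN: "card ?FN + 1 \<le> 2 * card N \<and> (card ?FN + 1 = 2 * card N \<longrightarrow> (\<exists>t. leaf_set t = N \<and> clusters t = ?FN \<and> disjoint_leaves t))"
    proof (rule less.hyps)
      show "card N < card L" using cL pos by simp
      show "laminar ?FN" using lam unfolding laminar_def by blast
      show "{x} \<in> ?FN" if "x \<in> N" for x using that sing by (auto simp: N_def)
    qed (use finM ne Nne in auto)
    have cN: "card ?FN = card ?F' + (if N \<in> F then 0 else 1)"
      using finF by (auto simp: insert_absorb)
    have le: "card F + 1 \<le> 2 * card L" using cF IM IN cL cN by (auto split: if_splits)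
    moreover have "\<exists>t. leaf_set t = L \<and> clusters t = F \<and> disjoint_leaves t" if eq: "card F + 1 = 2 * card L"
    proof -
      have NF: "N \<in> F" "card ?FM + 1 = 2 * card M" "card ?FN + 1 = 2 * card N"
        using eq cF IM IN cL cN by (auto split: if_splits)
      then obtain s t where s: "leaf_set s = M" "clusters s = ?FM" "disjoint_leaves s" and t: "leaf_set t = N" "clusters t = ?FN" "disjoint_leaves t"
        using IM IN by blast
      have "M \<union> N = L" "M \<inter> N = {}" using MsubL by (auto simp: N_def)
      then have "leaf_set (Nd s t) = L" "disjoint_leaves (Nd s t)" using s t by auto
      moreover have "clusters (Nd s t) = F" using s t \<open>M \<union> N = L\<close> NF(1) F by (auto simp: insert_absorb)
      ultimately show ?thesis by blast
    qed
    ultimately show ?thesis by blast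
  qed
qed

text \<open>A maximal member \<open>M\<close> and its mirror image together contain at most
  \<open>2 * (2 * card M - 1)\<close> members of the family, which is 2 less than twice the size of
  their union. If labels remain, the rest loses another 2 by induction, so attaining the bound
  forces a single mirror pair and a binary tree on \<open>M\<close>.\<close>

lemma small_binary:
  assumes "finite D" "swap ` D = D" "D \<noteq> {}" "S \<subseteq> Pow D" "{} \<notin> S" "\<And>A. A \<in> S \<Longrightarrow> A \<inter> swap ` A = {}"
    "\<And>x. x \<in> D \<Longrightarrow> {x} \<in> S" "laminar S" "\<And>A. A \<in> S \<Longrightarrow> swap ` A \<in> S"
  shows "card S + 2 \<le> 2 * card D \<and> (card S + 2 = 2 * card D \<longrightarrow>
    (\<exists>t. base t = D \<and> sym_clusters t = S \<and> disjoint_leaves t \<and> leaf_set t \<inter> swap ` leaf_set t = {}))"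
  using assms
proof (induction "card D" arbitrary: D S rule: less_induct)
  case less
  note fin = less.prems(1) and swD = less.prems(2) and Dne = less.prems(3) and sub = less.prems(4)
    and ne = less.prems(5) and sm = less.prems(6) and sing = less.prems(7) and lam = less.prems(8)
    and swap_closed = less.prems(9)
  have finS: "finite S" using fin sub by (meson finite_Pow_iff finite_subset)
  have "S \<noteq> {}" using Dne sing by fastforce
  then obtain M where M: "M \<in> S" and max: "\<And>B. B \<in> S \<Longrightarrow> M \<subseteq> B \<Longrightarrow> M = B"
    using finite_has_maximal[OF finS] by metis
  let ?M' = "swap ` M"
  have M': "?M' \<in> S" using swap_closed M by blast
  have max': "?M' = B" if "B \<in> S" "?M' \<subseteq> B" for B
  proof -
    have "M \<subseteq> swap ` B" using that(2) by (metis swap_image_image image_mono)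
    then have "M = swap ` B" using max swap_closed that(1) by blast
    then show ?thesis by simp
  qed
  have dis: "M \<inter> ?M' = {}" using sm M by blast
  have MD: "M \<subseteq> D" "?M' \<subseteq> D" using M M' sub by auto
  have Mne: "M \<noteq> {}" using M ne by auto
  have finM: "finite M" using MD fin finite_subset by blast
  define D' where "D' = D - (M \<union> ?M')"
  let ?SM = "{A \<in> S. A \<subseteq> M}" and ?SM' = "{A \<in> S. A \<subseteq> ?M'}" and ?S' = "{A \<in> S. A \<subseteq> D'}"
  have part: "A \<subseteq> M \<or> A \<subseteq> ?M' \<or> A \<subseteq> D'" if "A \<in> S" for A
    using laminarD[OF lam that M] laminarD[OF lam that M'] max[OF that] max'[OF that] sub that
    unfolding D'_def by blast
  have S: "S = ?SM \<union> ?SM' \<union> ?S'" using part by blast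
  have SM': "?SM' = (\<lambda>A. swap ` A) ` ?SM"
  proof (intro set_eqI iffI)
    fix A assume A: "A \<in> ?SM'"
    then have "swap ` A \<in> ?SM" using swap_closed by (auto simp: swap_image_iff)
    then show "A \<in> (\<lambda>A. swap ` A) ` ?SM" by (metis (no_types, lifting) imageI swap_image_image)
  qed (use swap_closed in auto)
  have cSM': "card ?SM' = card ?SM"
    unfolding SM' by (rule card_image) (simp add: inj_on_def)
  have cS: "card S = 2 * card ?SM + card ?S'"
  proof -
    have "card (?SM \<union> ?SM') = card ?SM + card ?SM'"
      by (rule card_Un_disjoint) (use finS subfamilies_disjoint[OF ne dis] in auto)
    moreover have "card (?SM \<union> ?SM' \<union> ?S') = card (?SM \<union> ?SM') + card ?S'"
    proof (rule card_Un_disjoint)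
      have "A = {}" if "A \<subseteq> M \<or> A \<subseteq> ?M'" "A \<subseteq> D'" for A using that unfolding D'_def by blast
      then show "(?SM \<union> ?SM') \<inter> ?S' = {}" using ne by blast
    qed (use finS in auto)
    ultimately show ?thesis using S cSM' by simp
  qed
  have IM: "card ?SM + 1 \<le> 2 * card M \<and> (card ?SM + 1 = 2 * card M \<longrightarrow> (\<exists>t. leaf_set t = M \<and> clusters t = ?SM \<and> disjoint_leaves t))"
  proof (rule laminar_binary)
    show "laminar ?SM" by (rule laminar_subset[OF lam]) blast
  qed (use M finM sing MD ne in auto)
  have cM: "card (M \<union> ?M') = 2 * card M" using card_Un_disjoint[OF finM _ dis] finM by simp
  have cD: "card D = 2 * card M + card D'"
    using card_Un_disjoint[of "M \<union> ?M'" D'] MD fin finM cM unfolding D'_def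
    by (metis Diff_disjoint Un_Diff_cancel Un_absorb1 Un_least finite_Diff finite_UnI finite_imageI)
  have posM: "card M > 0" using Mne finM by (simp add: card_gt_0_iff)
  show ?case
  proof (cases "D' = {}")
    case True
    then have "?S' = {}" using ne by auto
    then have c: "card S = 2 * card ?SM" using cS by (metis (no_types, lifting) add.right_neutral card.empty)
    have d: "card D = 2 * card M" using cD True by simp
    have "\<exists>t. base t = D \<and> sym_clusters t = S \<and> disjoint_leaves t \<and> leaf_set t \<inter> swap ` leaf_set t = {}" if "card S + 2 = 2 * card D"
    proof -
      have "card ?SM + 1 = 2 * card M" using that c d by simp
      then obtain t where t: "leaf_set t = M" "clusters t = ?SM" "disjoint_leaves t" using IM by blast
      have "base t = D" using t(1) True MD by (auto simp: base_def D'_def)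
      moreover have "sym_clusters t = S" unfolding sym_clusters_def t(2) SM'[symmetric] using S \<open>?S' = {}\<close> by blast
      ultimately show ?thesis using t dis by blast
    qed
    moreover have "card S + 2 \<le> 2 * card D" using c d IM by linarith
    ultimately show ?thesis by blast
  next
    case False
    have "card ?S' + 2 \<le> 2 * card D' \<and> (card ?S' + 2 = 2 * card D' \<longrightarrow>
      (\<exists>t. base t = D' \<and> sym_clusters t = ?S' \<and> disjoint_leaves t \<and> leaf_set t \<inter> swap ` leaf_set t = {}))"
    proof (rule less.hyps)
      show "card D' < card D" using cD posM by simp
      show swD': "swap ` D' = D'" using swD by (simp add: D'_def swap_image_Diff image_Un Un_commute)
      show "laminar ?S'" by (rule laminar_subset[OF lam]) blast
      show "swap ` A \<in> ?S'" if "A \<in> ?S'" for A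
        using that swap_closed swD' by (metis (no_types, lifting) image_mono mem_Collect_eq)
      show "{x} \<in> ?S'" if "x \<in> D'" for x using that sing by (auto simp: D'_def)
      show "finite D'" using fin by (simp add: D'_def)
      show "A \<inter> swap ` A = {}" if "A \<in> ?S'" for A using that sm by blast
    qed (use False ne in auto)
    then have "card S + 2 < 2 * card D" using cS cD IM by linarith
    then show ?thesis by simp
  qed
qed

lemma prefs_snoc: "bs \<noteq> [] \<Longrightarrow> prefs (bs @ [b]) = insert (\<Union> (set bs)) (prefs bs)"
proof -
  assume ne: "bs \<noteq> []"
  show ?thesis
  proof (intro set_eqI iffI)
    fix A assume "A \<in> prefs (bs @ [b])"
    then obtain i where i: "0 < i" "i < Suc (length bs)" "A = \<Union> (set (take i (bs @ [b])))"
      by (auto simp: prefs_def)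
    show "A \<in> insert (\<Union> (set bs)) (prefs bs)"
    proof (cases "i = length bs")
      case False
      then show ?thesis using i by (auto simp: prefs_def)
    qed (use i in simp)
  next
    fix A assume "A \<in> insert (\<Union> (set bs)) (prefs bs)"
    then consider "A = \<Union> (set bs)" | i where "0 < i" "i < length bs" "A = \<Union> (set (take i bs))"
      by (auto simp: prefs_def)
    then show "A \<in> prefs (bs @ [b])"
    proof cases
      case 1
      then show ?thesis using ne unfolding prefs_def by (intro CollectI exI[of _ "length bs"]) auto
    next
      case 2
      then show ?thesis unfolding prefs_def by (intro CollectI exI[of _ i]) auto
    qed
  qed
qed

lemma code_small_append: "code_small (ts @ us) = code_small ts \<union> code_small us"
  by (auto simp: code_small_def)

text \<open>The chain cuts \<open>D\<close> into \<open>card K + 1\<close> invariant blocks, and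
  every member of \<open>S\<close> lies in one of them. By \<open>small_binary\<close> each block
  stays at least 2 below twice its size; the term \<open>2 * card K\<close> makes up for all blocks
  but one. It has weight 2 because a trunk edge contributes a set and its complement. The induction
  removes the block outside the largest member of \<open>K\<close>, which becomes the last entry of
  the list.\<close>

lemma chain_code:
  assumes "finite K" "finite D" "swap ` D = D" "D \<noteq> {}" "S \<subseteq> Pow D" "{} \<notin> S" "\<And>A. A \<in> S \<Longrightarrow> A \<inter> swap ` A = {}"
    "\<And>x. x \<in> D \<Longrightarrow> {x} \<in> S" "laminar S" "\<And>A. A \<in> S \<Longrightarrow> swap ` A \<in> S"
    "\<And>B. B \<in> K \<Longrightarrow> B \<subset> D \<and> B \<noteq> {} \<and> swap ` B = B"
    "\<And>B C. B \<in> K \<Longrightarrow> C \<in> K \<Longrightarrow> B \<subseteq> C \<or> C \<subseteq> B"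
    "\<And>A B. A \<in> S \<Longrightarrow> B \<in> K \<Longrightarrow> A \<subseteq> B \<or> A \<inter> B = {}"
  shows "2 * card K + card S + 2 \<le> 2 * card D \<and> (2 * card K + card S + 2 = 2 * card D \<longrightarrow>
    (\<exists>ts. ts \<noteq> [] \<and> code_small ts = S \<and> prefs (map base ts) = K \<and> \<Union> (set (map base ts)) = D \<and> distinct (concat (map indices ts))))"
  using assms
proof (induction "card K" arbitrary: K D S rule: less_induct)
  case less
  note finK = less.prems(1) and fin = less.prems(2) and swD = less.prems(3) and Dne = less.prems(4) and sub = less.prems(5)
    and ne = less.prems(6) and sm = less.prems(7) and sing = less.prems(8) and lam = less.prems(9)
    and swap_closed = less.prems(10) and K = less.prems(11) and chain = less.prems(12) and comp = less.prems(13)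
  show ?case
  proof (cases "K = {}")
    case True
    have "\<exists>ts. ts \<noteq> [] \<and> code_small ts = S \<and> prefs (map base ts) = K \<and> \<Union> (set (map base ts)) = D \<and> distinct (concat (map indices ts))"
      if t: "base t = D" "sym_clusters t = S" "disjoint_leaves t" "leaf_set t \<inter> swap ` leaf_set t = {}" for t
      using t True distinct_indices[OF t(3,4)] by (intro exI[of _ "[t]"]) (auto simp: code_small_def prefs_def)
    then show ?thesis using small_binary[OF fin swD Dne sub ne sm sing lam swap_closed] True by auto
  next
    case False
    then obtain B where B: "B \<in> K" and max: "\<And>C. C \<in> K \<Longrightarrow> B \<subseteq> C \<Longrightarrow> B = C"
      using finite_has_maximal[OF finK] by metis
    have KB: "C \<subseteq> B" if "C \<in> K" for C using chain[OF that B] max[OF that] by blast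
    have BD: "B \<subset> D" "B \<noteq> {}" "swap ` B = B" using K[OF B] by auto
    define D' where "D' = D - B"
    have finB: "finite B" "finite D'" using BD fin finite_subset by (auto simp: D'_def)
    have swD': "swap ` D' = D'" using swD BD by (simp add: D'_def swap_image_Diff)
    have D'ne: "D' \<noteq> {}" using BD by (auto simp: D'_def)
    let ?SB = "{A \<in> S. A \<subseteq> B}" and ?S' = "{A \<in> S. A \<subseteq> D'}"
    have finS: "finite S" using fin sub by (meson finite_Pow_iff finite_subset)
    have S: "S = ?SB \<union> ?S'" using comp[OF _ B] sub by (auto simp: D'_def)
    have cS: "card S = card ?SB + card ?S'"
      by (subst S, rule card_Un_disjoint) (use finS subfamilies_disjoint[OF ne, of B D'] in \<open>auto simp: D'_def\<close>)
    have cD: "card D = card B + card D'"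
    proof -
      have "card (B \<union> D') = card B + card D'"
        by (rule card_Un_disjoint) (use finB in \<open>auto simp: D'_def\<close>)
      moreover have "B \<union> D' = D" using BD(1) by (auto simp: D'_def)
      ultimately show ?thesis by simp
    qed
    have cK: "card K = Suc (card (K - {B}))" by (rule card.remove[OF finK B])
    have IH: "2 * card (K - {B}) + card ?SB + 2 \<le> 2 * card B \<and> (2 * card (K - {B}) + card ?SB + 2 = 2 * card B \<longrightarrow>
      (\<exists>ts. ts \<noteq> [] \<and> code_small ts = ?SB \<and> prefs (map base ts) = K - {B} \<and> \<Union> (set (map base ts)) = B \<and> distinct (concat (map indices ts))))"
    proof (rule less.hyps)
      show "card (K - {B}) < card K" using cK by simp
      show "finite (K - {B})" using finK by simp
      show "laminar ?SB" by (rule laminar_subset[OF lam]) blast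
      show "swap ` A \<in> ?SB" if "A \<in> ?SB" for A
        using that swap_closed BD(3) by (metis (no_types, lifting) image_mono mem_Collect_eq)
      show "{x} \<in> ?SB" if "x \<in> B" for x using that sing BD by auto
      show "A \<inter> swap ` A = {}" if "A \<in> ?SB" for A using that sm by blast
      show "C \<subset> B \<and> C \<noteq> {} \<and> swap ` C = C" if "C \<in> K - {B}" for C
        using that KB[of C] K[of C] by blast
      show "C \<subseteq> E \<or> E \<subseteq> C" if "C \<in> K - {B}" "E \<in> K - {B}" for C E using that chain by blast
      show "A \<subseteq> C \<or> A \<inter> C = {}" if "A \<in> ?SB" "C \<in> K - {B}" for A C using that comp by blast
    qed (use finB BD ne in auto)
    have ID: "card ?S' + 2 \<le> 2 * card D' \<and> (card ?S' + 2 = 2 * card D' \<longrightarrow>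
      (\<exists>t. base t = D' \<and> sym_clusters t = ?S' \<and> disjoint_leaves t \<and> leaf_set t \<inter> swap ` leaf_set t = {}))"
    proof (rule small_binary)
      show "laminar ?S'" by (rule laminar_subset[OF lam]) blast
      show "swap ` A \<in> ?S'" if "A \<in> ?S'" for A
        using that swap_closed swD' by (metis (no_types, lifting) image_mono mem_Collect_eq)
      show "{x} \<in> ?S'" if "x \<in> D'" for x using that sing by (auto simp: D'_def)
      show "A \<inter> swap ` A = {}" if "A \<in> ?S'" for A using that sm by blast
    qed (use finB swD' D'ne ne in auto)
    have "2 * card K + card S + 2 \<le> 2 * card D" using IH ID cK cS cD by linarith
    moreover have "\<exists>ts. ts \<noteq> [] \<and> code_small ts = S \<and> prefs (map base ts) = K \<and> \<Union> (set (map base ts)) = D \<and> distinct (concat (map indices ts))"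
      if "2 * card K + card S + 2 = 2 * card D"
    proof -
      have "2 * card (K - {B}) + card ?SB + 2 = 2 * card B" "card ?S' + 2 = 2 * card D'"
        using that IH ID cK cS cD by linarith+
      then obtain ts t where ts: "ts \<noteq> []" "code_small ts = ?SB" "prefs (map base ts) = K - {B}"
          "\<Union> (set (map base ts)) = B" "distinct (concat (map indices ts))"
        and t: "base t = D'" "sym_clusters t = ?S'" "disjoint_leaves t" "leaf_set t \<inter> swap ` leaf_set t = {}"
        using IH ID by metis
      have "code_small (ts @ [t]) = S"
      proof -
        have "code_small [t] = ?S'" using t(2) by (simp add: code_small_def)
        then have "code_small (ts @ [t]) = ?SB \<union> ?S'" by (simp only: code_small_append ts(2))
        then show ?thesis using S by (rule trans[OF _ sym])
      qed
      moreover have "prefs (map base (ts @ [t])) = K"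
        using prefs_snoc[of "map base ts" "base t"] ts(1,3,4) B by auto
      moreover have "\<Union> (set (map base (ts @ [t]))) = D"
        using ts(4) t(1) BD by (auto simp: D'_def)
      moreover have "distinct (concat (map indices (ts @ [t])))"
      proof -
        have "set (indices t) \<inter> set (concat (map indices ts)) = {}"
        proof -
          have B_indices: "set (concat (map indices ts)) = index ` B"
            using ts(4) by (auto simp: index_base[symmetric])
          have D'_indices: "set (indices t) = index ` D'" using t(1) index_base by metis
          \<comment> \<open>Both blocks are invariant, so labels of equal index lie in the same
            block.\<close>
          have no: False if "a \<in> B" "b \<in> D'" "index a = index b" for a b
            using that BD(3) by (auto simp: index_eq_iff D'_def swap_image_iff)
          show ?thesis unfolding B_indices D'_indices
          proof (rule equals0I)
            fix y assume "y \<in> index ` D' \<inter> index ` B"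
            then obtain a b where "b \<in> D'" "y = index b" "a \<in> B" "y = index a" by blast
            then show False using no[of a b] by simp
          qed
        qed
        then show ?thesis using ts(5) distinct_indices[OF t(3,4)] by auto
      qed
      ultimately show ?thesis by blast
    qed
    ultimately show ?thesis by blast
  qed
qed

section \<open>From an extremal family of sides to a code\<close>

text \<open>Every invariant split is oriented by a minimal invariant side \<open>A\<close>:
  compatibility and minimality put \<open>A\<close> inside exactly one of its two sides. Two
  incomparable sides containing \<open>A\<close> would cover all labels, and then \<open>A\<close>
  and their complements would be three disjoint invariant sides.\<close>

lemma trunk_sides_chain:
  assumes S: "split_system n S"
    and no3: "\<forall>A\<in>trunk_sides S. \<forall>B\<in>trunk_sides S. \<forall>C\<in>trunk_sides S. A \<inter> B = {} \<longrightarrow> A \<inter> C = {} \<longrightarrow> B \<inter> C \<noteq> {}"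
  shows "\<exists>K. trunk_sides S = K \<union> (\<lambda>A. labels n - A) ` K \<and> K \<inter> (\<lambda>A. labels n - A) ` K = {} \<and>
    (\<forall>B\<in>K. \<forall>C\<in>K. B \<subseteq> C \<or> C \<subseteq> B)"
proof (cases "trunk_sides S = {}")
  case False
  have "finite (trunk_sides S)" using split_system_finite[OF S] by (simp add: trunk_sides_def)
  then obtain A where A: "A \<in> trunk_sides S" and min: "\<And>B. B \<in> trunk_sides S \<Longrightarrow> B \<subseteq> A \<Longrightarrow> A = B"
    using finite_has_minimal[of "trunk_sides S"] False by metis
  define c where "c A = labels n - A" for A
  have TS: "B \<in> S" "B \<subseteq> labels n" "B \<noteq> {}" if "B \<in> trunk_sides S" for B
    using that split_systemD[OF S] by (auto simp: trunk_sides_def)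
  have cT: "c B \<in> trunk_sides S" "c (c B) = B" if "B \<in> trunk_sides S" for B
    using that split_systemD[OF S] by (auto simp: trunk_sides_def c_def swap_compl)
  define K where "K = {B \<in> trunk_sides S. A \<subseteq> B}"
  have or: "A \<subseteq> B \<or> A \<subseteq> c B" if B: "B \<in> trunk_sides S" for B
  proof -
    from split_system_compat[OF S TS(1)[OF A] TS(1)[OF B]]
    consider "A \<subseteq> B" | "B \<subseteq> A" | "A \<inter> B = {}" | "A \<union> B = labels n" by blast
    then show ?thesis
    proof cases
      case 2
      then show ?thesis using min B by blast
    next
      case 3
      then show ?thesis using TS(2)[OF A] by (auto simp: c_def)
    next
      case 4
      then have "c B \<subseteq> A" using TS(2)[OF B] by (auto simp: c_def)
      then show ?thesis using min cT(1)[OF B] by blast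
    qed simp
  qed
  have "trunk_sides S = K \<union> c ` K"
  proof (intro equalityI subsetI)
    fix B assume B: "B \<in> trunk_sides S"
    show "B \<in> K \<union> c ` K"
    proof (cases "A \<subseteq> B")
      case False
      then have "c B \<in> K" using or[OF B] cT(1)[OF B] by (simp add: K_def)
      then show ?thesis using cT(2)[OF B] by (metis UnI2 imageI)
    qed (use B in \<open>simp add: K_def\<close>)
  qed (use cT in \<open>auto simp: K_def\<close>)
  moreover have "K \<inter> c ` K = {}" using TS(3)[OF A] by (auto simp: K_def c_def)
  moreover have "B \<subseteq> C \<or> C \<subseteq> B" if "B \<in> K" "C \<in> K" for B C
  proof (rule ccontr)
    assume ncomp: "\<not> (B \<subseteq> C \<or> C \<subseteq> B)"
    have BC: "B \<in> trunk_sides S" "C \<in> trunk_sides S" "A \<subseteq> B" "A \<subseteq> C" using that by (auto simp: K_def)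
    have "B \<inter> C \<noteq> {}" using BC(3,4) TS(3)[OF A] by blast
    then have "B \<union> C = labels n" using split_system_compat[OF S TS(1)[OF BC(1)] TS(1)[OF BC(2)]] ncomp by blast
    then have "c B \<inter> c C = {}" "A \<inter> c B = {}" "A \<inter> c C = {}" using BC(3,4) by (auto simp: c_def)
    then show False using no3 A cT(1)[OF BC(1)] cT(1)[OF BC(2)] by blast
  qed
  moreover have "c = (\<lambda>A. labels n - A)" by (rule ext) (rule c_def)
  ultimately show ?thesis by (intro exI[of _ K]) auto
qed auto

text \<open>\<open>no3\<close> stands in for the topological condition on the trunk, and
  \<open>card\<close> is equality in the bound of \<open>chain_code\<close> when \<open>D\<close>
  consists of all \<open>2 * n\<close> labels.\<close>

lemma code_exists:
  assumes S: "split_system n S" and swap_closed: "\<And>A. A \<in> S \<Longrightarrow> swap ` A \<in> S" and n: "1 \<le> n"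
    and no3: "\<forall>A\<in>trunk_sides S. \<forall>B\<in>trunk_sides S. \<forall>C\<in>trunk_sides S. A \<inter> B = {} \<longrightarrow> A \<inter> C = {} \<longrightarrow> B \<inter> C \<noteq> {}"
    and bichromatic: "\<And>A. A \<in> S \<Longrightarrow> 2 \<le> card A \<Longrightarrow> 2 \<le> card (labels n - A) \<Longrightarrow> bichromatic A"
    and card: "card (trunk_sides S) + card (small_sides S) + 2 = 4 * n"
  shows "\<exists>ts\<in>Codes n. S = code_sides n ts"
proof -
  define c where "c A = labels n - A" for A
  obtain K where K: "trunk_sides S = K \<union> c ` K" "K \<inter> c ` K = {}" "\<forall>B\<in>K. \<forall>C\<in>K. B \<subseteq> C \<or> C \<subseteq> B"
    using trunk_sides_chain[OF S no3] unfolding c_def by metis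
  have finS: "finite S" using S by (rule split_system_finite)
  then have finTr: "finite (trunk_sides S)" by (simp add: trunk_sides_def)
  have finK: "finite K" using K(1) by (metis (no_types, lifting) finTr finite_Un)
  have KS: "B \<in> S" "swap ` B = B" "B \<subseteq> labels n" "c (c B) = B" if "B \<in> K" for B
  proof -
    have "B \<in> trunk_sides S" using that K(1) by blast
    then show "B \<in> S" "swap ` B = B" by (simp_all add: trunk_sides_def)
    then show "B \<subseteq> labels n" "c (c B) = B" using split_systemD[OF S, of B] by (simp_all add: c_def)
  qed
  have "inj_on c K" using KS(4) by (metis inj_onI)
  then have cTr: "card (trunk_sides S) = 2 * card K"
    unfolding K(1) using card_Un_disjoint[OF finK _ K(2)] finK by (simp add: card_image)
  have Sm: "A \<in> S" "A \<inter> swap ` A = {}" "A \<subseteq> labels n" "A \<noteq> {}" if "A \<in> small_sides S" for A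
    using that split_systemD[OF S, of A] by (auto simp: small_sides_def)
  have lam: "laminar (small_sides S)"
    unfolding laminar_def
  proof (intro ballI)
    fix A B assume A: "A \<in> small_sides S" and B: "B \<in> small_sides S"
    show "A \<subseteq> B \<or> B \<subseteq> A \<or> A \<inter> B = {}"
    proof (cases "A \<union> B = labels n")
      \<comment> \<open>Two small sides cover all labels only if they are mirror images of each
        other, and then they are disjoint.\<close>
      case True
      have "swap ` A \<subseteq> B" "swap ` B \<subseteq> A"
        using True Sm[OF A] Sm[OF B] swap_labels[of n] by blast+
      then have "B \<subseteq> swap ` A" by (metis swap_image_image image_mono)
      then show ?thesis using Sm(2)[OF A] by blast
    qed (use split_system_compat[OF S Sm(1)[OF A] Sm(1)[OF B]] in blast)
  qed
  have comp: "A \<subseteq> B \<or> A \<inter> B = {}" if A: "A \<in> small_sides S" and B: "B \<in> K" for A B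
  proof -
    have Bne: "B \<noteq> {}" using split_systemD[OF S KS(1)[OF B]] by simp
    from split_system_compat[OF S Sm(1)[OF A] KS(1)[OF B]]
    consider "A \<subseteq> B" | "B \<subseteq> A" | "A \<inter> B = {}" | "A \<union> B = labels n" by blast
    then show ?thesis
    proof cases
      \<comment> \<open>An invariant set inside a small one would lie in its mirror image as well
        and be empty.\<close>
      case 2
      then have "B \<subseteq> swap ` A" using KS(2)[OF B] by (metis image_mono)
      then show ?thesis using 2 Sm(2)[OF A] Bne by blast
    next
      case 4
      then have "swap ` A \<subseteq> B" using Sm(2,3)[OF A] swap_labels[of n] by blast
      then have "A \<subseteq> B" using KS(2)[OF B] by (metis swap_image_image image_mono)
      then show ?thesis by simp
    qed auto
  qed
  have "2 * card K + card (small_sides S) + 2 \<le> 2 * card (labels n) \<and>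
    (2 * card K + card (small_sides S) + 2 = 2 * card (labels n) \<longrightarrow>
    (\<exists>ts. ts \<noteq> [] \<and> code_small ts = small_sides S \<and> prefs (map base ts) = K \<and> \<Union> (set (map base ts)) = labels n \<and> distinct (concat (map indices ts))))"
  proof (rule chain_code)
    have "Unprimed 1 \<in> labels n" using n by (simp add: labels_def)
    then show "labels n \<noteq> {}" by blast
    show "small_sides S \<subseteq> Pow (labels n)" "{} \<notin> small_sides S" using Sm(3,4) by blast+
    show "{x} \<in> small_sides S" if "x \<in> labels n" for x
      using that S by (auto simp: small_sides_def split_system_def)
    show "swap ` A \<in> small_sides S" if "A \<in> small_sides S" for A using that swap_closed by (auto simp: small_sides_def)
    show "B \<subset> labels n \<and> B \<noteq> {} \<and> swap ` B = B" if "B \<in> K" for B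
      using KS[OF that] split_systemD[OF S KS(1)[OF that]] by auto
    show "B \<subseteq> C \<or> C \<subseteq> B" if "B \<in> K" "C \<in> K" for B C using that K(3) by blast
  qed (use finK lam comp Sm in auto)
  then obtain ts where ts: "ts \<noteq> []" "code_small ts = small_sides S" "prefs (map base ts) = K"
    "\<Union> (set (map base ts)) = labels n" "distinct (concat (map indices ts))"
    using card cTr by auto
  have "code_sides n ts = small_sides S \<union> c ` small_sides S \<union> trunk_sides S"
    using ts(2,3) K(1) by (simp add: code_sides_def code_trunk_def c_def)
  also have "\<dots> = S"
  proof (intro equalityI subsetI)
    fix A assume A: "A \<in> S"
    then have "A \<in> trunk_sides S \<or> A \<in> small_sides S \<or> c A \<in> small_sides S" using split_system_cases[OF S swap_closed] by (simp add: c_def)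
    moreover have "c (c A) = A" using split_systemD(4)[OF S A] by (simp add: c_def)
    ultimately show "A \<in> small_sides S \<union> c ` small_sides S \<union> trunk_sides S" by (metis Un_iff imageI)
  qed (use split_systemD[OF S] in \<open>auto simp: small_sides_def trunk_sides_def c_def\<close>)
  finally have "S = code_sides n ts" by simp
  moreover have "ts \<in> Codes n"
  proof -
    have "set (concat (map indices ts)) = index ` \<Union> (set (map base ts))"
      by (auto simp: index_base[symmetric])
    then have "set (concat (map indices ts)) = {1..n}" using ts(4) index_labels by simp
    moreover have "no_mono_cherry t" if t: "t \<in> set ts" for t
    proof -
      have "distinct (indices t)" using ts(5) t by (simp add: distinct_concat_iff)
      moreover have "bichromatic A" if A: "A \<in> clusters t" "2 \<le> card A" for A
      proof -
        have AS: "A \<in> small_sides S" using A t ts(2) by (auto simp: code_small_def sym_clusters_def)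
        have "swap ` A \<subseteq> labels n - A" using Sm(2)[OF AS] Sm(3)[OF AS] swap_labels[of n] by blast
        then have "card (swap ` A) \<le> card (labels n - A)" by (intro card_mono) auto
        then show ?thesis using bichromatic[OF Sm(1)[OF AS]] A(2) by simp
      qed
      ultimately show ?thesis using no_mono_cherry_iff_bichromatic by blast
    qed
    ultimately show ?thesis using ts(1,5) by (simp add: Codes_def)
  qed
  ultimately show ?thesis by blast
qed

section \<open>Trees from laminar families\<close>

text \<open>With \<open>k\<close> vertices the interval is \<open>{0..real (k - 1)}\<close>. In
  \<open>\<gamma>\<close> the coordinate of the vertex at position \<open>i\<close> is the hat
  function centred at \<open>i\<close>, and \<open>g\<close> recovers the parameter as the mean
  position of the mass.\<close>

lemma path_list:
  fixes V :: "nat set"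
  assumes V: "finite V" "set vs \<subseteq> V" and dist: "distinct vs" and ne: "vs \<noteq> []"
  shows "is_path {p. (\<forall>v. 0 \<le> p v) \<and>
    {v. p v \<noteq> (0 :: real)} \<in> (\<lambda>v. {v}) ` set vs \<union> {{vs ! i, vs ! Suc i} | i. Suc i < length vs} \<and> sum p V = 1}"
    (is "is_path ?X")
proof -
  define k where "k = length vs"
  define \<gamma> where "\<gamma> t v = (\<Sum>i<k. if v = vs ! i then max 0 (1 - \<bar>t - real i\<bar>) else 0)" for t :: real and v
  define g where "g p = (\<Sum>i<k. real i * p (vs ! i))" for p :: "nat \<Rightarrow> real"
  \<comment> \<open>The point at fraction \<open>s\<close> of the edge from position
    \<open>i\<close> to \<open>i + 1\<close>. In \<open>ok\<close> the value \<open>s = 1\<close> is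
    excluded, since it is the next vertex, and at the last position only \<open>s = 0\<close> is
    allowed.\<close>
  define pt where "pt i s v = (if v = vs ! i then 1 - s else if Suc i < k \<and> v = vs ! Suc i then s else 0)"
    for i and s :: real and v
  define ok where "ok i s \<longleftrightarrow> i < k \<and> 0 \<le> s \<and> s < 1 \<and> (0 < s \<longrightarrow> Suc i < k)" for i and s :: real
  have kpos: "0 < k" using ne by (simp add: k_def)
  have inj: "vs ! i = vs ! j \<longleftrightarrow> i = j" if "i < k" "j < k" for i j
    using dist that by (simp add: k_def nth_eq_iff_index_eq)
  have inV: "vs ! i \<in> V" if "i < k" for i using V that by (auto simp: k_def)
  have \<gamma>_pt: "\<gamma> (real i + s) = pt i s" if "ok i s" for i s
  proof
    fix v
    show "\<gamma> (real i + s) v = pt i s v"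
    proof (cases "\<exists>j<k. v = vs ! j")
      case True
      then obtain j where j: "j < k" "v = vs ! j" by blast
      have "\<gamma> (real i + s) v = (\<Sum>m<k. if m = j then max 0 (1 - \<bar>real i + s - real m\<bar>) else 0)"
        unfolding \<gamma>_def by (rule sum.cong[OF refl]) (use j inj in auto)
      also have "\<dots> = max 0 (1 - \<bar>real i + s - real j\<bar>)" using j by simp
      also have "\<dots> = pt i s v"
      proof -
        consider "j = i" | "j = Suc i" | "j < i" | "Suc i < j" by linarith
        then show ?thesis
        proof cases
          case 1
          then show ?thesis using that j by (auto simp: pt_def ok_def)
        next
          case 2
          then show ?thesis using that j inj[of "Suc i" i] by (auto simp: pt_def ok_def)
        next
          case 3
          then have "real j + 1 \<le> real i" by linarith
          then show ?thesis using that j inj[of j i] inj[of j "Suc i"] 3 by (auto simp: pt_def ok_def)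
        next
          case 4
          then have "real i + 2 \<le> real j" by linarith
          then show ?thesis using that j inj[of j i] inj[of j "Suc i"] 4 by (auto simp: pt_def ok_def)
        qed
      qed
      finally show ?thesis .
    next
      case False
      then show ?thesis using that by (auto simp: \<gamma>_def pt_def ok_def)
    qed
  qed
  have g_pt: "g (pt i s) = real i + s" if "ok i s" for i s
  proof (cases "Suc i < k")
    case True
    have "g (pt i s) = (\<Sum>m\<in>{i, Suc i}. real m * pt i s (vs ! m))"
      unfolding g_def
      by (rule sum.mono_neutral_right) (use that True inj in \<open>auto simp: pt_def ok_def\<close>)
    also have "\<dots> = real i * (1 - s) + real (Suc i) * s"
      using that True inj[of "Suc i" i] by (simp add: pt_def ok_def)
    finally show ?thesis by (simp add: algebra_simps)
  next
    case False
    have "g (pt i s) = (\<Sum>m\<in>{i}. real m * pt i s (vs ! m))"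
      unfolding g_def
      by (rule sum.mono_neutral_right) (use that False inj in \<open>auto simp: pt_def ok_def\<close>)
    moreover have "i < k" "s = 0" using that False by (auto simp: ok_def)
    ultimately show ?thesis by (simp add: pt_def)
  qed
  have I: "t \<in> {0..real (k - 1)} \<longleftrightarrow> (\<exists>i s. ok i s \<and> t = real i + s)" for t
  proof
    assume t: "t \<in> {0..real (k - 1)}"
    define i where "i = nat \<lfloor>t\<rfloor>"
    have i: "real i \<le> t" "t < real i + 1" using t by (auto simp: i_def)
    have "ok i (t - real i)" using i t kpos unfolding ok_def by auto
    then show "\<exists>i s. ok i s \<and> t = real i + s" by (intro exI[of _ i] exI[of _ "t - real i"]) simp
  next
    assume "\<exists>i s. ok i s \<and> t = real i + s"
    then obtain i s where h: "i < k" "0 \<le> s" "s < 1" "0 < s \<longrightarrow> Suc i < k" "t = real i + s"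
      by (auto simp: ok_def)
    show "t \<in> {0..real (k - 1)}"
    proof (cases "s = 0")
      case True
      then show ?thesis using h by auto
    next
      case False
      then have "real i + 1 \<le> real (k - 1)" using h by auto
      then show ?thesis using h by auto
    qed
  qed
  have ptX: "pt i s \<in> ?X" if "ok i s" for i s
  proof -
    have "0 \<le> pt i s v" for v using that by (auto simp: pt_def ok_def)
    moreover have "{v. pt i s v \<noteq> 0} \<in> (\<lambda>v. {v}) ` set vs \<union> {{vs ! i, vs ! Suc i} | i. Suc i < length vs}"
    proof (cases "s = 0")
      case True
      then have "{v. pt i s v \<noteq> 0} = {vs ! i}" by (auto simp: pt_def)
      then show ?thesis using that by (auto simp: ok_def k_def)
    next
      case False
      then have "Suc i < k" "0 < s" using that by (auto simp: ok_def)
      then have "{v. pt i s v \<noteq> 0} = {vs ! i, vs ! Suc i}" using that by (auto simp: pt_def ok_def)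
      then show ?thesis using \<open>Suc i < k\<close> by (auto simp: k_def)
    qed
    moreover have "sum (pt i s) V = 1"
    proof (cases "Suc i < k")
      case True
      have "sum (pt i s) V = sum (pt i s) {vs ! i, vs ! Suc i}"
        by (rule sum.mono_neutral_right) (use that True inV V in \<open>auto simp: pt_def ok_def\<close>)
      then show ?thesis using True that inj[of "Suc i" i] by (simp add: pt_def ok_def)
    next
      case False
      have "sum (pt i s) V = sum (pt i s) {vs ! i}"
        by (rule sum.mono_neutral_right) (use that False inV V in \<open>auto simp: pt_def ok_def\<close>)
      then show ?thesis using False that by (simp add: pt_def ok_def)
    qed
    ultimately show ?thesis by simp
  qed
  have Xpt: "\<exists>i s. ok i s \<and> p = pt i s" if p: "p \<in> ?X" for p
  proof -
    define F where "F = {v. p v \<noteq> 0}"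
    have F: "F \<in> (\<lambda>v. {v}) ` set vs \<union> {{vs ! i, vs ! Suc i} | i. Suc i < length vs}"
      and nn: "\<And>v. 0 \<le> p v" and s1: "sum p V = 1"
      using p by (auto simp: F_def)
    have z: "p v = 0" if "v \<notin> F" for v using that by (simp add: F_def)
    have sF: "sum p F = 1"
    proof -
      have "F \<subseteq> V" using F V by auto
      then have "sum p V = sum p F" by (rule sum.mono_neutral_right[OF V(1)]) (use z in auto)
      then show ?thesis using s1 by simp
    qed
    from F consider i where "i < k" "F = {vs ! i}" | i where "Suc i < k" "F = {vs ! i, vs ! Suc i}"
      by (auto simp: in_set_conv_nth k_def)
    then show ?thesis
    proof cases
      case 1
      then have "p = pt i 0" using z sF by (auto simp: pt_def)
      moreover have "ok i 0" using 1 by (simp add: ok_def)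
      ultimately show ?thesis by blast
    next
      case 2
      have ne': "vs ! i \<noteq> vs ! Suc i" using inj[of "Suc i" i] 2 by auto
      then have sum: "p (vs ! i) + p (vs ! Suc i) = 1" using sF 2 by simp
      have "vs ! i \<in> F" "vs ! Suc i \<in> F" using 2 by auto
      then have "0 < p (vs ! i)" "0 < p (vs ! Suc i)" using nn by (auto simp: F_def less_le)
      then have "ok i (p (vs ! Suc i))" using sum 2 by (simp add: ok_def)
      moreover have "p = pt i (p (vs ! Suc i))"
      proof
        fix v
        show "p v = pt i (p (vs ! Suc i)) v"
          using z[of v] sum 2 by (auto simp: pt_def)
      qed
      ultimately show ?thesis by blast
    qed
  qed
  have "homeomorphism {0..real (k - 1)} ?X \<gamma> g"
  proof (rule homeomorphismI)
    show "continuous_on {0..real (k - 1)} \<gamma>"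
    proof (rule continuous_on_coordinatewise_then_product)
      fix v
      have "continuous_on {0..real (k - 1)} (\<lambda>t. if v = vs ! i then max 0 (1 - \<bar>t - real i\<bar>) else 0)" for i
        by (cases "v = vs ! i") (auto intro!: continuous_intros)
      then show "continuous_on {0..real (k - 1)} (\<lambda>t. \<gamma> t v)"
        unfolding \<gamma>_def by (intro continuous_on_sum)
    qed
    have "continuous_on ?X (\<lambda>p. p v)" for v
      by (rule continuous_on_product_then_coordinatewise[of _ "\<lambda>p. p"]) (rule continuous_on_id)
    then show "continuous_on ?X g"
      unfolding g_def by (intro continuous_on_sum continuous_on_mult continuous_on_const)
    have t: "\<gamma> t \<in> ?X \<and> g (\<gamma> t) = t" if "t \<in> {0..real (k - 1)}" for t
    proof -
      obtain i s where h: "ok i s" "t = real i + s" using \<open>t \<in> {0..real (k - 1)}\<close> I[of t] by blast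
      show ?thesis unfolding h(2) \<gamma>_pt[OF h(1)] using ptX[OF h(1)] g_pt[OF h(1)] by blast
    qed
    have p: "g p \<in> {0..real (k - 1)} \<and> \<gamma> (g p) = p" if "p \<in> ?X" for p
    proof -
      obtain i s where h: "ok i s" "p = pt i s" using Xpt[OF \<open>p \<in> ?X\<close>] by blast
      have "real i + s \<in> {0..real (k - 1)}" using I h(1) by blast
      then show ?thesis unfolding h(2) g_pt[OF h(1)] using \<gamma>_pt[OF h(1)] by blast
    qed
    show "\<gamma> ` {0..real (k - 1)} \<subseteq> ?X" using t by blast
    show "g ` ?X \<subseteq> {0..real (k - 1)}" using p by blast
    show "g (\<gamma> t) = t" if "t \<in> {0..real (k - 1)}" for t using t[OF that] by blast
    show "\<gamma> (g p) = p" if "p \<in> ?X" for p using p[OF that] by blast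
  qed
  then have "{0..real (k - 1)} homeomorphic ?X" unfolding homeomorphic_def by blast
  then have "?X homeomorphic {0..real (k - 1)}" by (rule homeomorphic_sym[THEN iffD1])
  moreover have "(0::real) \<le> real (k - 1)" by simp
  ultimately show ?thesis unfolding is_path_def by blast
qed

lemma is_path_singleton: "is_path {p}"
proof -
  have "homeomorphism {p} {0..0 :: real} (\<lambda>_. 0) (\<lambda>_. p)"
    unfolding atLeastAtMost_singleton by (simp add: homeomorphism_def)
  then have "{p} homeomorphic {0..0 :: real}" unfolding homeomorphic_def by blast
  then show ?thesis unfolding is_path_def by blast
qed

text \<open>Vertices stand for the members of a laminar family, whose maximal members \<open>Rs\<close> are joined to a
  path. For a trunk that is the midpoint of an edge, \<open>Rs\<close> consists of the two mirror images at its
  ends; otherwise it lists, for each trunk vertex, the labels hanging off that vertex.\<close>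

locale joined_forest =
  fixes n :: nat and F :: "label set set" and Rs :: "label set list" and V :: "nat set" and S :: "nat \<Rightarrow> label set"
  assumes F_sub: "F \<subseteq> Pow (labels n)" and F_ne: "{} \<notin> F" and lam: "laminar F"
    and sing: "l \<in> labels n \<Longrightarrow> {l} \<in> F"
    and len: "2 \<le> length Rs" and dist: "distinct Rs" and RsF: "set Rs \<subseteq> F"
    and below_root: "A \<in> F \<Longrightarrow> \<exists>R\<in>set Rs. A \<subseteq> R"
    and root_max: "R \<in> set Rs \<Longrightarrow> A \<in> F \<Longrightarrow> R \<subseteq> A \<Longrightarrow> A = R"
    and root_sing: "{l} \<in> set Rs \<Longrightarrow> length Rs = 2"
    and bij: "bij_betw S V F"
begin

definition vx :: "label set \<Rightarrow> nat" where "vx A = inv_into V S A"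

lemma vx: "A \<in> F \<Longrightarrow> vx A \<in> V" "A \<in> F \<Longrightarrow> S (vx A) = A" "v \<in> V \<Longrightarrow> vx (S v) = v"
  using bij unfolding vx_def bij_betw_def by (auto simp: inv_into_into f_inv_into_f)

lemma S_in: "v \<in> V \<Longrightarrow> S v \<in> F"
  using bij bij_betwE by blast

lemma S_inj: "v \<in> V \<Longrightarrow> w \<in> V \<Longrightarrow> S v = S w \<longleftrightarrow> v = w"
  using vx(3) by metis

lemma vx_inj: "A \<in> F \<Longrightarrow> B \<in> F \<Longrightarrow> vx A = vx B \<longleftrightarrow> A = B"
  using vx(2) by metis

lemma finF: "finite F"
  using F_sub finite_labels by (meson finite_Pow_iff finite_subset)

lemma finV: "finite V"
  using bij finF bij_betw_finite by blast

lemma Rs_in: "i < length Rs \<Longrightarrow> Rs ! i \<in> F"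
  using RsF by auto

lemma Rs_disjoint: "i < length Rs \<Longrightarrow> j < length Rs \<Longrightarrow> i \<noteq> j \<Longrightarrow> Rs ! i \<inter> Rs ! j = {}"
  using laminarD[OF lam Rs_in Rs_in, of i j] root_max[of "Rs ! i" "Rs ! j"] root_max[of "Rs ! j" "Rs ! i"]
    nth_eq_iff_index_eq[OF dist, of i j] Rs_in by (metis nth_mem)

definition least_above :: "label set \<Rightarrow> label set \<Rightarrow> bool" where
  "least_above A B \<longleftrightarrow> B \<in> F \<and> A \<subset> B \<and> (\<forall>C\<in>F. A \<subset> C \<longrightarrow> B \<subseteq> C)"

definition up :: "label set \<Rightarrow> label set" where
  "up A = (SOME B. least_above A B)"

lemma least_above_unique: "least_above A B \<Longrightarrow> least_above A C \<Longrightarrow> B = C"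
  unfolding least_above_def by blast

text \<open>By laminarity the members properly containing the nonempty set \<open>A\<close> form a
  chain, so a minimal one among them is least.\<close>

lemma up: 
  assumes "A \<in> F" "A \<notin> set Rs"
  shows "least_above A (up A)"
proof -
  obtain R where R: "R \<in> set Rs" "A \<subseteq> R" using below_root[OF assms(1)] by blast
  define X where "X = {C \<in> F. A \<subset> C}"
  have "R \<in> X" using R assms(2) RsF by (auto simp: X_def)
  then have "finite X" "X \<noteq> {}" using finF by (auto simp: X_def)
  then obtain B where B: "B \<in> X" and min: "\<And>C. C \<in> X \<Longrightarrow> C \<subseteq> B \<Longrightarrow> B = C"
    using finite_has_minimal by metis
  have "B \<subseteq> C" if "C \<in> F" "A \<subset> C" for C
  proof -
    have "A \<noteq> {}" using assms(1) F_ne by blast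
    then have "B \<inter> C \<noteq> {}" using B that by (auto simp: X_def)
    moreover have "C \<in> X" using that by (simp add: X_def)
    ultimately show ?thesis using laminarD[OF lam, of B C] B that(1) min[of C] by (auto simp: X_def)
  qed
  then have "least_above A B" using B by (simp add: least_above_def X_def)
  then show ?thesis unfolding up_def by (rule someI)
qed

lemma up_eq: "least_above A B \<Longrightarrow> A \<in> F \<Longrightarrow> A \<notin> set Rs \<Longrightarrow> up A = B"
  using up least_above_unique by blast

definition pos :: "label set \<Rightarrow> nat" where
  "pos A = (THE i. i < length Rs \<and> Rs ! i = A)"

lemma pos: "i < length Rs \<Longrightarrow> pos (Rs ! i) = i"
  unfolding pos_def using dist by (intro the_equality) (auto simp: nth_eq_iff_index_eq)

lemma root_cases:
  assumes "A \<in> set Rs"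
  obtains i where "i < length Rs" "A = Rs ! i"
  using assms by (auto simp: in_set_conv_nth)

definition r :: nat where "r = vx (Rs ! 0)"

text \<open>The path hangs from its first vertex; all other vertices hang from the next larger
  member of the family. At the root the truncated subtraction returns the root itself.\<close>

definition par :: "nat \<Rightarrow> nat" where
  "par v = vx (if S v \<in> set Rs then Rs ! (pos (S v) - 1) else up (S v))"

text \<open>On the path this is the position; off the path it is at least the length of the path and
  grows as the set shrinks. The subtraction is genuine, because no member has more than
  \<open>2 * n\<close> labels.\<close>

definition dep :: "nat \<Rightarrow> nat" where
  "dep v = (if S v \<in> set Rs then pos (S v) else length Rs + (2 * n - card (S v)))"

lemma par_root: "0 < i \<Longrightarrow> i < length Rs \<Longrightarrow> par (vx (Rs ! i)) = vx (Rs ! (i - 1))"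
  by (simp add: par_def vx Rs_in pos)

lemma par_nonroot: "v \<in> V \<Longrightarrow> S v \<notin> set Rs \<Longrightarrow> par v = vx (up (S v)) \<and> S (par v) = up (S v) \<and> par v \<in> V"
  using up[OF S_in] vx by (simp add: par_def least_above_def)

lemma r_in: "r \<in> V" "S r = Rs ! 0"
proof -
  have "0 < length Rs" using len by linarith
  then show "r \<in> V" "S r = Rs ! 0" using vx Rs_in by (simp_all add: r_def)
qed

lemma vert_cases:
  assumes "v \<in> V" "v \<noteq> r"
  obtains (nonroot) "S v \<notin> set Rs" | (root) i where "0 < i" "i < length Rs" "v = vx (Rs ! i)" "S v = Rs ! i"
proof (cases "S v \<in> set Rs")
  case True
  then obtain i where i: "i < length Rs" "S v = Rs ! i" by (rule root_cases)
  then have "v = vx (Rs ! i)" using vx(3)[OF assms(1)] by simp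
  moreover from this have "i \<noteq> 0" using assms(2) by (auto simp: r_def intro: gr0I)
  ultimately show ?thesis using i root by blast
qed (use nonroot in blast)

sublocale rooted V r par dep
proof
  show "finite V" by (rule finV)
  show "r \<in> V" by (rule r_in)
  fix v assume v: "v \<in> V" "v \<noteq> r"
  show "par v \<in> V"
    using v
  proof (cases rule: vert_cases)
    case nonroot
    then show ?thesis using par_nonroot[OF v(1)] by blast
  next
    case (root i)
    then show ?thesis using par_root[of i] vx(1)[OF Rs_in[of "i - 1"]] by simp
  qed
  show "dep (par v) < dep v"
    using v
  proof (cases rule: vert_cases)
    case nonroot
    have la: "least_above (S v) (up (S v))" using up[OF S_in[OF v(1)] nonroot] .
    have Sp: "S (par v) = up (S v)" using par_nonroot[OF v(1) nonroot] by blast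
    show ?thesis
    proof (cases "up (S v) \<in> set Rs")
      case True
      then obtain i where "i < length Rs" "up (S v) = Rs ! i" by (rule root_cases)
      then show ?thesis using nonroot Sp pos True by (simp add: dep_def)
    next
      case False
      have upF: "up (S v) \<subseteq> labels n" using la F_sub by (auto simp: least_above_def)
      then have "card (up (S v)) \<le> 2 * n" using card_mono[OF finite_labels upF] by simp
      moreover have "card (S v) < card (up (S v))"
      proof (rule psubset_card_mono)
        show "finite (up (S v))" using upF finite_labels by (rule finite_subset)
        show "S v \<subset> up (S v)" using la by (simp add: least_above_def)
      qed
      ultimately show ?thesis using nonroot False Sp by (simp add: dep_def)
    qed
  next
    case (root i)
    then have "par v = vx (Rs ! (i - 1))" using par_root by simp
    then have "S (par v) = Rs ! (i - 1)" using vx(2) Rs_in[of "i - 1"] root by simp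
    then show ?thesis using root pos[of i] pos[of "i - 1"] by (simp add: dep_def)
  qed
qed

lemma desc_nonroot:
  assumes v: "v \<in> V" "S v \<notin> set Rs"
  shows "desc v = {w \<in> V. S w \<subseteq> S v}"
proof (intro equalityI subsetI)
  fix w assume "w \<in> desc v"
  then have w: "w \<in> V" "(w, v) \<in> P\<^sup>*" by (auto simp: desc_def)
  from w(2) have "S w \<subseteq> S v"
  proof (induction rule: converse_rtrancl_induct)
    case (step x y)
    then have x: "x \<in> V" "x \<noteq> r" "y = par x" by (auto simp: P_def)
    from x(1,2) show ?case
    proof (cases rule: vert_cases)
      case nonroot
      have "S x \<subset> up (S x)" using up[OF S_in[OF x(1)] nonroot] by (simp add: least_above_def)
      moreover have "S y = up (S x)" using par_nonroot[OF x(1) nonroot] unfolding x(3) by blast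
      ultimately show ?thesis using step.IH by blast
    next
      case (root i)
      then have "S y = Rs ! (i - 1)" "i - 1 < length Rs" using x(3) par_root vx(2) Rs_in by simp_all
      then have "S v = Rs ! (i - 1)" using step.IH root_max[of "Rs ! (i - 1)" "S v"] S_in[OF v(1)] by simp
      then show ?thesis using v(2) \<open>i - 1 < length Rs\<close> by simp
    qed
  qed simp
  then show "w \<in> {w \<in> V. S w \<subseteq> S v}" using w(1) by simp
next
  fix w assume "w \<in> {w \<in> V. S w \<subseteq> S v}"
  then show "w \<in> desc v"
  proof (induction "dep w" arbitrary: w rule: less_induct)
    case less
    show ?case
    proof (cases "w = v")
      case True
      then show ?thesis using desc_self v by simp
    next
      case False
      then have sub: "w \<in> V" "S w \<subset> S v" using less.prems S_inj v(1) by auto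
      then have nr: "S w \<notin> set Rs" using root_max[of "S w" "S v"] S_in[OF v(1)] by auto
      moreover have "Rs ! 0 \<in> set Rs" by (rule nth_mem) (use len in linarith)
      ultimately have "w \<noteq> r" using r_in(2) by auto
      have "up (S w) \<subseteq> S v" using up[OF S_in[OF sub(1)] nr] sub(2) S_in[OF v(1)] by (simp add: least_above_def)
      moreover have "S (par w) = up (S w)" "par w \<in> V" using par_nonroot[OF sub(1) nr] by blast+
      ultimately have "par w \<in> {w \<in> V. S w \<subseteq> S v}" by simp
      then have "par w \<in> desc v" by (rule less.hyps[OF par_less[OF sub(1) \<open>w \<noteq> r\<close>]])
      then show ?thesis using desc_step[OF sub(1) \<open>w \<noteq> r\<close> False] by simp
    qed
  qed
qed

text \<open>Since the path hangs from \<open>Rs ! 0\<close>, everything attached to the path from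
  position \<open>i\<close> on lies below \<open>Rs ! i\<close>, not only the subsets of
  \<open>Rs ! i\<close>.\<close>

lemma desc_root_node:
  assumes i: "i < length Rs"
  shows "desc (vx (Rs ! i)) = {w \<in> V. \<exists>j. i \<le> j \<and> j < length Rs \<and> S w \<subseteq> Rs ! j}"
proof (intro equalityI subsetI)
  fix w assume "w \<in> desc (vx (Rs ! i))"
  then have w: "w \<in> V" "(w, vx (Rs ! i)) \<in> P\<^sup>*" by (auto simp: desc_def)
  from w(2) have "\<exists>j. i \<le> j \<and> j < length Rs \<and> S w \<subseteq> Rs ! j"
  proof (induction rule: converse_rtrancl_induct)
    case base
    then show ?case using i vx Rs_in by auto
  next
    case (step x y)
    then have x: "x \<in> V" "x \<noteq> r" "y = par x" by (auto simp: P_def)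
    obtain j where j: "i \<le> j" "j < length Rs" "S y \<subseteq> Rs ! j" using step.IH by blast
    from x(1,2) show ?case
    proof (cases rule: vert_cases)
      case nonroot
      have "S x \<subset> up (S x)" using up[OF S_in[OF x(1)] nonroot] by (simp add: least_above_def)
      moreover have "S y = up (S x)" using par_nonroot[OF x(1) nonroot] unfolding x(3) by blast
      ultimately show ?thesis using j by blast
    next
      case (root m)
      then have y: "S y = Rs ! (m - 1)" "m - 1 < length Rs" using x(3) par_root vx(2) Rs_in by simp_all
      then have "Rs ! j = Rs ! (m - 1)" using j root_max[of "Rs ! (m - 1)" "Rs ! j"] Rs_in by simp
      then have "j = m - 1" using nth_eq_iff_index_eq[OF dist j(2) y(2)] by simp
      then show ?thesis using root j by (intro exI[of _ m]) auto
    qed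
  qed
  then show "w \<in> {w \<in> V. \<exists>j. i \<le> j \<and> j < length Rs \<and> S w \<subseteq> Rs ! j}" using w(1) by simp
next
  fix w assume "w \<in> {w \<in> V. \<exists>j. i \<le> j \<and> j < length Rs \<and> S w \<subseteq> Rs ! j}"
  then show "w \<in> desc (vx (Rs ! i))"
  proof (induction "dep w" arbitrary: w rule: less_induct)
    case less
    show ?case
    proof (cases "w = vx (Rs ! i)")
      case True
      then show ?thesis using desc_self less.prems by simp
    next
      case False
      obtain j where j: "w \<in> V" "i \<le> j" "j < length Rs" "S w \<subseteq> Rs ! j" using less.prems by blast
      have wr: "w \<noteq> r"
      proof
        assume "w = r"
        then have "Rs ! 0 \<subseteq> Rs ! j" using j r_in by simp
        moreover have "0 < length Rs" using i by linarith
        ultimately have "Rs ! j = Rs ! 0" using root_max[of "Rs ! 0" "Rs ! j"] Rs_in j by simp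
        then have "j = 0" using nth_eq_iff_index_eq[OF dist j(3) \<open>0 < length Rs\<close>] by simp
        then show False using j(2) False \<open>w = r\<close> by (simp add: r_def)
      qed
      have "\<exists>j. i \<le> j \<and> j < length Rs \<and> S (par w) \<subseteq> Rs ! j"
        using j(1) wr
      proof (cases rule: vert_cases)
        case nonroot
        then have "S w \<subset> Rs ! j" using j by auto
        then have "up (S w) \<subseteq> Rs ! j" using up[OF S_in[OF j(1)] nonroot] Rs_in[OF j(3)] by (simp add: least_above_def)
        then show ?thesis using par_nonroot[OF j(1) nonroot] j by auto
      next
        case (root m)
        then have "Rs ! j = Rs ! m" using j root_max[of "Rs ! m" "Rs ! j"] Rs_in by simp
        then have "j = m" using nth_eq_iff_index_eq[OF dist j(3) root(2)] by simp
        then have "i \<le> m - 1" "m - 1 < length Rs" using j(2) root False by (cases "i = m", auto)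
        moreover have "S (par w) = Rs ! (m - 1)" using root par_root vx(2) Rs_in by simp
        ultimately show ?thesis by blast
      qed
      then have "par w \<in> desc (vx (Rs ! i))"
        using less.hyps[of "par w"] par_less[OF j(1) wr] par_in[OF j(1) wr] by simp
      then show ?thesis using desc_step[OF j(1) wr False] by simp
    qed
  qed
qed

definition T :: ltree where
  "T = \<lparr>verts = V, edges = E, leaf = (\<lambda>l. vx {l})\<rparr>"

lemma T_sel [simp]: "verts T = V" "edges T = E" "leaf T l = vx {l}"
  by (simp_all add: T_def)

text \<open>A maximal proper submember containing \<open>a\<close> has \<open>A\<close> as its least
  proper superset in \<open>F\<close>. Applied to a second label outside the first child, this
  yields a second child.\<close>

lemma child_containing:
  assumes "A \<in> F" "a \<in> A" "A \<noteq> {a}"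
  shows "\<exists>B\<in>F. a \<in> B \<and> B \<notin> set Rs \<and> up B = A"
proof -
  define X where "X = {B \<in> F. a \<in> B \<and> B \<subset> A}"
  have "a \<in> labels n" using assms F_sub by blast
  then have "{a} \<in> X" using assms sing by (auto simp: X_def)
  then have "finite X" "X \<noteq> {}" using finF by (auto simp: X_def)
  then obtain B where B': "B \<in> X" and max: "\<And>C. C \<in> X \<Longrightarrow> B \<subseteq> C \<Longrightarrow> B = C"
    using finite_has_maximal by metis
  have B: "B \<in> F" "a \<in> B" "B \<subset> A" using B' by (auto simp: X_def)
  have nr: "B \<notin> set Rs" using root_max[of B A] B assms(1) by blast
  note BF = B(1)
  have la: "least_above B (up B)" using up[OF BF nr] .
  then have "up B \<subseteq> A" using B assms(1) by (simp add: least_above_def)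
  moreover have "\<not> up B \<subset> A" using max[of "up B"] la B(2) by (auto simp: least_above_def X_def)
  ultimately show ?thesis using B nr by auto
qed

text \<open>A singleton has no nonempty proper subset, hence no child off the path. If it lies on
  the path, \<open>root_sing\<close> leaves only the path with two vertices, where each end has one
  path neighbour.\<close>

lemma deg_singleton:
  assumes v: "v \<in> V" and Sv: "S v = {l}"
  shows "degree E v = 1"
proof -
  have nochild: False if "w \<in> V" "S w \<notin> set Rs" "par w = v" for w
  proof -
    have "up (S w) = {l}" using par_nonroot[OF that(1,2)] that(3) Sv by simp
    then have "S w \<subset> {l}" using up[OF S_in[OF that(1)] that(2)] by (simp add: least_above_def)
    then have "S w = {}" by blast
    then show False using S_in[OF that(1)] F_ne by simp
  qed
  show ?thesis
  proof (cases "{l} \<in> set Rs")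
    case False
    then have "v \<noteq> r" using r_in len Sv by (metis nth_mem order_less_le_trans zero_less_numeral)
    have "par w \<noteq> v" if "w \<in> V" "w \<noteq> r" for w
      using that
    proof (cases rule: vert_cases)
      case (root i)
      then have "S (par w) = Rs ! (i - 1)" "i - 1 < length Rs" using par_root vx(2) Rs_in by simp_all
      then show ?thesis using False Sv by (metis nth_mem)
    qed (use nochild that in blast)
    then have "{w \<in> V. w \<noteq> r \<and> par w = v} = {}" by blast
    then show ?thesis unfolding degree_E[OF v] using \<open>v \<noteq> r\<close> by (simp only: card.empty if_False add_0)
  next
    case True
    then have l2: "length Rs = 2" by (rule root_sing)
    obtain i where i: "i < length Rs" "{l} = Rs ! i" using True by (rule root_cases)
    then have vi: "v = vx (Rs ! i)" using vx(3)[OF v] Sv by simp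
    have R01: "Rs ! 0 \<noteq> Rs ! 1" using nth_eq_iff_index_eq[OF dist, of 0 1] l2 by simp
    have par1: "par (vx (Rs ! 1)) = vx (Rs ! 0)" using par_root[of 1] l2 by simp
    have only: "w = vx (Rs ! 1)" if "w \<in> V" "w \<noteq> r" "par w = v" for w
      using that(1,2)
    proof (cases rule: vert_cases)
      case (root j)
      then have "j = 1" using l2 by simp
      then show ?thesis using root by simp
    qed (use nochild that in blast)
    have ne: "vx (Rs ! 1) \<noteq> vx (Rs ! 0)" using vx_inj Rs_in l2 R01 by simp
    show ?thesis
    proof (cases "i = 0")
      case True
      have "{w \<in> V. w \<noteq> r \<and> par w = v} = {vx (Rs ! 1)}"
        using only par1 vi True vx(1) Rs_in l2 ne by (auto simp: r_def)
      then show ?thesis using degree_E[OF v] vi True by (simp add: r_def)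
    next
      case False
      then have "i = 1" using i l2 by simp
      have False if "w \<in> V" "w \<noteq> r" "par w = v" for w
        using only[OF that] that(3) par1 vi \<open>i = 1\<close> ne by simp
      then have "{w \<in> V. w \<noteq> r \<and> par w = v} = {}" by blast
      moreover have "v \<noteq> r" using vi \<open>i = 1\<close> ne by (simp add: r_def)
      ultimately show ?thesis unfolding degree_E[OF v] by (simp only: card.empty if_False add_0)
    qed
  qed
qed

text \<open>Two children come from the family. The third edge leads to the parent or, at the root,
  to the second vertex of the path.\<close>

lemma deg_nonsingleton:
  assumes v: "v \<in> V" and Sv: "\<And>l. S v \<noteq> {l}"
  shows "3 \<le> degree E v"
proof -
  let ?C = "{w \<in> V. w \<noteq> r \<and> par w = v}"
  have finC: "finite ?C" using finV by simp
  have child: "vx B \<in> ?C" if "B \<in> F" "B \<notin> set Rs" "up B = S v" for B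
    using that par_nonroot[of "vx B"] vx v r_in len by (auto simp: r_def) (metis nth_mem order_less_le_trans zero_less_numeral)
  obtain a where a: "a \<in> S v" using S_in[OF v] F_ne by fastforce
  obtain B where B: "B \<in> F" "a \<in> B" "B \<notin> set Rs" "up B = S v"
    using child_containing[OF S_in[OF v] a Sv] by blast
  have "B \<subset> S v" using up[OF B(1,3)] B(4) by (simp add: least_above_def)
  then obtain b where b: "b \<in> S v" "b \<notin> B" by blast
  obtain B' where B': "B' \<in> F" "b \<in> B'" "B' \<notin> set Rs" "up B' = S v"
    using child_containing[OF S_in[OF v] b(1) Sv] by blast
  have BB': "B \<noteq> B'" using b B' by blast
  have two: "vx B \<in> ?C" "vx B' \<in> ?C" "vx B \<noteq> vx B'" using child B B' BB' vx_inj by auto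
  show ?thesis
  proof (cases "v = r")
    case True
    have l: "0 < length Rs" "1 < length Rs" using len by linarith+
    have "Rs ! 1 \<noteq> Rs ! 0" using nth_eq_iff_index_eq[OF dist l(2,1)] by simp
    then have "vx (Rs ! 1) \<in> ?C" using True par_root[of 1] l vx(1) Rs_in vx_inj by (auto simp: r_def)
    moreover have "vx (Rs ! 1) \<noteq> vx B" "vx (Rs ! 1) \<noteq> vx B'"
      using vx_inj B B' Rs_in l by (metis nth_mem)+
    ultimately have "card {vx B, vx B', vx (Rs ! 1)} \<le> card ?C" using two by (intro card_mono finC) auto
    moreover have "card {vx B, vx B', vx (Rs ! 1)} = 3"
      using two \<open>vx (Rs ! 1) \<noteq> vx B\<close> \<open>vx (Rs ! 1) \<noteq> vx B'\<close> by auto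
    ultimately show ?thesis using degree_E[OF v] by linarith
  next
    case False
    have "card {vx B, vx B'} \<le> card ?C" using two by (intro card_mono finC) auto
    moreover have "card {vx B, vx B'} = 2" using two by simp
    ultimately show ?thesis using degree_E[OF v] False by simp
  qed
qed

lemma leaf_labelled_T: "leaf_labelled_tree n T"
  unfolding leaf_labelled_tree_def
proof (intro conjI ballI)
  show "tree (verts T) (edges T)" using tree_E by simp
  have lv: "v \<in> leaves T \<longleftrightarrow> v \<in> V \<and> (\<exists>l. S v = {l})" for v
    using deg_singleton[of v] deg_nonsingleton[of v] by (auto simp: leaves_def) fastforce
  show "bij_betw (leaf T) (labels n) (leaves T)"
    unfolding bij_betw_def
  proof (intro conjI inj_onI equalityI subsetI)
    show "l = m" if "l \<in> labels n" "m \<in> labels n" "leaf T l = leaf T m" for l m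
      using that vx_inj[OF sing sing] by auto
    show "v \<in> leaves T" if "v \<in> leaf T ` labels n" for v
      using that lv vx sing by auto
    show "v \<in> leaf T ` labels n" if "v \<in> leaves T" for v
    proof -
      obtain l where l: "v \<in> V" "S v = {l}" using lv \<open>v \<in> leaves T\<close> by blast
      then have "l \<in> labels n" using S_in F_sub by fastforce
      moreover have "v = leaf T l" using vx(3)[OF l(1)] l(2) by simp
      ultimately show ?thesis by blast
    qed
  qed
  show "degree (edges T) v \<noteq> 2" if "v \<in> verts T" for v
  proof (cases "\<exists>l. S v = {l}")
    case True
    then show ?thesis using deg_singleton[of v] that by auto
  next
    case False
    then show ?thesis using deg_nonsingleton[of v] that by auto
  qed
qed

sublocale LT: rooted_ltree T r par dep n
  rewrites "verts T = V" and "edges T = E" and "leaf T l = vx {l}"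
  by unfold_locales (use finV r_in par_in par_less leaf_labelled_T in auto)

lemma cl_nonroot: "v \<in> V \<Longrightarrow> S v \<notin> set Rs \<Longrightarrow> LT.cl v = S v"
proof -
  assume v: "v \<in> V" "S v \<notin> set Rs"
  have sub: "S v \<subseteq> labels n" using S_in[OF v(1)] F_sub by blast
  have "l \<in> LT.cl v \<longleftrightarrow> l \<in> labels n \<and> vx {l} \<in> desc v" for l by (simp add: LT.cl_def)
  also have "\<dots> l \<longleftrightarrow> l \<in> labels n \<and> l \<in> S v" for l
    unfolding desc_nonroot[OF v] using vx(1,2)[OF sing, of l] by auto
  finally show ?thesis using sub by blast
qed

lemma cl_root: "i < length Rs \<Longrightarrow> LT.cl (vx (Rs ! i)) = \<Union> (set (drop i Rs))"
proof -
  assume i: "i < length Rs"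
  have "l \<in> LT.cl (vx (Rs ! i)) \<longleftrightarrow> (\<exists>j. i \<le> j \<and> j < length Rs \<and> l \<in> Rs ! j)" for l
  proof -
    have "l \<in> labels n" if "j < length Rs" "l \<in> Rs ! j" for j using that Rs_in F_sub by blast
    then show ?thesis using desc_root_node[OF i] vx sing by (auto simp: LT.cl_def)
  qed
  moreover have "l \<in> \<Union> (set (drop i Rs)) \<longleftrightarrow> (\<exists>j. i \<le> j \<and> j < length Rs \<and> l \<in> Rs ! j)" for l
  proof -
    have "l \<in> \<Union> (set (drop i Rs)) \<longleftrightarrow> (\<exists>j<length Rs - i. l \<in> Rs ! (i + j))"
      by (auto simp: set_conv_nth)
    also have "\<dots> \<longleftrightarrow> (\<exists>j. i \<le> j \<and> j < length Rs \<and> l \<in> Rs ! j)"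
      by (metis add.commute le_add1 le_add_diff_inverse less_diff_conv)
    finally show ?thesis .
  qed
  ultimately show ?thesis by blast
qed

text \<open>A path vertex cuts off the whole tail of the path, so a set in the middle of
  \<open>Rs\<close> does not appear by itself; the partial unions do.\<close>

lemma sides_T: "sides n T = (\<Union>A\<in>F - set Rs. {A, labels n - A}) \<union>
   (\<Union>i\<in>{0<..<length Rs}. {\<Union> (set (drop i Rs)), labels n - \<Union> (set (drop i Rs))})"
proof -
  \<comment> \<open>The root need not be a leaf here, so properness of the clusters has its own
    argument: off the path the parent is a strictly larger label set, and on the path the labels of
    \<open>Rs ! 0\<close> are missed.\<close>
  have ne: "LT.cl v \<noteq> {}" "LT.cl v \<noteq> labels n" if v: "v \<in> V" "v \<noteq> r" for v
  proof -
    show "LT.cl v \<noteq> {}" using LT.cl_nonempty v by simp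
    have l0: "0 < length Rs" using len by linarith
    from v show "LT.cl v \<noteq> labels n"
    proof (cases rule: vert_cases)
      case nonroot
      have "S v \<subset> up (S v)" "up (S v) \<subseteq> labels n"
        using up[OF S_in[OF v(1)] nonroot] F_sub by (auto simp: least_above_def)
      then show ?thesis using cl_nonroot[OF v(1) nonroot] by blast
    next
      case (root i)
      have "Rs ! 0 \<subseteq> labels n" "Rs ! 0 \<noteq> {}" using Rs_in[OF l0] F_sub F_ne by auto
      moreover have "Rs ! 0 \<inter> LT.cl v = {}"
      proof -
        have "Rs ! 0 \<inter> R = {}" if R: "R \<in> set (drop i Rs)" for R
        proof -
          obtain j where "j < length Rs - i" "R = Rs ! (i + j)" using R by (auto simp: in_set_conv_nth)
          then show ?thesis using Rs_disjoint[of 0 "i + j"] root l0 by simp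
        qed
        then show ?thesis using cl_root[OF root(2)] root(3) by blast
      qed
      ultimately show ?thesis by blast
    qed
  qed
  have "sides n T = (\<Union>v\<in>V - {r}. {LT.cl v, labels n - LT.cl v})"
  proof -
    have "split_of n T {v, par v} = {LT.cl v, labels n - LT.cl v}" if "v \<in> V - {r}" for v
      using that ne by (intro LT.split_of_cl) auto
    then show ?thesis by (simp add: sides_def E_def image_image)
  qed
  also have "\<dots> = (\<Union>A\<in>LT.cl ` (V - {r}). {A, labels n - A})" by blast
  also have "LT.cl ` (V - {r}) = (F - set Rs) \<union> (\<lambda>i. \<Union> (set (drop i Rs))) ` {0<..<length Rs}"
  proof (intro equalityI subsetI)
    fix A assume "A \<in> LT.cl ` (V - {r})"
    then obtain v where v: "v \<in> V" "v \<noteq> r" "A = LT.cl v" by blast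
    from v(1,2) show "A \<in> (F - set Rs) \<union> (\<lambda>i. \<Union> (set (drop i Rs))) ` {0<..<length Rs}"
    proof (cases rule: vert_cases)
      case nonroot
      then show ?thesis using cl_nonroot[OF v(1)] v(3) S_in[OF v(1)] by simp
    next
      case (root i)
      then show ?thesis using cl_root v(3) by auto
    qed
  next
    fix A assume "A \<in> (F - set Rs) \<union> (\<lambda>i. \<Union> (set (drop i Rs))) ` {0<..<length Rs}"
    then consider "A \<in> F" "A \<notin> set Rs" | i where "0 < i" "i < length Rs" "A = \<Union> (set (drop i Rs))" by auto
    then show "A \<in> LT.cl ` (V - {r})"
    proof cases
      case 1
      have "vx A \<noteq> r" using 1 vx(2) r_in len by (metis nth_mem order_less_le_trans zero_less_numeral)
      moreover have "LT.cl (vx A) = A" using cl_nonroot[of "vx A"] vx 1 by simp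
      ultimately show ?thesis using vx(1)[OF 1(1)] by (metis DiffI imageI singletonD)
    next
      case 2
      have l0: "0 < length Rs" using len by linarith
      have "Rs ! i \<noteq> Rs ! 0" using nth_eq_iff_index_eq[OF dist 2(2) l0] 2(1) by simp
      then have "vx (Rs ! i) \<noteq> r" using vx_inj Rs_in 2 l0 by (simp add: r_def)
      then show ?thesis using cl_root[OF 2(2)] vx(1) Rs_in 2 by (metis DiffI imageI singletonD)
    qed
  qed
  finally show ?thesis by (simp only: UN_Un image_image UN_simps)
qed

end

section \<open>Symmetric trees from codes\<close>

text \<open>\<open>trunk_swap_closed\<close> says that every path edge is mapped to itself, with its
  ends fixed or exchanged. This covers a trunk with several vertices and a trunk that is the
  midpoint of an edge.\<close>

locale symmetric_forest = joined_forest +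
  assumes swap_closed: "A \<in> F \<Longrightarrow> swap ` A \<in> F"
    and trunk_swap_closed: "Suc i < length Rs \<Longrightarrow> {swap ` (Rs ! i), swap ` (Rs ! Suc i)} = {Rs ! i, Rs ! Suc i}"
begin

definition \<sigma> :: "nat \<Rightarrow> nat" where "\<sigma> v = vx (swap ` S v)"

lemma \<sigma>: "v \<in> V \<Longrightarrow> \<sigma> v \<in> V" "v \<in> V \<Longrightarrow> S (\<sigma> v) = swap ` S v" "v \<in> V \<Longrightarrow> \<sigma> (\<sigma> v) = v"
  using vx swap_closed S_in by (simp_all add: \<sigma>_def)

lemma \<sigma>_vx: "A \<in> F \<Longrightarrow> \<sigma> (vx A) = vx (swap ` A)"
  using vx by (simp add: \<sigma>_def)

lemma swap_root: "R \<in> set Rs \<Longrightarrow> swap ` R \<in> set Rs"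
proof -
  assume "R \<in> set Rs"
  then obtain i where i: "i < length Rs" "R = Rs ! i" by (rule root_cases)
  show ?thesis
  proof (cases "Suc i < length Rs")
    case True
    then have "swap ` R \<in> {Rs ! i, Rs ! Suc i}" unfolding trunk_swap_closed[OF True, symmetric] i(2) by simp
    then show ?thesis using i(1) True by auto
  next
    case False
    then obtain j where j: "i = Suc j" using len i(1) by (cases i) auto
    then have "Suc j < length Rs" using i(1) by simp
    then have "swap ` R \<in> {Rs ! j, Rs ! Suc j}" unfolding trunk_swap_closed[OF \<open>Suc j < length Rs\<close>, symmetric] i(2) j by simp
    then show ?thesis using i(1) j by auto
  qed
qed

lemma swap_nonroot: "A \<notin> set Rs \<Longrightarrow> swap ` A \<notin> set Rs"
  using swap_root[of "swap ` A"] by auto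

lemma up_swap:
  assumes "A \<in> F" "A \<notin> set Rs"
  shows "up (swap ` A) = swap ` up A"
proof (rule up_eq)
  have la: "least_above A (up A)" using up assms by blast
  show "least_above (swap ` A) (swap ` up A)"
    unfolding least_above_def
  proof (intro conjI ballI impI)
    show "swap ` up A \<in> F" using la swap_closed by (simp add: least_above_def)
    show "swap ` A \<subset> swap ` up A"
      using la by (simp add: least_above_def psubset_eq swap_image_subset)
    fix C assume C: "C \<in> F" "swap ` A \<subset> C"
    have "A \<subset> swap ` C"
      using C(2) swap_image_subset[of "swap ` A" C] by (auto simp: psubset_eq)
    then have "up A \<subseteq> swap ` C" using la swap_closed[OF C(1)] by (simp add: least_above_def)
    then show "swap ` up A \<subseteq> C" using swap_image_subset[of "up A" "swap ` C"] by simp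
  qed
  show "swap ` A \<in> F" "swap ` A \<notin> set Rs" using swap_closed swap_nonroot assms by auto
qed

lemma \<sigma>_edge:
  assumes v: "v \<in> V" "v \<noteq> r"
  shows "\<sigma> ` {v, par v} \<in> E"
  using v
proof (cases rule: vert_cases)
  case nonroot
  have nr: "S (\<sigma> v) \<notin> set Rs" using swap_nonroot[OF nonroot] \<sigma>(2)[OF v(1)] by simp
  have "par (\<sigma> v) = vx (swap ` up (S v))"
    using par_nonroot[OF \<sigma>(1)[OF v(1)] nr] \<sigma>(2)[OF v(1)] up_swap[OF S_in[OF v(1)] nonroot] by simp
  also have "\<dots> = \<sigma> (par v)"
    using par_nonroot[OF v(1) nonroot] unfolding \<sigma>_def by metis
  finally have "\<sigma> ` {v, par v} = {\<sigma> v, par (\<sigma> v)}" by simp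
  moreover have "\<sigma> v \<noteq> r"
  proof
    assume "\<sigma> v = r"
    then have "S (\<sigma> v) = Rs ! 0" using r_in by simp
    moreover have "Rs ! 0 \<in> set Rs" by (rule nth_mem) (use len in linarith)
    ultimately show False using nr by simp
  qed
  ultimately show ?thesis using \<sigma>(1)[OF v(1)] by (auto simp: E_def)
next
  case (root i)
  then obtain j where j: "i = Suc j" by (cases i) auto
  have pv: "par v = vx (Rs ! j)" using par_root[of i] root j by simp
  have RF: "Rs ! j \<in> F" "Rs ! Suc j \<in> F" using Rs_in root j by auto
  have "\<sigma> ` {v, par v} = {vx (swap ` (Rs ! Suc j)), vx (swap ` (Rs ! j))}"
    using \<sigma>_vx[OF RF(1)] \<sigma>_vx[OF RF(2)] pv root(3) j by simp
  also have "\<dots> = vx ` {swap ` (Rs ! j), swap ` (Rs ! Suc j)}" by (simp add: insert_commute)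
  also have "\<dots> = vx ` {Rs ! j, Rs ! Suc j}" using trunk_swap_closed[of j] root j by simp
  also have "\<dots> = {v, par v}" using pv root(3) j by auto
  finally show ?thesis using v by (auto simp: E_def)
qed

lemma graph_iso_\<sigma>: "graph_iso T T \<sigma>"
proof -
  have bij\<sigma>: "bij_betw \<sigma> V V"
    by (rule bij_betw_byWitness[of V \<sigma> \<sigma> V]) (use \<sigma> in auto)
  have EV: "e \<subseteq> V" if "e \<in> E" for e using that par_in by (auto simp: E_def)
  have "(\<lambda>e. \<sigma> ` e) ` E = E"
  proof (rule endo_inj_surj)
    show "finite E" using finV by (simp add: E_def)
    show "(\<lambda>e. \<sigma> ` e) ` E \<subseteq> E"
    proof (rule image_subsetI)
      fix e assume "e \<in> E"
      then obtain v where "v \<in> V" "v \<noteq> r" "e = {v, par v}" by (auto simp: E_def)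
      then show "\<sigma> ` e \<in> E" using \<sigma>_edge by blast
    qed
    show "inj_on (\<lambda>e. \<sigma> ` e) E"
      using EV inj_on_image_eq_iff[OF bij_betw_imp_inj_on[OF bij\<sigma>]] by (meson inj_onI)
  qed
  then show ?thesis using bij\<sigma> by (simp add: graph_iso_def)
qed

lemma leaf_\<sigma>: "\<forall>l\<in>labels n. \<sigma> (leaf T l) = leaf T (swap l)"
  using \<sigma>_vx[OF sing] by auto

lemma fixed_points_iff: "p \<in> fixed_points T \<sigma> \<longleftrightarrow> (\<forall>v. 0 \<le> p v) \<and>
    {v. p v \<noteq> 0} \<in> (\<lambda>v. {v}) ` V \<union> E \<and> sum p V = 1 \<and> (\<forall>v\<in>V. p (\<sigma> v) = p v)"
  by (auto simp: fixed_points_def realization_def)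

text \<open>Off the path a parent is a strictly larger label set than its child, whereas mirror
  images have equal size. So a flipped edge lies on the path.\<close>

lemma flipped_edge:
  assumes v: "v \<in> V" "v \<noteq> r" "\<sigma> v = par v"
  shows "\<exists>j. Suc j < length Rs \<and> S v = Rs ! Suc j \<and> S (par v) = Rs ! j \<and> swap ` (Rs ! Suc j) = Rs ! j"
  using v(1,2)
proof (cases rule: vert_cases)
  case nonroot
  have "up (S v) = swap ` S v" using par_nonroot[OF v(1) nonroot] \<sigma>(2)[OF v(1)] v(3) by metis
  moreover have "S v \<subset> up (S v)" using up[OF S_in[OF v(1)] nonroot] by (simp add: least_above_def)
  moreover have "finite (swap ` S v)" using S_in[OF v(1)] F_sub finite_labels finite_subset by blast
  ultimately have "card (S v) < card (swap ` S v)" by (metis psubset_card_mono)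
  then show ?thesis by simp
next
  case (root i)
  then obtain j where j: "i = Suc j" by (cases i) auto
  have "S (par v) = Rs ! j" using par_root[of i] root j vx(2) Rs_in by simp
  moreover have "swap ` (Rs ! Suc j) = S (par v)" using \<sigma>(2)[OF v(1)] v(3) root(4) j by simp
  ultimately show ?thesis using root j by auto
qed

lemma support_cases:
  assumes p: "p \<in> fixed_points T \<sigma>"
  obtains (vertex) v where "v \<in> V" "{v. p v \<noteq> 0} = {v}" "\<sigma> v = v"
  | (edge) v where "v \<in> V" "v \<noteq> r" "{v. p v \<noteq> 0} = {v, par v}" "\<sigma> v = v"
  | (flipped) v where "v \<in> V" "v \<noteq> r" "{v. p v \<noteq> 0} = {v, par v}" "\<sigma> v = par v"
proof -
  have supp: "{v. p v \<noteq> 0} \<in> (\<lambda>v. {v}) ` V \<union> E" and inv: "\<And>v. v \<in> V \<Longrightarrow> p (\<sigma> v) = p v"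
    using p by (auto simp: fixed_points_iff)
  have step: "\<sigma> v \<in> {v. p v \<noteq> 0}" if "v \<in> V" "v \<in> {v. p v \<noteq> 0}" for v
    using inv[OF that(1)] that(2) by simp
  from supp consider v where "v \<in> V" "{v. p v \<noteq> 0} = {v}"
    | v where "v \<in> V" "v \<noteq> r" "{v. p v \<noteq> 0} = {v, par v}"
    by (auto simp: E_def)
  then show ?thesis
  proof cases
    case (1 v)
    then have "\<sigma> v = v" using step[of v] by blast
    then show ?thesis using vertex 1 by blast
  next
    case (2 v)
    then have "\<sigma> v = v \<or> \<sigma> v = par v" using step[of v] by blast
    then show ?thesis using edge flipped 2 by blast
  qed
qed

text \<open>Here the fixed vertices are exactly the path vertices, and no edge is flipped, since
  that would identify two different entries of \<open>Rs\<close>. The fixed points are then the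
  realization of the path, which \<open>path_list\<close> handles.\<close>

lemma path_if_roots_fixed:
  assumes fixR: "\<And>R. R \<in> set Rs \<Longrightarrow> swap ` R = R" and fixF: "\<And>A. A \<in> F \<Longrightarrow> swap ` A = A \<Longrightarrow> A \<in> set Rs"
  shows "is_path (fixed_points T \<sigma>)"
proof -
  define vs where "vs = map vx Rs"
  have vs: "length vs = length Rs" "\<And>i. i < length Rs \<Longrightarrow> vs ! i = vx (Rs ! i)" by (simp_all add: vs_def)
  have fixv: "v \<in> set vs" if "v \<in> V" "\<sigma> v = v" for v
  proof -
    have "S v \<in> set Rs" using fixF[OF S_in[OF that(1)]] \<sigma>(2)[OF that(1)] that(2) by simp
    then show ?thesis using vx(3)[OF that(1)] by (metis image_eqI set_map vs_def)
  qed
  have vs_fix: "\<sigma> v = v" if "v \<in> set vs" for v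
    using that fixR \<sigma>_vx RsF by (auto simp: vs_def)
  have vsV: "set vs \<subseteq> V" using RsF vx(1) by (auto simp: vs_def)
  have vsE: "{vs ! i, vs ! Suc i} \<in> E" if "Suc i < length vs" for i
  proof -
    have i: "Suc i < length Rs" "0 < length Rs" using that vs by auto
    then have "Rs ! Suc i \<noteq> Rs ! 0" using nth_eq_iff_index_eq[OF dist i] by simp
    then have "vx (Rs ! Suc i) \<noteq> r" using vx_inj Rs_in i by (simp add: r_def)
    moreover have "par (vx (Rs ! Suc i)) = vx (Rs ! i)" using par_root[of "Suc i"] i by simp
    ultimately have "{vx (Rs ! Suc i), vx (Rs ! i)} \<in> E"
      unfolding E_def using vx(1)[OF Rs_in[OF i(1)]] by (intro image_eqI[of _ _ "vx (Rs ! Suc i)"]) auto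
    then show ?thesis using vs i by (simp add: insert_commute)
  qed
  let ?I = "(\<lambda>v. {v}) ` set vs \<union> {{vs ! i, vs ! Suc i} | i. Suc i < length vs}"
  have "fixed_points T \<sigma> = {p. (\<forall>v. 0 \<le> p v) \<and> {v. p v \<noteq> 0} \<in> ?I \<and> sum p V = 1}"
  proof (intro equalityI subsetI)
    fix p assume p: "p \<in> fixed_points T \<sigma>"
    then have "{v. p v \<noteq> 0} \<in> ?I"
    proof (cases rule: support_cases)
      case (vertex v)
      then show ?thesis using fixv by simp
    next
      case (edge v)
      have "S v \<in> set Rs" using fixF[OF S_in[OF edge(1)]] \<sigma>(2)[OF edge(1)] edge(4) by simp
      from edge(1,2) show ?thesis
      proof (cases rule: vert_cases)
        case (root i)
        then obtain j where j: "i = Suc j" by (cases i) auto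
        have "v = vs ! Suc j" "par v = vs ! j" using root j vs par_root[of i] by simp_all
        then have "{v, par v} = {vs ! j, vs ! Suc j}" by (simp add: insert_commute)
        moreover have "Suc j < length vs" using root j vs by simp
        ultimately show ?thesis unfolding edge(3) by blast
      qed (use \<open>S v \<in> set Rs\<close> in simp)
    next
      case (flipped v)
      then obtain j where j: "Suc j < length Rs" "swap ` (Rs ! Suc j) = Rs ! j"
        using flipped_edge by blast
      then have "Rs ! Suc j = Rs ! j" using fixR[of "Rs ! Suc j"] by simp
      moreover have "j < length Rs" using j by simp
      ultimately show ?thesis using nth_eq_iff_index_eq[OF dist j(1), of j] by simp
    qed
    then show "p \<in> {p. (\<forall>v. 0 \<le> p v) \<and> {v. p v \<noteq> 0} \<in> ?I \<and> sum p V = 1}"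
      using p by (simp add: fixed_points_iff)
  next
    fix p :: "nat \<Rightarrow> real" assume "p \<in> {p. (\<forall>v. 0 \<le> p v) \<and> {v. p v \<noteq> 0} \<in> ?I \<and> sum p V = 1}"
    then have p: "\<And>v. 0 \<le> p v" "{v. p v \<noteq> 0} \<in> ?I" "sum p V = 1" by auto
    have "{v. p v \<noteq> 0} \<in> (\<lambda>v. {v}) ` V \<union> E" using p(2) vsV vsE by auto
    moreover have supp: "{v. p v \<noteq> 0} \<subseteq> set vs"
    proof -
      have "A \<subseteq> set vs" if "A \<in> ?I" for A using that by auto
      then show ?thesis using p(2) by blast
    qed
    have "p (\<sigma> v) = p v" if v: "v \<in> V" for v
    proof (cases "v \<in> set vs")
      case True
      then show ?thesis using vs_fix by simp
    next
      case False
      then have "\<sigma> v \<notin> set vs" using vs_fix \<sigma>(3)[OF v] by metis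
      then have "p (\<sigma> v) = 0" "p v = 0" using supp False by auto
      then show ?thesis by simp
    qed
    ultimately show "p \<in> fixed_points T \<sigma>" using p(1,3) by (auto simp: fixed_points_iff)
  qed
  moreover have "distinct vs"
    unfolding vs_def using dist vx_inj RsF by (auto simp: distinct_map inj_on_def)
  moreover have "vs \<noteq> []" using len by (auto simp: vs_def)
  ultimately show ?thesis using path_list[OF finV vsV] by simp
qed

text \<open>Without fixed vertices, a fixed point is supported on a flipped edge, which can only be
  the single path edge. Equal coordinates at its ends leave the midpoint.\<close>

lemma path_if_none_fixed:
  assumes nofix: "\<And>A. A \<in> F \<Longrightarrow> swap ` A \<noteq> A" and l2: "length Rs = 2"
  shows "is_path (fixed_points T \<sigma>)"
proof -
  let ?a = "vx (Rs ! 0)" and ?b = "vx (Rs ! 1)"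
  have RF: "Rs ! 0 \<in> F" "Rs ! 1 \<in> F" using Rs_in l2 by auto
  have swap_closed: "swap ` (Rs ! 0) = Rs ! 1" "swap ` (Rs ! 1) = Rs ! 0"
    using trunk_swap_closed[of 0] l2 nofix RF by (auto simp: doubleton_eq_iff)
  have ab: "?a \<in> V" "?b \<in> V" "\<sigma> ?a = ?b" "\<sigma> ?b = ?a"
    using vx(1) RF \<sigma>_vx[OF RF(1)] \<sigma>_vx[OF RF(2)] swap_closed by auto
  have ne: "?a \<noteq> ?b" using vx_inj[OF RF] nofix[OF RF(1)] swap_closed by auto
  have par: "par ?b = ?a" using par_root[of 1] l2 by simp
  have E: "{?a, ?b} \<in> E" unfolding E_def using ab ne par by (intro image_eqI[of _ _ ?b]) (auto simp: r_def)
  define m where "m v = (if v = ?a \<or> v = ?b then 1 / 2 else 0 :: real)" for v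
  have nov: "\<sigma> v \<noteq> v" if "v \<in> V" for v
    using \<sigma>(2)[OF that] nofix[OF S_in[OF that]] by auto
  have "fixed_points T \<sigma> = {m}"
  proof (intro equalityI subsetI)
    fix p assume p: "p \<in> fixed_points T \<sigma>"
    then have "{v. p v \<noteq> 0} = {?a, ?b}"
    proof (cases rule: support_cases)
      case (flipped v)
      then obtain j where j: "Suc j < length Rs" "S v = Rs ! Suc j" using flipped_edge by blast
      then have "v = ?b" using vx(3)[OF flipped(1)] l2 by simp
      then show ?thesis using flipped par by auto
    qed (use nov in blast)+
    moreover from this have "sum p V = sum p {?a, ?b}"
      by (intro sum.mono_neutral_right finV) (use ab in auto)
    moreover have "p ?b = p ?a" using p ab by (auto simp: fixed_points_iff)
    moreover have "sum p V = 1" using p by (simp add: fixed_points_iff)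
    ultimately have "p ?a = 1 / 2" "p ?b = 1 / 2" "\<And>v. v \<noteq> ?a \<Longrightarrow> v \<noteq> ?b \<Longrightarrow> p v = 0"
      using ne by auto
    then show "p \<in> {m}" by (auto simp: m_def fun_eq_iff)
  next
    fix p assume "p \<in> {m}"
    then have pm: "p = m" by simp
    have "{v. m v \<noteq> 0} = {?a, ?b}" by (auto simp: m_def)
    moreover have "sum m V = sum m {?a, ?b}"
      by (intro sum.mono_neutral_right finV) (use ab in \<open>auto simp: m_def\<close>)
    then have "sum m V = 1" using ne by (simp add: m_def)
    moreover have "m (\<sigma> v) = m v" if "v \<in> V" for v
    proof -
      have "\<sigma> v = ?a \<longleftrightarrow> v = ?b" "\<sigma> v = ?b \<longleftrightarrow> v = ?a" using ab \<sigma>(3)[OF that] by metis+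
      then show ?thesis by (auto simp: m_def)
    qed
    ultimately show "p \<in> fixed_points T \<sigma>" using E by (auto simp: pm fixed_points_iff m_def)
  qed
  then show ?thesis using is_path_singleton by simp
qed

end

section \<open>Cluster families of plane trees and of codes\<close>

lemma distinct_ixD: "distinct (indices t) \<Longrightarrow> disjoint_leaves t \<and> leaf_set t \<inter> swap ` leaf_set t = {}"
proof (induction t)
  case (Nd s t)
  have no: "index a \<noteq> index b" if "a \<in> leaf_set s" "b \<in> leaf_set t" for a b
    using that Nd.prems by (auto simp: set_indices)
  have "leaf_set s \<inter> leaf_set t = {}" "leaf_set s \<inter> swap ` leaf_set t = {}" "leaf_set t \<inter> swap ` leaf_set s = {}"
    using no by fastforce+
  with Nd show ?case by (auto simp: image_Un Int_Un_distrib Int_Un_distrib2)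
qed auto

lemma clusters_laminar: "disjoint_leaves t \<Longrightarrow> laminar (clusters t)"
proof (induction t)
  case (Nd s t)
  then have "laminar (clusters s)" "laminar (clusters t)" "leaf_set s \<inter> leaf_set t = {}" by auto
  then show ?case
    using clusters_sub[of _ s] clusters_sub[of _ t] unfolding laminar_def clusters.simps by (smt (verit) Un_iff disjoint_iff insert_iff subset_iff)
qed (simp add: laminar_def)

lemma sym_clusters_iff: "A \<in> sym_clusters t \<longleftrightarrow> A \<in> clusters t \<or> swap ` A \<in> clusters t"
  unfolding sym_clusters_def by (metis UnCI UnE image_iff swap_image_image)

lemma sym_clusters_swap: "A \<in> sym_clusters t \<Longrightarrow> swap ` A \<in> sym_clusters t"
  by (auto simp: sym_clusters_iff)

lemma finite_sym_clusters [simp]: "finite (sym_clusters t)"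
  by (simp add: sym_clusters_def)

lemma sym_clusters_sub: "A \<in> sym_clusters t \<Longrightarrow> A \<subseteq> leaf_set t \<or> A \<subseteq> swap ` leaf_set t"
  unfolding sym_clusters_def using clusters_sub by blast

lemma sym_clusters_sub_base: "A \<in> sym_clusters t \<Longrightarrow> A \<subseteq> base t"
  using sym_clusters_sub unfolding base_def by blast

lemma sym_clusters_nonempty: "A \<in> sym_clusters t \<Longrightarrow> A \<noteq> {}"
  unfolding sym_clusters_def using clusters_nonempty by blast

lemma singleton_in_sym_clusters: "a \<in> base t \<Longrightarrow> {a} \<in> sym_clusters t"
  using singleton_in_clusters[of a t] singleton_in_clusters[of "swap a" t]
  by (auto simp: base_def sym_clusters_iff swap_image_iff)

lemma sym_clusters_small: "leaf_set t \<inter> swap ` leaf_set t = {} \<Longrightarrow> A \<in> sym_clusters t \<Longrightarrow> A \<inter> swap ` A = {}"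
proof -
  assume d: "leaf_set t \<inter> swap ` leaf_set t = {}" and "A \<in> sym_clusters t"
  then consider "A \<subseteq> leaf_set t" | "swap ` A \<subseteq> leaf_set t"
    using sym_clusters_sub[of A t] swap_image_subset[of A "swap ` leaf_set t"] unfolding swap_image_image by blast
  then show ?thesis
  proof cases
    case 1
    then have "swap ` A \<subseteq> swap ` leaf_set t" by (rule image_mono)
    then show ?thesis using 1 d by blast
  next
    case 2
    then have "A \<subseteq> swap ` leaf_set t" by (metis image_mono swap_image_image)
    then show ?thesis using 2 d by blast
  qed
qed

lemma sym_clusters_laminar:
  assumes "distinct (indices t)"
  shows "laminar (sym_clusters t)"
proof -
  have d: "leaf_set t \<inter> swap ` leaf_set t = {}" and l: "laminar (clusters t)"
    using distinct_ixD[OF assms] clusters_laminar by auto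
  show ?thesis
    unfolding laminar_def
  proof (intro ballI)
    fix A B assume "A \<in> sym_clusters t" "B \<in> sym_clusters t"
    then consider "A \<in> clusters t" "B \<in> clusters t" | "swap ` A \<in> clusters t" "swap ` B \<in> clusters t"
      | "A \<in> clusters t" "swap ` B \<in> clusters t" | "swap ` A \<in> clusters t" "B \<in> clusters t"
      by (auto simp: sym_clusters_iff)
    then show "A \<subseteq> B \<or> B \<subseteq> A \<or> A \<inter> B = {}"
    proof cases
      case 1
      then show ?thesis using laminarD[OF l] by blast
    next
      case 2
      then show ?thesis using laminarD[OF l 2] by (auto simp: swap_image_subset simp flip: swap_image_Int)
    next
      case 3
      then have "A \<subseteq> leaf_set t" "B \<subseteq> swap ` leaf_set t" using clusters_sub swap_image_subset[of "swap ` B" "leaf_set t"] by auto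
      then show ?thesis using d by blast
    next
      case 4
      then have "B \<subseteq> leaf_set t" "A \<subseteq> swap ` leaf_set t" using clusters_sub swap_image_subset[of "swap ` A" "leaf_set t"] by auto
      then show ?thesis using d by blast
    qed
  qed
qed

lemma base_nonempty [simp]: "base t \<noteq> {}"
  by (simp add: base_def)

locale code =
  fixes n :: nat and ts :: "bt list"
  assumes code: "ts \<in> Codes n"
begin

lemma ts_ne: "ts \<noteq> []" and dist_indices: "distinct (concat (map indices ts))"
  and set_indices_ts: "set (concat (map indices ts)) = {1..n}" and no_mono_cherry_ts: "t \<in> set ts \<Longrightarrow> no_mono_cherry t"
  using code by (auto simp: Codes_def)

lemma indices_nonempty: "indices t \<noteq> []"
  by (induction t) auto

lemma dist_map_indices: "distinct (map indices ts)"
proof -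
  have "removeAll [] (map indices ts) = map indices ts" by (rule removeAll_id) (use indices_nonempty in \<open>auto simp: eq_commute[of "[]"]\<close>)
  then show ?thesis using dist_indices by (simp add: distinct_concat_iff)
qed

lemma dist_ts: "distinct ts"
  using dist_map_indices by (simp add: distinct_map)

lemma dist_indices_t: "t \<in> set ts \<Longrightarrow> distinct (indices t)"
  using dist_indices by (auto simp: distinct_concat_iff)

lemma leaf_set_small: "t \<in> set ts \<Longrightarrow> leaf_set t \<inter> swap ` leaf_set t = {}"
  using distinct_ixD dist_indices_t by blast

lemma base_disjoint:
  assumes "t \<in> set ts" "u \<in> set ts" "t \<noteq> u"
  shows "base t \<inter> base u = {}"
proof -
  have "indices t \<noteq> indices u" using dist_map_indices assms by (auto simp: distinct_map inj_on_def)
  then have "set (indices t) \<inter> set (indices u) = {}"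
    using dist_indices assms by (auto simp: distinct_concat_iff)
  then show ?thesis unfolding index_base[symmetric] by blast
qed

lemma Un_base: "\<Union> (base ` set ts) = labels n"
proof (intro equalityI subsetI)
  fix a assume "a \<in> \<Union> (base ` set ts)"
  then obtain t where "t \<in> set ts" "a \<in> base t" by blast
  then have "index a \<in> set (concat (map indices ts))" using index_base[of t] by auto
  then show "a \<in> labels n" unfolding set_indices_ts labels_iff_index .
next
  fix a assume "a \<in> labels n"
  then have "index a \<in> set (concat (map indices ts))" unfolding set_indices_ts labels_iff_index .
  then obtain t where t: "t \<in> set ts" "index a \<in> index ` base t" using index_base by auto
  then obtain b where b: "b \<in> base t" "index a = index b" by blast
  then have "a = b \<or> a = swap b" by (simp add: index_eq_iff)
  then have "a \<in> base t" using b(1) swap_base[of t] by blast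
  then show "a \<in> \<Union> (base ` set ts)" using t by blast
qed

lemma code_small_iff: "A \<in> code_small ts \<longleftrightarrow> (\<exists>t\<in>set ts. A \<in> sym_clusters t)"
  by (auto simp: code_small_def)

lemma code_small_props: "A \<in> code_small ts \<Longrightarrow> A \<noteq> {}" "A \<in> code_small ts \<Longrightarrow> A \<inter> swap ` A = {}"
  "A \<in> code_small ts \<Longrightarrow> swap ` A \<in> code_small ts" "A \<in> code_small ts \<Longrightarrow> A \<subseteq> labels n"
  "l \<in> labels n \<Longrightarrow> {l} \<in> code_small ts"
  "A \<in> code_small ts \<Longrightarrow> swap ` A \<noteq> A"
proof -
  show ne: "A \<in> code_small ts \<Longrightarrow> A \<noteq> {}" using sym_clusters_nonempty by (auto simp: code_small_iff)
  show sm: "A \<in> code_small ts \<Longrightarrow> A \<inter> swap ` A = {}" using sym_clusters_small leaf_set_small unfolding code_small_iff by blast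
  show "A \<in> code_small ts \<Longrightarrow> swap ` A \<in> code_small ts" using sym_clusters_swap by (auto simp: code_small_iff)
  show "A \<in> code_small ts \<Longrightarrow> A \<subseteq> labels n" using sym_clusters_sub_base Un_base unfolding code_small_iff by blast
  show "l \<in> labels n \<Longrightarrow> {l} \<in> code_small ts" using singleton_in_sym_clusters Un_base unfolding code_small_iff by blast
  show "A \<in> code_small ts \<Longrightarrow> swap ` A \<noteq> A" using ne sm by auto
qed

text \<open>The path consists of the leaf set and its mirror image, which are also the two sides of
  the edge between them. If \<open>t\<close> is a single leaf, this is the tree with one
  edge.\<close>

lemma tree_of_single:
  assumes ts: "ts = [t]"
  shows "\<exists>T \<sigma>. leaf_labelled_tree n T \<and> sides n T = code_sides n ts \<and> graph_iso T T \<sigma> \<and>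
    (\<forall>l\<in>labels n. \<sigma> (leaf T l) = leaf T (swap l)) \<and> is_path (fixed_points T \<sigma>)"
proof -
  let ?L = "leaf_set t"
  let ?Rs = "[?L, swap ` ?L]"
  obtain S where S: "bij_betw S {0..<card (sym_clusters t)} (sym_clusters t)"
    using ex_bij_betw_nat_finite[of "sym_clusters t"] by auto
  have d: "?L \<inter> swap ` ?L = {}" using leaf_set_small ts by simp
  have Lne: "?L \<noteq> swap ` ?L" using d leaf_set_nonempty[of t] by blast
  have SmC: "code_small ts = sym_clusters t" by (simp add: ts code_small_def)
  have LF: "?L \<in> sym_clusters t" "swap ` ?L \<in> sym_clusters t" by (auto simp: sym_clusters_iff)
  have max: "A = R" if R: "R \<in> set ?Rs" "A \<in> sym_clusters t" "R \<subseteq> A" for R A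
  proof -
    consider "R = ?L" | "R = swap ` ?L" using R(1) by auto
    then show ?thesis
    proof cases
      case 1
      then have "A \<subseteq> ?L" using sym_clusters_sub[OF that(2)] that(3) d leaf_set_nonempty[of t] by blast
      then show ?thesis using 1 that(3) by blast
    next
      case 2
      then have "A \<subseteq> swap ` ?L" using sym_clusters_sub[OF that(2)] that(3) d leaf_set_nonempty[of t] by blast
      then show ?thesis using 2 that(3) by blast
    qed
  qed
  interpret symmetric_forest n "sym_clusters t" ?Rs "{0..<card (sym_clusters t)}" S
  proof
    show "sym_clusters t \<subseteq> Pow (labels n)" using code_small_props(4) SmC by auto
    show "{} \<notin> sym_clusters t" using sym_clusters_nonempty by blast
    show "laminar (sym_clusters t)" using sym_clusters_laminar dist_indices_t ts by simp
    show "{l} \<in> sym_clusters t" if "l \<in> labels n" for l using code_small_props(5)[OF that] SmC by simp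
    show "\<exists>R\<in>set ?Rs. A \<subseteq> R" if "A \<in> sym_clusters t" for A using sym_clusters_sub[OF that] by auto
    show "A = R" if "R \<in> set ?Rs" "A \<in> sym_clusters t" "R \<subseteq> A" for R A using max that by blast
    show "{swap ` (?Rs ! i), swap ` (?Rs ! Suc i)} = {?Rs ! i, ?Rs ! Suc i}" if "Suc i < length ?Rs" for i
      using that by auto
  qed (use Lne LF S sym_clusters_swap in auto)
  have lab: "labels n = ?L \<union> swap ` ?L" using Un_base ts by (simp add: base_def)
  have cL: "labels n - ?L = swap ` ?L" "labels n - swap ` ?L = ?L" using d lab by auto
  have "sides n T = (\<Union>A\<in>sym_clusters t - set ?Rs. {A, labels n - A}) \<union> {swap ` ?L, ?L}"
  proof -
    have "{0<..<length ?Rs} = {1}" by auto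
    then show ?thesis unfolding sides_T using cL by simp
  qed
  also have "\<dots> = (\<Union>A\<in>(sym_clusters t - set ?Rs) \<union> {?L, swap ` ?L}. {A, labels n - A})"
    unfolding UN_Un UN_insert cL by auto
  also have "(sym_clusters t - set ?Rs) \<union> {?L, swap ` ?L} = sym_clusters t" using LF by auto
  also have "(\<Union>A\<in>sym_clusters t. {A, labels n - A}) = code_sides n ts"
  proof -
    have "code_trunk n ts = {}" by (simp add: code_trunk_def prefs_def ts)
    then show ?thesis unfolding code_sides_def SmC by auto
  qed
  finally have "sides n T = code_sides n ts" .
  moreover have "is_path (fixed_points T \<sigma>)"
    by (rule path_if_none_fixed) (use code_small_props(6) SmC in auto)
  ultimately show ?thesis using leaf_labelled_T graph_iso_\<sigma> leaf_\<sigma> by blast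
qed

lemma compl_take:
  "labels n - \<Union> (set (take i (map base ts))) = \<Union> (set (drop i (map base ts)))"
proof -
  have "set (map base ts) = set (take i (map base ts)) \<union> set (drop i (map base ts))"
    by (metis append_take_drop_id set_append)
  then have "labels n = \<Union> (set (take i (map base ts))) \<union> \<Union> (set (drop i (map base ts)))"
    using Un_base by (metis Union_Un_distrib set_map)
  moreover have "\<Union> (set (take i (map base ts))) \<inter> \<Union> (set (drop i (map base ts))) = {}"
  proof -
    have "base t \<inter> base u = {}" if tu: "t \<in> set (take i ts)" "u \<in> set (drop i ts)" for t u
    proof -
      have "set (take i ts) \<inter> set (drop i ts) = {}" using dist_ts by (simp add: set_take_disj_set_drop_if_distinct)
      then have "t \<noteq> u" using tu by blast
      then show ?thesis using base_disjoint tu in_set_takeD in_set_dropD by metis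
    qed
    then show ?thesis by (auto simp: take_map drop_map)
  qed
  ultimately show ?thesis by blast
qed

lemma base_notin_code_small: "base t \<notin> code_small ts"
  using code_small_props(6)[of "base t"] by auto

text \<open>The blocks \<open>base t\<close> are added as trunk vertices. Being invariant they are
  not small, so the members outside \<open>Rs\<close> are exactly \<open>code_small ts\<close>, and
  the path edges contribute the partial unions of blocks.\<close>

lemma tree_of_multi:
  assumes len: "2 \<le> length ts"
  shows "\<exists>T \<sigma>. leaf_labelled_tree n T \<and> sides n T = code_sides n ts \<and> graph_iso T T \<sigma> \<and>
    (\<forall>l\<in>labels n. \<sigma> (leaf T l) = leaf T (swap l)) \<and> is_path (fixed_points T \<sigma>)"
proof -
  let ?F = "code_small ts \<union> base ` set ts"
  let ?Rs = "map base ts"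
  have "finite ?F" by (simp add: code_small_def)
  then obtain S where S: "bij_betw S {0..<card ?F} ?F"
    using ex_bij_betw_nat_finite by blast
  have sub: "A \<subseteq> base t \<or> A \<inter> base t = {}" if "A \<in> ?F" "t \<in> set ts" for A t
    using that base_disjoint sym_clusters_sub_base unfolding code_small_iff Un_iff by blast
  interpret symmetric_forest n ?F ?Rs "{0..<card ?F}" S
  proof
    show "?F \<subseteq> Pow (labels n)" using code_small_props(4) Un_base by blast
    show "{} \<notin> ?F" using code_small_props(1) base_nonempty by (metis UnE imageE)
    show "laminar ?F"
      unfolding laminar_def
    proof (intro ballI)
      fix A B assume A: "A \<in> ?F" and B: "B \<in> ?F"
      show "A \<subseteq> B \<or> B \<subseteq> A \<or> A \<inter> B = {}"
      proof (cases "A \<in> base ` set ts \<or> B \<in> base ` set ts")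
        case True
        then show ?thesis using sub A B by blast
      next
        case False
        then obtain t u where tu: "t \<in> set ts" "A \<in> sym_clusters t" "u \<in> set ts" "B \<in> sym_clusters u"
          using A B by (auto simp: code_small_iff)
        show ?thesis
        proof (cases "t = u")
          case True
          then show ?thesis using laminarD[OF sym_clusters_laminar[OF dist_indices_t]] tu by blast
        next
          case False
          then show ?thesis using base_disjoint tu sym_clusters_sub_base by blast
        qed
      qed
    qed
    show "{l} \<in> ?F" if "l \<in> labels n" for l using code_small_props(5)[OF that] by simp
    show "2 \<le> length ?Rs" using len by simp
    show "distinct ?Rs"
      unfolding distinct_map
    proof (intro conjI dist_ts inj_onI)
      fix t u assume "t \<in> set ts" "u \<in> set ts" "base t = base u"
      then show "t = u" using base_disjoint[of t u] base_nonempty[of t] by auto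
    qed
    show "\<exists>R\<in>set ?Rs. A \<subseteq> R" if "A \<in> ?F" for A
      using that sym_clusters_sub_base by (auto simp: code_small_iff)
    show "A = R" if R: "R \<in> set ?Rs" "A \<in> ?F" "R \<subseteq> A" for A R
    proof -
      obtain t where t: "t \<in> set ts" "R = base t" using R(1) by auto
      have "A \<inter> base t \<noteq> {}" using R(3) t(2) base_nonempty[of t] by blast
      then show ?thesis using sub[OF R(2) t(1)] R(3) t(2) by blast
    qed
    \<comment> \<open>Vacuous: the blocks are invariant under \<open>swap\<close>, and a singleton
      is not.\<close>
    show "length ?Rs = 2" if l: "{l} \<in> set ?Rs" for l
    proof -
      obtain t where "base t = {l}" using l by (metis imageE set_map)
      then have "swap l = l" using swap_base[of t] by auto
      then show ?thesis by simp
    qed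
    show "swap ` A \<in> ?F" if "A \<in> ?F" for A using that code_small_props(3) by auto
  qed (use S in auto)
  have "?F - set ?Rs = code_small ts" using base_notin_code_small by auto
  then have "sides n T = (\<Union>A\<in>code_small ts. {A, labels n - A}) \<union>
      (\<Union>i\<in>{0<..<length ts}. {\<Union> (set (drop i ?Rs)), labels n - \<Union> (set (drop i ?Rs))})"
    unfolding sides_T by simp
  also have "(\<Union>i\<in>{0<..<length ts}. {\<Union> (set (drop i ?Rs)), labels n - \<Union> (set (drop i ?Rs))}) = code_trunk n ts"
  proof -
    have t: "\<Union> (set (take i ?Rs)) \<subseteq> labels n" for i
      using Un_base by (metis Union_mono set_map set_take_subset)
    have d: "labels n - \<Union> (set (drop i ?Rs)) = \<Union> (set (take i ?Rs))" for i
      unfolding compl_take[symmetric] using t by (rule double_diff) simp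
    have pr: "prefs ?Rs = (\<lambda>i. \<Union> (set (take i ?Rs))) ` {0<..<length ts}" unfolding prefs_def by auto
    have "(\<Union>i\<in>{0<..<length ts}. {\<Union> (set (drop i ?Rs)), labels n - \<Union> (set (drop i ?Rs))})
      = (\<Union>i\<in>{0<..<length ts}. {labels n - \<Union> (set (take i ?Rs)), \<Union> (set (take i ?Rs))})"
      by (simp only: d compl_take)
    also have "\<dots> = code_trunk n ts" unfolding code_trunk_def pr by blast
    finally show ?thesis .
  qed
  also have "(\<Union>A\<in>code_small ts. {A, labels n - A}) \<union> code_trunk n ts = code_sides n ts" by (auto simp: code_sides_def)
  finally have "sides n T = code_sides n ts" .
  moreover have "is_path (fixed_points T \<sigma>)"
  proof (rule path_if_roots_fixed)
    show "swap ` R = R" if R: "R \<in> set ?Rs" for R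
    proof -
      obtain t where "R = base t" using R by (metis imageE set_map)
      then show ?thesis by simp
    qed
    show "A \<in> set ?Rs" if "A \<in> ?F" "swap ` A = A" for A using that code_small_props(6) by auto
  qed
  ultimately show ?thesis using leaf_labelled_T graph_iso_\<sigma> leaf_\<sigma> by blast
qed

lemma tree_of_code:
  "\<exists>T \<sigma>. leaf_labelled_tree n T \<and> sides n T = code_sides n ts \<and> graph_iso T T \<sigma> \<and>
    (\<forall>l\<in>labels n. \<sigma> (leaf T l) = leaf T (swap l)) \<and> is_path (fixed_points T \<sigma>)"
proof (cases "2 \<le> length ts")
  case True
  then show ?thesis by (rule tree_of_multi)
next
  case False
  moreover have "length ts \<noteq> 0" using ts_ne by simp
  ultimately have "length ts = 1" by linarith
  then obtain t where "ts = [t]" by (auto simp: length_Suc_conv)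
  then show ?thesis by (rule tree_of_single)
qed

end

section \<open>Regular symbic trees and codes\<close>

lemma bichromatic_swap [simp]: "bichromatic (swap ` A) \<longleftrightarrow> bichromatic A"
proof -
  have "Unprimed i \<in> swap ` A \<longleftrightarrow> Primed i \<in> A" "Primed i \<in> swap ` A \<longleftrightarrow> Unprimed i \<in> A" for i
    by (simp_all add: swap_image_iff)
  then show ?thesis by (auto simp: bichromatic_def)
qed

text \<open>Binary trees attain the bound of \<open>laminar_binary\<close>, which makes the trees
  built from codes regular.\<close>

lemma card_clusters: "disjoint_leaves t \<Longrightarrow> card (clusters t) + 1 = 2 * card (leaf_set t)"
proof (induction t)
  case (Nd s t)
  have d: "leaf_set s \<inter> leaf_set t = {}" using Nd.prems by simp
  have "leaf_set s \<union> leaf_set t \<notin> clusters s" "leaf_set s \<union> leaf_set t \<notin> clusters t"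
    using clusters_sub[of "leaf_set s \<union> leaf_set t"] d leaf_set_nonempty[of s] leaf_set_nonempty[of t] by blast+
  moreover have "clusters s \<inter> clusters t = {}"
    using clusters_sub clusters_nonempty d by blast
  ultimately have "card (clusters (Nd s t)) = Suc (card (clusters s) + card (clusters t))"
    by (simp add: card_Un_disjoint)
  then show ?case using Nd d by (simp add: card_Un_disjoint)
qed simp

lemma card_sym_clusters:
  assumes "distinct (indices t)"
  shows "card (sym_clusters t) + 2 = 2 * card (base t)"
proof -
  have d: "disjoint_leaves t" "leaf_set t \<inter> swap ` leaf_set t = {}" using distinct_ixD[OF assms] by auto
  have "clusters t \<inter> (\<lambda>A. swap ` A) ` clusters t = {}"
  proof (rule equals0I)
    fix A assume A: "A \<in> clusters t \<inter> (\<lambda>A. swap ` A) ` clusters t"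
    then have "A \<subseteq> leaf_set t" "A \<subseteq> swap ` leaf_set t" "A \<noteq> {}" using clusters_sub clusters_nonempty by blast+
    then show False using d(2) by blast
  qed
  moreover have "card ((\<lambda>A. swap ` A) ` clusters t) = card (clusters t)"
    by (rule card_image) (simp add: inj_on_def)
  ultimately have "card (sym_clusters t) = 2 * card (clusters t)" by (simp add: sym_clusters_def card_Un_disjoint)
  moreover have "card (base t) = 2 * card (leaf_set t)" using d(2) by (simp add: base_def card_Un_disjoint)
  ultimately show ?thesis using card_clusters[OF d(1)] by simp
qed

context code
begin

lemma n_pos: "1 \<le> n"
proof -
  obtain t where "t \<in> set ts" using ts_ne by (cases ts) auto
  moreover obtain i where "i \<in> set (indices t)" using indices_nonempty[of t] by (cases "indices t") auto
  ultimately have "i \<in> set (concat (map indices ts))" by auto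
  then show ?thesis unfolding set_indices_ts by simp
qed

lemma prefs_image: "prefs (map base ts) = (\<lambda>i. \<Union> (set (take i (map base ts)))) ` {0<..<length ts}"
  by (auto simp: prefs_def)

lemma prefs_props:
  assumes "A \<in> prefs (map base ts)"
  shows "swap ` A = A" "A \<subseteq> labels n" "base (hd ts) \<subseteq> A" "A \<noteq> labels n"
proof -
  obtain i where i: "0 < i" "i < length ts" "A = \<Union> (set (take i (map base ts)))"
    using assms by (auto simp: prefs_def)
  have "swap ` \<Union> (base ` X) = \<Union> (base ` X)" for X
    by (simp add: image_UN)
  then show "swap ` A = A" unfolding i(3) take_map set_map by blast
  show "A \<subseteq> labels n" unfolding i(3) using Un_base by (metis Union_mono set_map set_take_subset)
  have "hd ts \<in> set (take i ts)" using i(1) ts_ne by (cases ts; cases i) auto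
  then show "base (hd ts) \<subseteq> A" unfolding i(3) take_map set_map by blast
  show "A \<noteq> labels n"
  proof
    assume "A = labels n"
    then have "\<Union> (set (drop i (map base ts))) = {}" using compl_take[of i] i(3) by simp
    moreover have "ts ! i \<in> set (drop i ts)" using i(2) by (metis Cons_nth_drop_Suc list.set_intros(1))
    then have "base (ts ! i) \<subseteq> \<Union> (set (drop i (map base ts)))" by (auto simp: drop_map)
    ultimately show False using base_nonempty[of "ts ! i"] by blast
  qed
qed

lemma code_trunk_props:
  assumes "A \<in> code_trunk n ts"
  shows "swap ` A = A" "A \<noteq> {}" "A \<subseteq> labels n"
proof -
  have "swap ` A = A \<and> A \<noteq> {} \<and> A \<subseteq> labels n"
  proof (cases "A \<in> prefs (map base ts)")
    case True
    then show ?thesis using prefs_props[OF True] base_nonempty[of "hd ts"] by auto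
  next
    case False
    then obtain B where B: "B \<in> prefs (map base ts)" "A = labels n - B" using assms by (auto simp: code_trunk_def)
    then show ?thesis using prefs_props[OF B(1)] by (auto simp: swap_compl)
  qed
  then show "swap ` A = A" "A \<noteq> {}" "A \<subseteq> labels n" by auto
qed

text \<open>The complement of a small side is small only if it is the mirror image, and mirror
  images already belong to \<open>code_small\<close>. So the two kinds of sides can be recovered
  from \<open>code_sides\<close>.\<close>

lemma small_sides_code_sides: "small_sides (code_sides n ts) = code_small ts"
proof (intro equalityI subsetI)
  fix A assume "A \<in> small_sides (code_sides n ts)"
  then have A: "A \<in> code_sides n ts" "A \<inter> swap ` A = {}" by (auto simp: small_sides_def)
  from A(1) consider "A \<in> code_small ts" | B where "B \<in> code_small ts" "A = labels n - B" | "A \<in> code_trunk n ts"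
    by (auto simp: code_sides_def)
  then show "A \<in> code_small ts"
  proof cases
    case 2
    have "A = swap ` B"
      using A(2) code_small_props(2,4)[OF 2(1)] code_small_props(4)[OF code_small_props(3)[OF 2(1)]]
      unfolding 2(2) swap_compl by blast
    then show ?thesis using code_small_props(3)[OF 2(1)] by simp
  next
    case 3
    then show ?thesis using code_trunk_props[OF 3] A(2) by auto
  qed simp
next
  fix A assume "A \<in> code_small ts"
  then show "A \<in> small_sides (code_sides n ts)" using code_small_props(2) by (auto simp: small_sides_def code_sides_def)
qed

lemma trunk_sides_code_sides: "trunk_sides (code_sides n ts) = code_trunk n ts"
proof (intro equalityI subsetI)
  fix A assume "A \<in> trunk_sides (code_sides n ts)"
  then have A: "A \<in> code_sides n ts" "swap ` A = A" by (auto simp: trunk_sides_def)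
  from A(1) consider "A \<in> code_small ts" | B where "B \<in> code_small ts" "A = labels n - B" | "A \<in> code_trunk n ts"
    by (auto simp: code_sides_def)
  then show "A \<in> code_trunk n ts"
  proof cases
    case 1
    then show ?thesis using code_small_props(6) A(2) by blast
  next
    case 2
    have "labels n - swap ` B = labels n - B" using A(2) 2(2) by (simp add: swap_compl)
    then have "swap ` B = B"
      using code_small_props(4)[OF 2(1)] code_small_props(4)[OF code_small_props(3)[OF 2(1)]] by (metis double_diff subset_refl)
    then show ?thesis using code_small_props(6)[OF 2(1)] by blast
  qed simp
next
  fix A assume A: "A \<in> code_trunk n ts"
  then show "A \<in> trunk_sides (code_sides n ts)" using code_trunk_props[OF A] by (simp add: trunk_sides_def code_sides_def)
qed

text \<open>A block of size b has 2b - 2 small sides, so k blocks give \<open>4 * n\<close> minus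
  2k. Together with the 2k - 2 trunk sides this is \<open>4 * n - 2\<close> for every k, which is
  the number required by regularity.\<close>

lemma card_code_small: "card (code_small ts) + 2 * length ts = 4 * n"
proof -
  have disj: "\<forall>t\<in>set ts. \<forall>u\<in>set ts. t \<noteq> u \<longrightarrow> sym_clusters t \<inter> sym_clusters u = {}"
  proof (intro ballI impI equals0I)
    fix t u A assume tu: "t \<in> set ts" "u \<in> set ts" "t \<noteq> u" "A \<in> sym_clusters t \<inter> sym_clusters u"
    then have "A \<subseteq> base t" "A \<subseteq> base u" "A \<noteq> {}"
      using sym_clusters_sub_base[of A] sym_clusters_nonempty[of A t] by blast+
    then show False using base_disjoint[OF tu(1-3)] by blast
  qed
  have "card (code_small ts) = (\<Sum>t\<in>set ts. card (sym_clusters t))"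
    unfolding code_small_def by (rule card_UN_disjoint) (use disj in auto)
  moreover have "length ts = card (set ts)" using dist_ts by (simp add: distinct_card)
  ultimately have "card (code_small ts) + 2 * length ts = (\<Sum>t\<in>set ts. card (sym_clusters t) + 2)"
    by (simp only: sum.distrib) simp
  also have "\<dots> = (\<Sum>t\<in>set ts. 2 * card (base t))"
    by (rule sum.cong[OF refl]) (rule card_sym_clusters[OF dist_indices_t])
  also have "\<dots> = 2 * card (\<Union> (base ` set ts))"
    unfolding sum_distrib_left[symmetric]
    by (subst card_UN_disjoint) (use base_disjoint in \<open>auto simp: base_def\<close>)
  finally show ?thesis using Un_base by simp
qed

text \<open>The proper prefixes are pairwise different, and the first block separates them from
  their complements: it lies in every prefix.\<close>

lemma card_code_trunk: "card (code_trunk n ts) + 2 = 2 * length ts"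
proof -
  let ?P = "\<lambda>i. \<Union> (set (take i (map base ts)))"
  have lt: "?P i \<noteq> ?P j" if "i < j" "j < length ts" for i j
  proof -
    have "ts ! i \<in> set (take j ts)" using that by (metis in_set_conv_nth length_take min_less_iff_conj nth_take order_less_trans)
    then have "base (ts ! i) \<subseteq> ?P j" by (auto simp: take_map)
    moreover have "base (ts ! i) \<subseteq> labels n - ?P i"
    proof -
      have "ts ! i \<in> set (drop i ts)" using that by (metis Cons_nth_drop_Suc list.set_intros(1) order_less_trans)
      then show ?thesis unfolding compl_take by (auto simp: drop_map)
    qed
    ultimately show ?thesis using base_nonempty[of "ts ! i"] by blast
  qed
  have inj: "inj_on ?P {0<..<length ts}"
    by (rule linorder_inj_onI) (use lt in auto)
  then have cp: "card (prefs (map base ts)) = length ts - 1" unfolding prefs_image by (simp add: card_image)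
  have fin: "finite (prefs (map base ts))" unfolding prefs_image by simp
  have "inj_on (\<lambda>A. labels n - A) (prefs (map base ts))"
  proof (rule inj_onI)
    fix A B assume "A \<in> prefs (map base ts)" "B \<in> prefs (map base ts)" "labels n - A = labels n - B"
    then show "A = B" using prefs_props(2)[of A] prefs_props(2)[of B] by blast
  qed
  moreover have "prefs (map base ts) \<inter> (\<lambda>A. labels n - A) ` prefs (map base ts) = {}"
    using prefs_props(3) base_nonempty[of "hd ts"] by blast
  ultimately have "card (code_trunk n ts) = 2 * card (prefs (map base ts))"
    unfolding code_trunk_def using fin by (simp add: card_Un_disjoint card_image)
  moreover have "0 < length ts" using ts_ne by simp
  ultimately show ?thesis using cp by linarith
qed

lemma code_small_bichromatic:
  assumes "A \<in> code_small ts" "2 \<le> card A"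
  shows "bichromatic A"
proof -
  obtain t where t: "t \<in> set ts" "A \<in> sym_clusters t" using assms(1) code_small_iff by blast
  then have "\<forall>A\<in>clusters t. 2 \<le> card A \<longrightarrow> bichromatic A" using no_mono_cherry_iff_bichromatic[OF dist_indices_t] no_mono_cherry_ts by blast
  then show ?thesis using t(2) assms(2) by (fastforce simp: sym_clusters_def)
qed

lemma code_sides_bichromatic:
  assumes "A \<in> code_sides n ts" "2 \<le> card A" "2 \<le> card (labels n - A)"
  shows "bichromatic A"
proof -
  from assms(1) consider "A \<in> code_small ts" | B where "B \<in> code_small ts" "A = labels n - B" | "A \<in> code_trunk n ts"
    by (auto simp: code_sides_def)
  then show ?thesis
  proof cases
    case 1
    then show ?thesis using code_small_bichromatic assms(2) by blast
  next
    case 2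
    have "labels n - A = B" using code_small_props(4)[OF 2(1)] 2(2) by (simp add: double_diff)
    then have "bichromatic (swap ` B)" using code_small_bichromatic[OF 2(1)] assms(3) by simp
    moreover have "swap ` B \<subseteq> A"
      using code_small_props(2)[OF 2(1)] code_small_props(4)[OF code_small_props(3)[OF 2(1)]] 2(2) by blast
    ultimately show ?thesis by (rule bichromatic_mono)
  next
    case 3
    show ?thesis using code_trunk_props[OF 3] by (intro bichromatic_if_swap[of A A]) auto
  qed
qed

end

lemma sides_swap:
  assumes "graph_iso T T \<sigma>" "leaf_labelled_tree n T" "\<forall>l\<in>labels n. \<sigma> (leaf T l) = leaf T (swap l)" "A \<in> sides n T"
  shows "swap ` A \<in> sides n T"
proof -
  have "bij_betw swap (labels n) (labels n)" by (simp add: bij_betw_def inj_swap)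
  then have "sides n T = (\<lambda>A. swap ` A) ` sides n T" using sides_graph_iso[OF assms(1,2)] assms(3) by blast
  then show ?thesis using assms(4) by blast
qed

text \<open>By \<open>card_split_orbits\<close>, n - 1 orbits mean
  \<open>2 * (n - 1) + 2 * n\<close> sides of the two kinds; as n is positive, this is
  \<open>4 * n - 2\<close>.\<close>

lemma regular_card:
  assumes T: "leaf_labelled_tree n T" and n: "1 \<le> n" and swap_closed: "\<And>A. A \<in> sides n T \<Longrightarrow> swap ` A \<in> sides n T"
  shows "card (split_orbits n T) = n - 1 \<longleftrightarrow> card (trunk_sides (sides n T)) + card (small_sides (sides n T)) + 2 = 4 * n"
proof -
  have "Unprimed 1 \<in> labels n" using n by (simp add: labels_def)
  then obtain par d where "leaf_rooted T (leaf T (Unprimed 1)) par d n (Unprimed 1)"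
    using leaf_rooted_exists[OF T] by blast
  then interpret leaf_rooted T "leaf T (Unprimed 1)" par d n "Unprimed 1" .
  have "2 * card (split_orbits n T) + 2 * n = card (trunk_sides (sides n T)) + card (small_sides (sides n T))"
    unfolding split_orbits_def splits_eq using card_split_orbits[OF split_system_sides swap_closed] .
  then show ?thesis using n by linarith
qed

lemma splits_bichromatic_iff:
  assumes T: "leaf_labelled_tree n T" and n: "1 \<le> n"
  shows "(\<forall>s\<in>splits n T. \<forall>A\<in>s. (\<exists>i. Unprimed i \<in> A) \<and> (\<exists>i. Primed i \<in> A)) \<longleftrightarrow>
    (\<forall>A\<in>sides n T. 2 \<le> card A \<longrightarrow> 2 \<le> card (labels n - A) \<longrightarrow> bichromatic A)"
proof -
  have "Unprimed 1 \<in> labels n" using n by (simp add: labels_def)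
  then obtain par d where "leaf_rooted T (leaf T (Unprimed 1)) par d n (Unprimed 1)"
    using leaf_rooted_exists[OF T] by blast
  then interpret leaf_rooted T "leaf T (Unprimed 1)" par d n "Unprimed 1" .
  show ?thesis
    unfolding bichromatic_def[symmetric] splits_eq
  proof (intro iffI ballI impI)
    fix s A assume h: "\<forall>A\<in>sides n T. 2 \<le> card A \<longrightarrow> 2 \<le> card (labels n - A) \<longrightarrow> bichromatic A"
      "s \<in> {{A, labels n - A} | A. A \<in> sides n T \<and> 2 \<le> card A \<and> 2 \<le> card (labels n - A)}" "A \<in> s"
    then obtain B where B: "B \<in> sides n T" "2 \<le> card B" "2 \<le> card (labels n - B)" "A = B \<or> A = labels n - B"
      by blast
    then show "bichromatic A" using h(1) split_systemD(3,4)[OF split_system_sides B(1)] by auto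
  next
    fix A
    assume h: "\<forall>s\<in>{{A, labels n - A} | A. A \<in> sides n T \<and> 2 \<le> card A \<and> 2 \<le> card (labels n - A)}. \<forall>A\<in>s. bichromatic A"
      and A: "A \<in> sides n T" "2 \<le> card A" "2 \<le> card (labels n - A)"
    have "{A, labels n - A} \<in> {{A, labels n - A} | A. A \<in> sides n T \<and> 2 \<le> card A \<and> 2 \<le> card (labels n - A)}"
      using A by blast
    from bspec[OF h this] show "bichromatic A" by simp
  qed
qed

lemma code_of_regular:
  assumes n: "1 \<le> n" and T: "T \<in> regular_symbic_trees n"
  shows "\<exists>ts\<in>Codes n. sides n T = code_sides n ts"
proof -
  have lt: "leaf_labelled_tree n T"
    and bi: "\<forall>s\<in>splits n T. \<forall>A\<in>s. (\<exists>i. Unprimed i \<in> A) \<and> (\<exists>i. Primed i \<in> A)"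
    and card: "card (split_orbits n T) = n - 1"
    using T by (simp_all add: regular_symbic_trees_def symbic_tree_def)
  obtain \<sigma> where \<sigma>: "graph_iso T T \<sigma>" "\<forall>l\<in>labels n. \<sigma> (leaf T l) = leaf T (swap l)" "is_path (fixed_points T \<sigma>)"
    using T by (auto simp: regular_symbic_trees_def symbic_tree_def)
  have "Unprimed 1 \<in> labels n" using n by (simp add: labels_def)
  then obtain par d where "leaf_rooted T (leaf T (Unprimed 1)) par d n (Unprimed 1)"
    using leaf_rooted_exists[OF lt] by blast
  then interpret leaf_rooted T "leaf T (Unprimed 1)" par d n "Unprimed 1" .
  have swap_closed: "swap ` A \<in> sides n T" if "A \<in> sides n T" for A using sides_swap[OF \<sigma>(1) lt \<sigma>(2) that] .
  show ?thesis
  proof (rule code_exists[OF split_system_sides swap_closed n])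
    show "\<forall>A\<in>trunk_sides (sides n T). \<forall>B\<in>trunk_sides (sides n T). \<forall>C\<in>trunk_sides (sides n T). A \<inter> B = {} \<longrightarrow> A \<inter> C = {} \<longrightarrow> B \<inter> C \<noteq> {}"
      using trunk_no_three_disjoint[OF \<sigma>] by blast
    show "card (trunk_sides (sides n T)) + card (small_sides (sides n T)) + 2 = 4 * n"
      using regular_card[OF lt n swap_closed] card by simp
    show "bichromatic A" if "A \<in> sides n T" "2 \<le> card A" "2 \<le> card (labels n - A)" for A
      using splits_bichromatic_iff[OF lt n] bi that by blast
  qed
qed

lemma regular_of_code:
  assumes "ts \<in> Codes n"
  shows "\<exists>T\<in>regular_symbic_trees n. sides n T = code_sides n ts"
proof -
  interpret code n ts using assms by unfold_locales
  obtain T \<sigma> where T: "leaf_labelled_tree n T" "sides n T = code_sides n ts" and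
    \<sigma>: "graph_iso T T \<sigma>" "\<forall>l\<in>labels n. \<sigma> (leaf T l) = leaf T (swap l)" "is_path (fixed_points T \<sigma>)"
    using tree_of_code by blast
  have swap_closed: "swap ` A \<in> sides n T" if "A \<in> sides n T" for A using sides_swap[OF \<sigma>(1) T(1) \<sigma>(2) that] .
  have "card (split_orbits n T) = n - 1"
    using regular_card[OF T(1) n_pos swap_closed] card_code_trunk card_code_small unfolding T(2) trunk_sides_code_sides small_sides_code_sides by simp
  moreover have "\<forall>s\<in>splits n T. \<forall>A\<in>s. (\<exists>i. Unprimed i \<in> A) \<and> (\<exists>i. Primed i \<in> A)"
    unfolding splits_bichromatic_iff[OF T(1) n_pos] T(2) using code_sides_bichromatic by blast
  ultimately have "T \<in> regular_symbic_trees n"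
    using T(1) \<sigma> by (auto simp: regular_symbic_trees_def symbic_tree_def)
  then show ?thesis using T(2) by blast
qed

lemma card_quotient_kernel: "card (A // {(x, y). x \<in> A \<and> y \<in> A \<and> f x = f y}) = card (f ` A)"
proof -
  let ?R = "{(x, y). x \<in> A \<and> y \<in> A \<and> f x = f y}"
  have cls: "?R `` {x} = {y \<in> A. f y = f x}" if "x \<in> A" for x using that by auto
  have "A // ?R = (\<lambda>v. {y \<in> A. f y = v}) ` f ` A"
    unfolding quotient_def using cls by auto
  moreover have "inj_on (\<lambda>v. {y \<in> A. f y = v}) (f ` A)"
    by (rule inj_onI) blast
  ultimately show ?thesis by (simp add: card_image)
qed

text \<open>There are infinitely many trees on natural numbers, but isomorphism is equality of
  \<open>sides\<close>. The classes are therefore counted by the families of sides that occur, and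
  these are the families of codes.\<close>

lemma num_eq_card_code_sides:
  assumes "1 \<le> n"
  shows "num_regular_symbic_trees n = card (code_sides n ` Codes n)"
proof -
  let ?R = "regular_symbic_trees n"
  have lt: "leaf_labelled_tree n T" if "T \<in> ?R" for T
    using that by (simp add: regular_symbic_trees_def symbic_tree_def)
  have "{(T, T'). T \<in> ?R \<and> T' \<in> ?R \<and> labelled_iso n T T'} = {(T, T'). T \<in> ?R \<and> T' \<in> ?R \<and> sides n T = sides n T'}"
    using labelled_iso_iff_sides[OF lt lt assms] by blast
  then have "num_regular_symbic_trees n = card (sides n ` ?R)"
    using assms card_quotient_kernel[of ?R "sides n"] by (simp add: num_regular_symbic_trees_def)
  moreover have "sides n ` ?R = code_sides n ` Codes n"
  proof (intro equalityI image_subsetI)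
    show "sides n T \<in> code_sides n ` Codes n" if "T \<in> ?R" for T using code_of_regular[OF assms that] by blast
    show "code_sides n ts \<in> sides n ` ?R" if "ts \<in> Codes n" for ts using regular_of_code[OF that] by (metis imageI)
  qed
  ultimately show ?thesis by simp
qed

section \<open>Codes of the same tree\<close>

lemma Un_clusters: "\<Union> (clusters t) = leaf_set t"
  using clusters_sub leaf_set_in_clusters by blast

lemma Un_sym_clusters: "\<Union> (sym_clusters t) = base t"
  unfolding sym_clusters_def base_def using Un_clusters[of t] by blast

lemma length_indices_pos: "0 < length (indices t)"
  by (induction t) auto

text \<open>All plane drawings of the rooted tree underlying \<open>t\<close>, as clusters forget
  the order of children. The distinctness condition excludes degenerate terms such as
  \<open>Nd (Lf a) (Lf a)\<close>, whose clusters are those of \<open>Lf a\<close>.\<close>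

definition reorderings :: "bt \<Rightarrow> bt set" where
  "reorderings t = {u. distinct (indices u) \<and> clusters u = clusters t}"

lemma clusters_left:
  assumes "leaf_set s \<inter> leaf_set t = {}"
  shows "clusters s = {A \<in> clusters (Nd s t). A \<subseteq> leaf_set s}"
proof -
  have "\<not> leaf_set s \<union> leaf_set t \<subseteq> leaf_set s" using assms leaf_set_nonempty[of t] by blast
  moreover have "\<not> A \<subseteq> leaf_set s" if "A \<in> clusters t" for A
    using clusters_sub[OF that] clusters_nonempty[OF that] assms by blast
  ultimately show ?thesis using clusters_sub by auto
qed

lemma clusters_Nd_commute: "clusters (Nd s t) = clusters (Nd t s)"
  by (simp add: Un_commute)

text \<open>The two maximal proper clusters determine the unordered pair of children.\<close>

lemma clusters_Nd_eq:
  assumes d: "leaf_set a \<inter> leaf_set b = {}" "leaf_set s \<inter> leaf_set t = {}" and eq: "clusters (Nd a b) = clusters (Nd s t)"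
  shows "clusters a = clusters s \<and> clusters b = clusters t \<or> clusters a = clusters t \<and> clusters b = clusters s"
proof -
  have U: "leaf_set a \<union> leaf_set b = leaf_set s \<union> leaf_set t" using eq Un_clusters[of "Nd a b"] Un_clusters[of "Nd s t"] by simp
  have sub: "leaf_set x \<subseteq> leaf_set p \<or> leaf_set x \<subseteq> leaf_set q"
    if "leaf_set x \<inter> leaf_set y = {}" "clusters (Nd x y) = clusters (Nd p q)" "leaf_set x \<union> leaf_set y = leaf_set p \<union> leaf_set q" for x y p q
  proof -
    have "leaf_set x \<in> clusters (Nd x y)" by simp
    then have "leaf_set x \<in> clusters (Nd p q)" unfolding that(2) .
    moreover have "leaf_set x \<noteq> leaf_set p \<union> leaf_set q" using that(1,3) leaf_set_nonempty[of y] by blast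
    ultimately show ?thesis using clusters_sub by auto
  qed
  have 1: "leaf_set a \<subseteq> leaf_set s \<or> leaf_set a \<subseteq> leaf_set t" using sub[OF d(1) eq U] .
  have 2: "leaf_set b \<subseteq> leaf_set s \<or> leaf_set b \<subseteq> leaf_set t"
    using sub[of b a s t] d(1) eq U clusters_Nd_commute[of a b] by (simp add: Int_commute Un_commute)
  have 3: "leaf_set s \<subseteq> leaf_set a \<or> leaf_set s \<subseteq> leaf_set b" using sub[OF d(2) eq[symmetric] U[symmetric]] .
  have ne: "leaf_set a \<noteq> {}" "leaf_set b \<noteq> {}" "leaf_set s \<noteq> {}" "leaf_set t \<noteq> {}" by simp_all
  have same: "clusters a = clusters s \<and> clusters b = clusters t"
    if "leaf_set a = leaf_set s" "leaf_set b = leaf_set t" "clusters (Nd a b) = clusters (Nd s t)" "leaf_set s \<inter> leaf_set t = {}" for a b s t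
    using clusters_left[of a b] clusters_left[of s t] clusters_left[of b a] clusters_left[of t s] that clusters_Nd_commute
    by (metis Int_commute)
  have "(leaf_set a = leaf_set s \<and> leaf_set b = leaf_set t) \<or> (leaf_set a = leaf_set t \<and> leaf_set b = leaf_set s)"
  proof (cases "leaf_set a \<subseteq> leaf_set s")
    case True
    have "\<not> leaf_set b \<subseteq> leaf_set s"
    proof
      assume "leaf_set b \<subseteq> leaf_set s"
      then have "leaf_set t \<subseteq> leaf_set s" using True U by blast
      then show False using d(2) ne(4) by blast
    qed
    then have "leaf_set b \<subseteq> leaf_set t" using 2 by blast
    then show ?thesis using True U d by blast
  next
    case False
    then have "leaf_set a \<subseteq> leaf_set t" using 1 by blast
    have "\<not> leaf_set b \<subseteq> leaf_set t"
    proof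
      assume "leaf_set b \<subseteq> leaf_set t"
      then have "leaf_set s \<subseteq> leaf_set t" using \<open>leaf_set a \<subseteq> leaf_set t\<close> U by blast
      then show False using d(2) ne(3) by blast
    qed
    then have "leaf_set b \<subseteq> leaf_set s" using 2 by blast
    then show ?thesis using \<open>leaf_set a \<subseteq> leaf_set t\<close> U d by blast
  qed
  then show ?thesis
    using same[of a s b t] same[of a t b s] eq d clusters_Nd_commute[of s t] by (metis Int_commute)
qed

text \<open>A binary tree with m leaves has m - 1 inner nodes, and exchanging the children at any of
  them gives a new drawing because their leaf sets are disjoint.\<close>

lemma card_reorderings:
  assumes "distinct (indices t)"
  shows "finite (reorderings t) \<and> card (reorderings t) = 2 ^ (length (indices t) - 1)"
  using assms
proof (induction t)
  case (Lf a)
  have "u = Lf a" if "clusters u = {{a}}" "distinct (indices u)" for u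
  proof (cases u)
    case (Lf b)
    then show ?thesis using that by simp
  next
    case (Nd s t)
    have "leaf_set s \<in> clusters u" "leaf_set t \<in> clusters u" using Nd by auto
    then have "leaf_set s = {a}" "leaf_set t = {a}" using that(1) by auto
    then show ?thesis using distinct_ixD[OF that(2)] Nd by auto
  qed
  then have "reorderings (Lf a) = {Lf a}" by (auto simp: reorderings_def)
  then show ?case by simp
next
  case (Nd s t)
  have ds: "distinct (indices s)" "distinct (indices t)" "set (indices s) \<inter> set (indices t) = {}" using Nd.prems by auto
  have d: "leaf_set s \<inter> leaf_set t = {}" using distinct_ixD[OF Nd.prems] by simp
  let ?K = "reorderings s \<times> reorderings t"
  let ?f = "\<lambda>(a, b). Nd a b" and ?g = "\<lambda>(a, b). Nd b a"
  have indices_eq: "set (indices u) = set (indices v)" if "clusters u = clusters v" for u v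
    using that Un_clusters set_indices by metis
  have eq: "reorderings (Nd s t) = ?f ` ?K \<union> ?g ` ?K"
  proof (intro equalityI subsetI)
    fix u assume "u \<in> reorderings (Nd s t)"
    then have u: "distinct (indices u)" "clusters u = clusters (Nd s t)" by (auto simp: reorderings_def)
    show "u \<in> ?f ` ?K \<union> ?g ` ?K"
    proof (cases u)
      case (Lf a)
      have "leaf_set s \<in> clusters u" "leaf_set t \<in> clusters u" using u(2) by auto
      then have "leaf_set s = {a}" "leaf_set t = {a}" using Lf by auto
      then show ?thesis using d by simp
    next
      case (Nd a b)
      have "leaf_set a \<inter> leaf_set b = {}" "distinct (indices a)" "distinct (indices b)" using distinct_ixD[OF u(1)] u(1) Nd by auto
      then show ?thesis
        using clusters_Nd_eq[of a b s t] d u(2) Nd by (force simp: reorderings_def)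
    qed
  next
    fix u assume "u \<in> ?f ` ?K \<union> ?g ` ?K"
    then obtain a b where ab: "a \<in> reorderings s" "b \<in> reorderings t" "u = Nd a b \<or> u = Nd b a" by auto
    then have c: "clusters a = clusters s" "clusters b = clusters t" "distinct (indices a)" "distinct (indices b)"
      by (auto simp: reorderings_def)
    have l: "leaf_set a = leaf_set s" "leaf_set b = leaf_set t" using c Un_clusters by metis+
    have "set (indices a) \<inter> set (indices b) = {}" using indices_eq[OF c(1)] indices_eq[OF c(2)] ds(3) by simp
    then show "u \<in> reorderings (Nd s t)" using ab(3) c l by (auto simp: reorderings_def)
  qed
  have "?f ` ?K \<inter> ?g ` ?K = {}"
  proof (rule equals0I)
    fix u assume "u \<in> ?f ` ?K \<inter> ?g ` ?K"
    then obtain a b where "a \<in> reorderings s" "a \<in> reorderings t" by auto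
    then have "clusters s = clusters t" by (auto simp: reorderings_def)
    then have "leaf_set s = leaf_set t" using Un_clusters by metis
    then show False using d by simp
  qed
  moreover have IH: "finite (reorderings s)" "card (reorderings s) = 2 ^ (length (indices s) - 1)"
    "finite (reorderings t)" "card (reorderings t) = 2 ^ (length (indices t) - 1)"
    using Nd.IH ds by auto
  moreover have "card (?f ` ?K) = card ?K" "card (?g ` ?K) = card ?K"
    by (auto intro!: card_image simp: inj_on_def)
  ultimately have "card (reorderings (Nd s t)) = 2 * (card (reorderings s) * card (reorderings t))"
    unfolding eq by (subst card_Un_disjoint) (auto simp: card_cartesian_product)
  also have "\<dots> = 2 ^ (1 + (length (indices s) - 1) + (length (indices t) - 1))"
    by (simp add: IH power_add)
  also have "1 + (length (indices s) - 1) + (length (indices t) - 1) = length (indices (Nd s t)) - 1"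
    unfolding indices.simps length_append using length_indices_pos[of s] length_indices_pos[of t] by linarith
  finally show ?case unfolding eq using IH by simp
qed

fun swap_tree :: "bt \<Rightarrow> bt" where
  "swap_tree (Lf a) = Lf (swap a)"
| "swap_tree (Nd s t) = Nd (swap_tree s) (swap_tree t)"

lemma indices_swap_tree [simp]: "indices (swap_tree t) = indices t"
  by (induction t) auto

lemma leaf_set_swap_tree: "leaf_set (swap_tree t) = swap ` leaf_set t"
  by (induction t) (auto simp: image_Un)

lemma clusters_swap_tree: "clusters (swap_tree t) = (\<lambda>A. swap ` A) ` clusters t"
  by (induction t) (auto simp: image_Un leaf_set_swap_tree)

lemma sym_clusters_swap_tree: "sym_clusters (swap_tree t) = sym_clusters t"
  unfolding sym_clusters_def clusters_swap_tree by (auto simp: image_image)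

text \<open>The drawings of the same mirror pair of trees: either member of the pair may serve as
  its representative in a code.\<close>

definition twins :: "bt \<Rightarrow> bt set" where
  "twins t = {u. distinct (indices u) \<and> sym_clusters u = sym_clusters t}"

lemma clusters_from_sym_clusters:
  assumes "distinct (indices t)"
  shows "clusters t = {A \<in> sym_clusters t. A \<subseteq> leaf_set t}"
proof -
  have "leaf_set t \<inter> swap ` leaf_set t = {}" using distinct_ixD[OF assms] by blast
  moreover have "A \<in> clusters t" if A: "A \<in> sym_clusters t" "A \<subseteq> leaf_set t" "leaf_set t \<inter> swap ` leaf_set t = {}" for A
  proof (rule ccontr)
    assume "A \<notin> clusters t"
    then have "swap ` A \<in> clusters t" using A(1) by (simp add: sym_clusters_iff)
    then have "swap ` swap ` A \<subseteq> swap ` leaf_set t" by (intro image_mono clusters_sub)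
    then show False using A sym_clusters_nonempty[OF A(1)] by auto
  qed
  moreover have "A \<in> sym_clusters t" "A \<subseteq> leaf_set t" if "A \<in> clusters t" for A
    using that clusters_sub[OF that] by (simp_all add: sym_clusters_def)
  ultimately show ?thesis by blast
qed

text \<open>The symmetrised family determines the leaf set up to mirror image, and the leaf set
  selects the half of the family that belongs to the tree.\<close>

lemma leaf_set_twin:
  assumes t: "distinct (indices t)" and u: "distinct (indices u)" and eq: "sym_clusters u = sym_clusters t" and sub: "leaf_set u \<subseteq> leaf_set t"
  shows "clusters u = clusters t"
proof -
  have d: "leaf_set t \<inter> swap ` leaf_set t = {}" using distinct_ixD[OF t] by blast
  have "leaf_set t \<in> sym_clusters u" unfolding eq by (simp add: sym_clusters_def)
  then have "leaf_set t \<subseteq> leaf_set u \<or> leaf_set t \<subseteq> swap ` leaf_set u" by (rule sym_clusters_sub)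
  moreover have "\<not> leaf_set t \<subseteq> swap ` leaf_set u"
    using image_mono[OF sub, of swap] d leaf_set_nonempty[of t] by blast
  ultimately have "leaf_set u = leaf_set t" using sub by blast
  then show ?thesis using clusters_from_sym_clusters[OF t] clusters_from_sym_clusters[OF u] eq by simp
qed

text \<open>A twin is a drawing of \<open>t\<close> or of its mirror image. These two kinds differ,
  since their leaf sets are disjoint, and each contributes half of the power of 2.\<close>

lemma card_twins:
  assumes t: "distinct (indices t)"
  shows "finite (twins t) \<and> card (twins t) = 2 ^ length (indices t)"
proof -
  have d: "leaf_set t \<inter> swap ` leaf_set t = {}" using distinct_ixD[OF t] by blast
  have "twins t = reorderings t \<union> reorderings (swap_tree t)"
  proof (intro equalityI subsetI)
    fix u assume "u \<in> twins t"
    then have u: "distinct (indices u)" "sym_clusters u = sym_clusters t" by (auto simp: twins_def)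
    have "leaf_set u \<in> sym_clusters t" unfolding u(2)[symmetric] by (simp add: sym_clusters_def)
    then consider "leaf_set u \<subseteq> leaf_set t" | "leaf_set u \<subseteq> leaf_set (swap_tree t)" using sym_clusters_sub leaf_set_swap_tree by metis
    then show "u \<in> reorderings t \<union> reorderings (swap_tree t)"
      using leaf_set_twin[OF t u] leaf_set_twin[of "swap_tree t" u] t u sym_clusters_swap_tree by cases (auto simp: reorderings_def)
  next
    fix u assume "u \<in> reorderings t \<union> reorderings (swap_tree t)"
    then consider "distinct (indices u)" "clusters u = clusters t" | "distinct (indices u)" "clusters u = clusters (swap_tree t)"
      by (auto simp: reorderings_def)
    then show "u \<in> twins t"
    proof cases
      case 1
      then show ?thesis by (simp add: twins_def sym_clusters_def)
    next
      case 2
      then have "sym_clusters u = sym_clusters (swap_tree t)" by (simp add: sym_clusters_def)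
      then show ?thesis using 2 sym_clusters_swap_tree by (simp add: twins_def)
    qed
  qed
  moreover have "reorderings t \<inter> reorderings (swap_tree t) = {}"
  proof (rule equals0I)
    fix u assume "u \<in> reorderings t \<inter> reorderings (swap_tree t)"
    then have "clusters t = clusters (swap_tree t)" by (auto simp: reorderings_def)
    then have "leaf_set t = swap ` leaf_set t" using Un_clusters leaf_set_swap_tree by metis
    then show False using d by simp
  qed
  moreover have "(2 :: nat) ^ (length (indices t) - 1) + 2 ^ (length (indices t) - 1) = 2 ^ length (indices t)"
    using length_indices_pos[of t] by (cases "length (indices t)") auto
  ultimately show ?thesis
    using card_reorderings[OF t] card_reorderings[of "swap_tree t"] t by (simp add: card_Un_disjoint)
qed

definition twin_lists :: "bt list \<Rightarrow> bt list set" where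
  "twin_lists ts = {us. list_all2 (\<lambda>t u. u \<in> twins t) ts us}"

lemma card_twin_lists:
  assumes "\<And>t. t \<in> set ts \<Longrightarrow> distinct (indices t)"
  shows "finite (twin_lists ts) \<and> card (twin_lists ts) = 2 ^ length (concat (map indices ts))"
  using assms
proof (induction ts)
  case Nil
  then show ?case by (simp add: twin_lists_def)
next
  case (Cons t ts)
  have "twin_lists (t # ts) = (\<lambda>(u, us). u # us) ` (twins t \<times> twin_lists ts)"
    by (auto simp: twin_lists_def list_all2_Cons1)
  moreover have "inj_on (\<lambda>(u, us). u # us) (twins t \<times> twin_lists ts)" by (auto simp: inj_on_def)
  ultimately show ?case
    using Cons card_twins[of t] by (simp add: card_image card_cartesian_product power_add)
qed

section \<open>Recovering the order of the blocks from the trunk sides\<close>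

fun disjoint_list :: "'a set list \<Rightarrow> bool" where
  "disjoint_list [] \<longleftrightarrow> True"
| "disjoint_list (b # bs) \<longleftrightarrow> b \<noteq> {} \<and> b \<inter> \<Union> (set bs) = {} \<and> disjoint_list bs"

text \<open>In contrast to \<open>prefs\<close>, the full union is included. Without it the last
  block could not be recovered from the family.\<close>

definition prefs1 :: "'a set list \<Rightarrow> 'a set set" where
  "prefs1 bs = {\<Union> (set (take i bs)) | i. 0 < i \<and> i \<le> length bs}"

lemma prefs1_Cons: "prefs1 (b # bs) = insert b ((\<lambda>X. b \<union> X) ` prefs1 bs)"
proof (intro equalityI subsetI)
  fix A assume "A \<in> prefs1 (b # bs)"
  then obtain i where i: "0 < i" "i \<le> Suc (length bs)" "A = \<Union> (set (take i (b # bs)))"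
    by (auto simp: prefs1_def)
  then obtain j where j: "i = Suc j" by (cases i) auto
  show "A \<in> insert b ((\<lambda>X. b \<union> X) ` prefs1 bs)"
  proof (cases "j = 0")
    case True
    then show ?thesis using i j by simp
  next
    case False
    then have "\<Union> (set (take j bs)) \<in> prefs1 bs" using i j by (auto simp: prefs1_def)
    moreover have "A = b \<union> \<Union> (set (take j bs))" using i j by simp
    ultimately show ?thesis by blast
  qed
next
  fix A assume "A \<in> insert b ((\<lambda>X. b \<union> X) ` prefs1 bs)"
  then consider "A = b" | i where "i \<le> length bs" "A = b \<union> \<Union> (set (take i bs))"
    by (auto simp: prefs1_def)
  then show "A \<in> prefs1 (b # bs)"
  proof cases
    case 1
    then show ?thesis unfolding prefs1_def by (intro CollectI exI[of _ 1]) simp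
  next
    case (2 i)
    then show ?thesis unfolding prefs1_def by (intro CollectI exI[of _ "Suc i"]) simp
  qed
qed

lemma prefs1_sub: "A \<in> prefs1 bs \<Longrightarrow> A \<subseteq> \<Union> (set bs)"
  unfolding prefs1_def using set_take_subset by fastforce

lemma prefs1_nonempty: "disjoint_list bs \<Longrightarrow> A \<in> prefs1 bs \<Longrightarrow> A \<noteq> {}"
proof (cases bs)
  case Nil
  then show "A \<in> prefs1 bs \<Longrightarrow> A \<noteq> {}" by (simp add: prefs1_def)
next
  case (Cons b bs')
  then show "disjoint_list bs \<Longrightarrow> A \<in> prefs1 bs \<Longrightarrow> A \<noteq> {}" by (auto simp: prefs1_Cons)
qed

text \<open>The first block is the least partial union. Removing it from the other members leaves
  the partial unions of the tail.\<close>

lemma prefs1_inj: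
  "disjoint_list bs \<Longrightarrow> disjoint_list cs \<Longrightarrow> prefs1 bs = prefs1 cs \<Longrightarrow> bs = cs"
proof (induction bs arbitrary: cs)
  case Nil
  then show ?case by (cases cs) (auto simp: prefs1_Cons, auto simp: prefs1_def)
next
  case (Cons b bs)
  show ?case
  proof (cases cs)
    case Nil
    then show ?thesis using Cons.prems(3) by (auto simp: prefs1_Cons) (auto simp: prefs1_def)
  next
    case cs: (Cons c cs')
    have eq: "insert b ((\<lambda>X. b \<union> X) ` prefs1 bs) = insert c ((\<lambda>X. c \<union> X) ` prefs1 cs')"
      using Cons.prems(3) cs by (simp add: prefs1_Cons)
    have "b \<in> insert c ((\<lambda>X. c \<union> X) ` prefs1 cs')" "c \<in> insert b ((\<lambda>X. b \<union> X) ` prefs1 bs)"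
      using eq by (blast, blast)
    then have bc: "b = c" by blast
    have strip: "(\<lambda>X. X - b) ` (insert b ((\<lambda>X. b \<union> X) ` prefs1 xs) - {b}) = prefs1 xs"
      if xs: "b \<inter> \<Union> (set xs) = {}" "disjoint_list xs" for xs
    proof -
      have X: "b \<union> X \<noteq> b" "(b \<union> X) - b = X" if "X \<in> prefs1 xs" for X
        using prefs1_sub[OF that] prefs1_nonempty[OF xs(2) that] xs(1) by blast+
      have "insert b ((\<lambda>X. b \<union> X) ` prefs1 xs) - {b} = (\<lambda>X. b \<union> X) ` prefs1 xs"
        using X(1) by blast
      then show ?thesis using X(2) by (simp add: image_image cong: image_cong)
    qed
    have "prefs1 bs = (\<lambda>X. X - b) ` (insert b ((\<lambda>X. b \<union> X) ` prefs1 bs) - {b})"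
      by (rule strip[symmetric]) (use Cons.prems(1) in auto)
    also have "\<dots> = (\<lambda>X. X - b) ` (insert b ((\<lambda>X. b \<union> X) ` prefs1 cs') - {b})"
      unfolding eq unfolding bc ..
    also have "\<dots> = prefs1 cs'" by (rule strip) (use Cons.prems(2) cs bc in auto)
    finally have "prefs1 bs = prefs1 cs'" .
    then have "bs = cs'" using Cons.IH[of cs'] Cons.prems(1,2) cs by simp
    then show ?thesis using bc cs by simp
  qed
qed

context code
begin

lemma disjoint_list_base: "disjoint_list (map base ts)"
proof -
  have "disjoint_list (map base us)" if "distinct us" "set us \<subseteq> set ts" for us
    using that
  proof (induction us)
    case (Cons u us)
    have "base u \<inter> base v = {}" if "v \<in> set us" for v
      using base_disjoint[of u v] that Cons.prems by auto
    then show ?case using Cons by auto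
  qed simp
  then show ?thesis using dist_ts by blast
qed

lemma prefs1_base: "prefs1 (map base ts) = insert (labels n) (prefs (map base ts))"
proof -
  have "prefs1 (map base ts) = insert (\<Union> (set (map base ts))) (prefs (map base ts))"
  proof (intro equalityI subsetI)
    fix A assume "A \<in> prefs1 (map base ts)"
    then obtain i where "0 < i" "i \<le> length ts" "A = \<Union> (set (take i (map base ts)))"
      by (auto simp: prefs1_def)
    then show "A \<in> insert (\<Union> (set (map base ts))) (prefs (map base ts))"
      by (cases "i = length ts") (auto simp: prefs_def)
  next
    fix A assume "A \<in> insert (\<Union> (set (map base ts))) (prefs (map base ts))"
    then consider "A = \<Union> (set (take (length ts) (map base ts)))" | i where "0 < i" "i < length ts" "A = \<Union> (set (take i (map base ts)))"
      by (auto simp: prefs_def)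
    then show "A \<in> prefs1 (map base ts)"
    proof cases
      case 1
      then show ?thesis unfolding prefs1_def using ts_ne by (intro CollectI exI[of _ "length ts"]) simp
    next
      case (2 i)
      then show ?thesis unfolding prefs1_def by (intro CollectI exI[of _ i]) simp
    qed
  qed
  then show ?thesis using Un_base by simp
qed

text \<open>The trunk sides are closed under complement and so do not show the direction of the
  trunk. Knowing the first block fixes the direction.\<close>

lemma prefs_hd: "prefs (map base ts) = {A \<in> code_trunk n ts. base (hd ts) \<subseteq> A}"
proof (intro equalityI subsetI)
  fix A assume "A \<in> {A \<in> code_trunk n ts. base (hd ts) \<subseteq> A}"
  then have A: "A \<in> code_trunk n ts" "base (hd ts) \<subseteq> A" by auto
  show "A \<in> prefs (map base ts)"
  proof (rule ccontr)
    assume "A \<notin> prefs (map base ts)"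
    then obtain B where "B \<in> prefs (map base ts)" "A = labels n - B" using A(1) by (auto simp: code_trunk_def)
    then show False using prefs_props(3) A(2) base_nonempty[of "hd ts"] by blast
  qed
qed (use prefs_props(3) in \<open>auto simp: code_trunk_def\<close>)

lemma base_hd_code_trunk: "2 \<le> length ts \<Longrightarrow> base (hd ts) \<in> prefs (map base ts)"
  unfolding prefs_def using ts_ne by (intro CollectI exI[of _ 1]) (cases ts, auto)

lemma rev_code: "code n (rev ts)"
proof
  have "concat (map indices (rev ts)) = concat (rev (map indices ts))" by (simp add: rev_map)
  moreover have "set (concat (rev xss)) = set (concat xss)" for xss :: "nat list list" by simp
  moreover have "distinct (concat (rev xss)) \<longleftrightarrow> distinct (concat xss)" for xss :: "nat list list"
  proof -
    have "mset (concat (rev xss)) = mset (concat xss)" by (induction xss) auto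
    then show ?thesis by (rule mset_eq_imp_distinct_iff)
  qed
  ultimately show "rev ts \<in> Codes n" using code by (auto simp: Codes_def)
qed

text \<open>A partial union from the right is the complement of one from the left.\<close>

lemma code_trunk_rev: "code_trunk n (rev ts) = code_trunk n ts"
proof -
  have t: "\<Union> (set (take i (map base ts))) \<subseteq> labels n" for i
    using Un_base by (metis Union_mono set_map set_take_subset)
  have "prefs (map base (rev ts)) = (\<lambda>i. \<Union> (set (drop i (map base ts)))) ` {0<..<length ts}"
  proof -
    have "prefs (map base (rev ts)) = (\<lambda>i. \<Union> (set (drop (length ts - i) (map base ts)))) ` {0<..<length ts}"
    proof -
      have "\<Union> (set (take i (map base (rev ts)))) = \<Union> (set (drop (length ts - i) (map base ts)))" for i
        unfolding rev_map[symmetric] take_rev by simp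
      then have "prefs (map base (rev ts)) = {\<Union> (set (drop (length ts - i) (map base ts))) | i. 0 < i \<and> i < length ts}"
        by (simp add: prefs_def)
      then show ?thesis by auto
    qed
    also have "\<dots> = (\<lambda>i. \<Union> (set (drop i (map base ts)))) ` (\<lambda>i. length ts - i) ` {0<..<length ts}"
      by (simp add: image_image)
    also have "(\<lambda>i. length ts - i) ` {0<..<length ts} = {0<..<length ts}"
    proof (intro equalityI subsetI)
      fix i assume "i \<in> {0<..<length ts}"
      then show "i \<in> (\<lambda>i. length ts - i) ` {0<..<length ts}"
        by (intro image_eqI[of _ _ "length ts - i"]) auto
    qed auto
    finally show ?thesis .
  qed
  also have "\<dots> = (\<lambda>A. labels n - A) ` prefs (map base ts)"
    unfolding prefs_image image_image compl_take ..
  finally have p: "prefs (map base (rev ts)) = (\<lambda>A. labels n - A) ` prefs (map base ts)" .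
  have "(\<lambda>A. labels n - A) ` (\<lambda>A. labels n - A) ` prefs (map base ts) = prefs (map base ts)"
  proof -
    have "labels n - (labels n - A) = A" if "A \<in> prefs (map base ts)" for A
      using prefs_props(2)[OF that] by (simp add: double_diff)
    then show ?thesis by (simp add: image_image cong: image_cong)
  qed
  then show ?thesis unfolding code_trunk_def p by (simp add: Un_commute)
qed

lemma code_small_rev: "code_small (rev ts) = code_small ts"
  by (simp add: code_small_def)

lemma code_sides_rev: "code_sides n (rev ts) = code_sides n ts"
  by (simp add: code_sides_def code_trunk_rev code_small_rev)

lemma sym_clusters_from_code_small:
  assumes "t \<in> set ts"
  shows "sym_clusters t = {A \<in> code_small ts. A \<subseteq> base t}"
proof (intro equalityI subsetI)
  fix A assume "A \<in> {A \<in> code_small ts. A \<subseteq> base t}"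
  then obtain u where u: "u \<in> set ts" "A \<in> sym_clusters u" "A \<subseteq> base t" by (auto simp: code_small_iff)
  then have "u = t" using base_disjoint[OF u(1) assms] sym_clusters_sub_base[OF u(2)] sym_clusters_nonempty[OF u(2)] by blast
  then show "A \<in> sym_clusters t" using u by simp
qed (use assms sym_clusters_sub_base in \<open>auto simp: code_small_iff\<close>)

lemma twin_props:
  assumes "us \<in> twin_lists ts"
  shows "us \<in> Codes n" "code_sides n us = code_sides n ts" "map base us = map base ts"
proof -
  have l2: "list_all2 (\<lambda>t u. u \<in> twins t) ts us" using assms by (simp add: twin_lists_def)
  then have len: "length us = length ts" by (simp add: list_all2_lengthD)
  have sym_clusters: "sym_clusters (us ! i) = sym_clusters (ts ! i)" and dix: "distinct (indices (us ! i))" if "i < length ts" for i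
    using list_all2_nthD[OF l2 that] by (auto simp: twins_def)
  have mCs: "map sym_clusters us = map sym_clusters ts" using sym_clusters len by (intro nth_equalityI) auto
  then have mapC: "map (f \<circ> sym_clusters) us = map (f \<circ> sym_clusters) ts" for f :: "label set set \<Rightarrow> 'a" by (metis map_map)
  have base: "base = Union \<circ> sym_clusters" by (auto simp: Un_sym_clusters)
  show mb: "map base us = map base ts" unfolding base by (rule mapC)
  have "sym_clusters ` set us = sym_clusters ` set ts" using mCs by (metis set_map)
  then have "code_small us = code_small ts" by (simp add: code_small_def)
  then show "code_sides n us = code_sides n ts" using mb by (simp add: code_sides_def code_trunk_def)
  have dist: "distinct (concat (map indices us)) \<and> set (concat (map indices us)) = set (concat (map indices ts))"
    using l2 dist_indices
  proof (induction rule: list_all2_induct)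
    case (Cons t ts u us)
    have "set (indices u) = set (indices t)" using Cons.hyps(1) unfolding index_base[symmetric] Un_sym_clusters[symmetric] twins_def by simp
    then show ?case using Cons by (auto simp: twins_def)
  qed simp
  moreover have "us \<noteq> []" using len ts_ne by auto
  moreover have "no_mono_cherry u" if u: "u \<in> set us" for u
  proof -
    obtain i where i: "i < length ts" "u = us ! i" using u len by (auto simp: in_set_conv_nth)
    have "bichromatic A" if A: "A \<in> clusters u" "2 \<le> card A" for A
    proof -
      have "A \<in> sym_clusters (ts ! i)" using A(1) sym_clusters[OF i(1)] i(2) by (auto simp: sym_clusters_def)
      then have "A \<in> code_small ts" using i(1) code_small_iff by auto
      then show ?thesis using code_small_bichromatic A(2) by blast
    qed
    then show ?thesis using no_mono_cherry_iff_bichromatic dix[OF i(1)] i(2) by blast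
  qed
  ultimately show "us \<in> Codes n" using set_indices_ts by (simp add: Codes_def)
qed

text \<open>The clusters of an entry are cut out of \<open>code_small\<close> by its block, so
  entries with equal blocks are twins.\<close>

lemma twin_if_base_eq:
  assumes us: "code n us" and sm: "code_small us = code_small ts" and mb: "map base us = map base ts"
  shows "us \<in> twin_lists ts"
proof -
  interpret us: code n us by (rule us)
  have len: "length us = length ts" using mb by (metis length_map)
  have "us ! i \<in> twins (ts ! i)" if i: "i < length ts" for i
  proof -
    have b: "base (us ! i) = base (ts ! i)" using mb i len by (metis nth_map)
    have "sym_clusters (us ! i) = sym_clusters (ts ! i)"
      using sym_clusters_from_code_small[of "ts ! i"] us.sym_clusters_from_code_small[of "us ! i"] i len b sm by simp
    then show ?thesis using us.dist_indices_t[of "us ! i"] i len by (simp add: twins_def)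
  qed
  then show ?thesis using len by (simp add: twin_lists_def list_all2_conv_all_nth)
qed

lemma bases_eq:
  assumes us: "code n us" and tr: "code_trunk n us = code_trunk n ts" and hd: "base (hd us) = base (hd ts)"
  shows "map base us = map base ts"
proof -
  interpret us: code n us by (rule us)
  have "prefs (map base us) = prefs (map base ts)"
    unfolding prefs_hd us.prefs_hd tr hd ..
  then have "prefs1 (map base us) = prefs1 (map base ts)" unfolding prefs1_base us.prefs1_base by simp
  then show ?thesis using prefs1_inj us.disjoint_list_base disjoint_list_base by blast
qed

text \<open>With at least two entries, the first block of \<open>us\<close> is itself a trunk side.
  As a trunk side of \<open>ts\<close> it contains the first block of \<open>ts\<close> or is
  disjoint from it, and the inclusion excludes the latter.\<close>

lemma hd_eq_if_sub:
  assumes us: "code n us" and tr: "code_trunk n us = code_trunk n ts" and len: "2 \<le> length us" and sub: "base (hd us) \<subseteq> base (hd ts)"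
  shows "base (hd us) = base (hd ts)"
proof -
  interpret us: code n us by (rule us)
  have "base (hd us) \<in> code_trunk n ts" using us.base_hd_code_trunk[OF len] tr by (auto simp: code_trunk_def)
  then consider "base (hd us) \<in> prefs (map base ts)" | B where "B \<in> prefs (map base ts)" "base (hd us) = labels n - B"
    by (auto simp: code_trunk_def)
  then show ?thesis
  proof cases
    case 1
    then show ?thesis using prefs_props(3) sub by blast
  next
    case 2
    then show ?thesis using prefs_props(3)[OF 2(1)] sub base_nonempty[of "hd us"] by blast
  qed
qed

text \<open>It remains to find the direction of the trunk. The first block of \<open>ts\<close> is a
  partial union of \<open>us\<close> or of \<open>rev us\<close>; it then contains the first block
  of that list, and \<open>hd_eq_if_sub\<close> turns this into equality.\<close>

lemma code_sides_eq_imp: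
  assumes us: "us \<in> Codes n" and eq: "code_sides n us = code_sides n ts"
  shows "length us = length ts" "us \<in> twin_lists ts \<or> rev us \<in> twin_lists ts"
proof -
  have cus: "code n us" using us by unfold_locales
  interpret us: code n us by (rule cus)
  interpret ru: code n "rev us" by (rule us.rev_code)
  have sm: "code_small us = code_small ts" using small_sides_code_sides us.small_sides_code_sides eq by simp
  have tr: "code_trunk n us = code_trunk n ts" using trunk_sides_code_sides us.trunk_sides_code_sides eq by simp
  show len: "length us = length ts" using card_code_trunk us.card_code_trunk tr by simp
  show "us \<in> twin_lists ts \<or> rev us \<in> twin_lists ts"
  proof (cases "2 \<le> length ts")
    case False
    then have "length ts = 1" using ts_ne by (cases ts) (auto simp: Suc_le_eq)
    then obtain t u where tu: "ts = [t]" "us = [u]" using len by (auto simp: length_Suc_conv)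
    then have "map base us = map base ts" using Un_base us.Un_base by simp
    then show ?thesis using twin_if_base_eq[OF cus sm] by blast
  next
    case True
    have "base (hd ts) \<in> code_trunk n us" using base_hd_code_trunk[OF True] tr by (auto simp: code_trunk_def)
    moreover have "code_trunk n us = prefs (map base us) \<union> prefs (map base (rev us))"
    proof -
      have "code_trunk n us = code_trunk n us \<union> code_trunk n (rev us)" using us.code_trunk_rev by simp
      moreover have "(\<lambda>A. labels n - A) ` prefs (map base us) \<subseteq> prefs (map base (rev us))"
      proof
        fix A assume "A \<in> (\<lambda>A. labels n - A) ` prefs (map base us)"
        then obtain B where B: "B \<in> prefs (map base us)" "A = labels n - B" by blast
        then have AT: "A \<in> code_trunk n (rev us)" using us.code_trunk_rev by (auto simp: code_trunk_def)
        have "base (hd (rev us)) \<subseteq> A"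
        proof -
          obtain i where i: "0 < i" "i < length us" "B = \<Union> (set (take i (map base us)))" using B(1) by (auto simp: prefs_def)
          have "hd (rev us) \<in> set (drop i us)" using i(2) us.ts_ne by (simp add: hd_rev last_drop[symmetric] del: last_drop)
          then show ?thesis unfolding B(2) i(3) us.compl_take by (auto simp: drop_map)
        qed
        then show "A \<in> prefs (map base (rev us))" using ru.prefs_hd AT by blast
      qed
      moreover have "prefs (map base (rev us)) \<subseteq> code_trunk n (rev us)" by (auto simp: code_trunk_def)
      ultimately show ?thesis using us.code_trunk_rev by (auto simp: code_trunk_def)
    qed
    ultimately consider "base (hd ts) \<in> prefs (map base us)" | "base (hd ts) \<in> prefs (map base (rev us))" by blast
    then show ?thesis
    proof cases
      case 1
      then have "base (hd us) = base (hd ts)"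
        using hd_eq_if_sub[OF cus tr] True len us.prefs_props(3) by simp
      then show ?thesis using twin_if_base_eq[OF cus sm] bases_eq[OF cus tr] by blast
    next
      case 2
      have tr': "code_trunk n (rev us) = code_trunk n ts" and sm': "code_small (rev us) = code_small ts"
        using tr sm us.code_trunk_rev us.code_small_rev by auto
      have "base (hd (rev us)) = base (hd ts)"
        using hd_eq_if_sub[OF us.rev_code tr'] True len ru.prefs_props(3)[OF 2] by simp
      then show ?thesis using twin_if_base_eq[OF us.rev_code sm'] bases_eq[OF us.rev_code tr'] by blast
    qed
  qed
qed

text \<open>Reversal gives new codes unless the length is 1: twins keep the sequence of blocks,
  while first and last block of a longer code are nonempty and disjoint.\<close>

lemma card_code_sides_fibre:
  "card {us \<in> Codes n. code_sides n us = code_sides n ts} = (if length ts = 1 then 2 ^ n else 2 ^ Suc n)"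
proof -
  have eq: "{us \<in> Codes n. code_sides n us = code_sides n ts} = twin_lists ts \<union> rev ` twin_lists ts"
  proof (intro equalityI subsetI)
    fix us assume "us \<in> {us \<in> Codes n. code_sides n us = code_sides n ts}"
    then show "us \<in> twin_lists ts \<union> rev ` twin_lists ts"
      using code_sides_eq_imp(2)[of us] by (force intro: image_eqI[of us rev "rev us"])
  next
    fix us assume "us \<in> twin_lists ts \<union> rev ` twin_lists ts"
    then consider "us \<in> twin_lists ts" | vs where "vs \<in> twin_lists ts" "us = rev vs" by blast
    then show "us \<in> {us \<in> Codes n. code_sides n us = code_sides n ts}"
    proof cases
      case 1
      then show ?thesis using twin_props by blast
    next
      case 2
      then have v: "code n vs" "code_sides n vs = code_sides n ts" using twin_props[OF 2(1)] by (simp_all add: code_def)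
      then show ?thesis using code.rev_code[OF v(1)] code.code_sides_rev[OF v(1)] 2(2) by (simp add: code_def)
    qed
  qed
  have "length (concat (map indices ts)) = card (set (concat (map indices ts)))"
    using dist_indices by (rule distinct_card[symmetric])
  then have len: "length (concat (map indices ts)) = n" unfolding set_indices_ts by simp
  have tw: "finite (twin_lists ts)" "card (twin_lists ts) = 2 ^ n"
    using card_twin_lists[OF dist_indices_t] len by simp_all
  have tlen: "length us = length ts" if "us \<in> twin_lists ts" for us
    using that by (simp add: twin_lists_def list_all2_lengthD)
  show ?thesis
  proof (cases "length ts = 1")
    case True
    have "rev us = us" if "us \<in> twin_lists ts" for us
      using tlen[OF that] True by (auto simp: length_Suc_conv)
    then have "rev ` twin_lists ts = twin_lists ts" by simp
    then show ?thesis using eq tw True by simp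
  next
    case False
    have "twin_lists ts \<inter> rev ` twin_lists ts = {}"
    proof (rule equals0I)
      fix us assume "us \<in> twin_lists ts \<inter> rev ` twin_lists ts"
      then obtain vs where v: "us \<in> twin_lists ts" "vs \<in> twin_lists ts" "us = rev vs" by blast
      then have "map base (rev vs) = map base ts" "map base vs = map base ts" using twin_props(3) by blast+
      then have r: "rev (map base ts) = map base ts" by (metis rev_map)
      obtain t rest where rest: "ts = t # rest" using ts_ne by (cases ts) auto
      then have "rest \<noteq> []" using False by auto
      then obtain xs u where "rest = xs @ [u]" by (cases rest rule: rev_cases) auto
      with rest have ts: "ts = t # xs @ [u]" by simp
      have "hd (rev (map base ts)) = hd (map base ts)" using r by (rule arg_cong)
      then have "base t = base u" unfolding ts by simp
      moreover have "t \<noteq> u" using dist_ts ts by auto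
      ultimately show False using base_disjoint[of t u] ts base_nonempty[of t] by auto
    qed
    moreover have "card (rev ` twin_lists ts) = card (twin_lists ts)"
      by (rule card_image) (simp add: inj_on_def)
    ultimately have "card (twin_lists ts \<union> rev ` twin_lists ts) = 2 ^ Suc n"
      using tw by (simp add: card_Un_disjoint)
    then show ?thesis using eq False by simp
  qed
qed

end

text \<open>Codes of length 1 have fibres of half the size, so they get weight 2; then every family
  of sides is counted \<open>2 ^ Suc n\<close> times.\<close>

lemma card_code_sides_Codes:
  assumes fin: "finite (Codes n)"
  shows "card {ts \<in> Codes n. length ts = 1} * 2 + card {ts \<in> Codes n. length ts \<noteq> 1} = 2 ^ Suc n * card (code_sides n ` Codes n)"
proof -
  let ?A = "{ts \<in> Codes n. length ts = 1}" and ?B = "{ts \<in> Codes n. length ts \<noteq> 1}"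
  have same: "length us = length ts" if "ts \<in> Codes n" "us \<in> Codes n" "code_sides n us = code_sides n ts" for ts us
  proof -
    interpret code n ts using that by unfold_locales
    show ?thesis using code_sides_eq_imp(1) that by blast
  qed
  have "card ?A = 2 ^ n * card (code_sides n ` ?A)"
  proof (rule card_eq_fibres)
    fix ts assume ts: "ts \<in> ?A"
    then interpret code n ts by unfold_locales simp
    have "us \<in> ?A \<longleftrightarrow> us \<in> Codes n" if "code_sides n us = code_sides n ts" for us
      using same[of ts us] ts that by auto
    then have "{us \<in> ?A. code_sides n us = code_sides n ts} = {us \<in> Codes n. code_sides n us = code_sides n ts}" by blast
    then show "card {us \<in> ?A. code_sides n us = code_sides n ts} = 2 ^ n" using card_code_sides_fibre ts by simp
  qed (use fin in simp)
  moreover have "card ?B = 2 ^ Suc n * card (code_sides n ` ?B)"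
  proof (rule card_eq_fibres)
    fix ts assume ts: "ts \<in> ?B"
    then interpret code n ts by unfold_locales simp
    have "us \<in> ?B \<longleftrightarrow> us \<in> Codes n" if "code_sides n us = code_sides n ts" for us
      using same[of ts us] ts that by auto
    then have "{us \<in> ?B. code_sides n us = code_sides n ts} = {us \<in> Codes n. code_sides n us = code_sides n ts}" by blast
    then show "card {us \<in> ?B. code_sides n us = code_sides n ts} = 2 ^ Suc n" using card_code_sides_fibre ts by simp
  qed (use fin in simp)
  moreover have "card (code_sides n ` Codes n) = card (code_sides n ` ?A) + card (code_sides n ` ?B)"
  proof -
    have "code_sides n ` Codes n = code_sides n ` ?A \<union> code_sides n ` ?B" by blast
    moreover have "code_sides n ` ?A \<inter> code_sides n ` ?B = {}"
    proof (rule equals0I)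
      fix X assume "X \<in> code_sides n ` ?A \<inter> code_sides n ` ?B"
      then obtain ts us where "ts \<in> ?A" "us \<in> ?B" "code_sides n us = code_sides n ts" by auto
      then show False using same[of ts us] by simp
    qed
    ultimately show ?thesis using fin by (simp add: card_Un_disjoint)
  qed
  ultimately show ?thesis by (simp add: algebra_simps)
qed

section \<open>Counting codes\<close>

definition trees_over :: "nat list \<Rightarrow> bt set" where
  "trees_over xs = {t. indices t = xs \<and> no_mono_cherry t}"

definition forests_over :: "nat list \<Rightarrow> bt list set" where
  "forests_over xs = {ts. ts \<noteq> [] \<and> concat (map indices ts) = xs \<and> (\<forall>t\<in>set ts. no_mono_cherry t)}"

text \<open>One leaf has two colours. For two leaves the convolution would give 4, but the two
  monochromatic cherries are excluded. From three leaves on the root is not a cherry, and the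
  convolution over the number of leaves on the left holds.\<close>

fun num_trees :: "nat \<Rightarrow> nat" where
  "num_trees n = (if n = 0 then 0 else if n \<le> 2 then 2 else \<Sum>j\<in>{1..<n}. num_trees j * num_trees (n - j))"

declare num_trees.simps [simp del]

fun num_forests :: "nat \<Rightarrow> nat" where
  "num_forests n = num_trees n + (\<Sum>j\<in>{1..<n}. num_trees j * num_forests (n - j))"

declare num_forests.simps [simp del]

lemma indices_singleton_iff: "indices t = [i] \<longleftrightarrow> t = Lf (Unprimed i) \<or> t = Lf (Primed i)"
proof (cases t)
  case (Lf a)
  then show ?thesis by (cases a) auto
next
  case (Nd s u)
  have "length (indices s @ indices u) \<noteq> 1"
    unfolding length_append using length_indices_pos[of s] length_indices_pos[of u] by linarith
  then have "length (indices t) \<noteq> 1" using Nd by simp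
  then have "indices t \<noteq> [i]" by auto
  then show ?thesis using Nd by (simp del: indices.simps)
qed

lemma card_trees_over:
  "finite (trees_over xs) \<and> card (trees_over xs) = num_trees (length xs)"
proof (induction "length xs" arbitrary: xs rule: less_induct)
  case less
  consider "xs = []" | a where "xs = [a]" | a b where "xs = [a, b]" | "3 \<le> length xs"
    by (cases xs rule: remdups_adj.cases; cases "tl (tl xs)") auto
  then show ?case
  proof cases
    case 1
    have "trees_over xs = {}" using length_indices_pos 1 by (auto simp: trees_over_def)
    then show ?thesis using 1 by (simp add: num_trees.simps)
  next
    case (2 a)
    have "trees_over xs = {Lf (Unprimed a), Lf (Primed a)}"
      unfolding 2 trees_over_def indices_singleton_iff by auto
    then show ?thesis using 2 by (simp add: num_trees.simps)
  next
    case (3 a b)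
    have "trees_over xs = {Nd (Lf (Unprimed a)) (Lf (Primed b)), Nd (Lf (Primed a)) (Lf (Unprimed b))}"
    proof (intro equalityI subsetI)
      fix t assume "t \<in> trees_over xs"
      then have t: "indices t = [a, b]" "no_mono_cherry t" using 3 by (auto simp: trees_over_def)
      then obtain s u where su: "t = Nd s u" by (cases t) auto
      then have "indices s @ indices u = [a, b]" using t by simp
      moreover have "indices s \<noteq> []" "indices u \<noteq> []" using length_indices_pos[of s] length_indices_pos[of u] by auto
      ultimately have "indices s = [a]" "indices u = [b]" by (auto simp: append_eq_Cons_conv)
      then show "t \<in> {Nd (Lf (Unprimed a)) (Lf (Primed b)), Nd (Lf (Primed a)) (Lf (Unprimed b))}"
        using su t(2) unfolding indices_singleton_iff by auto
    qed (auto simp: trees_over_def 3)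
    then show ?thesis using 3 by (simp add: num_trees.simps)
  next
    case 4
    let ?n = "length xs"
    let ?N = "\<lambda>j. (\<lambda>(s, u). Nd s u) ` (trees_over (take j xs) \<times> trees_over (drop j xs))"
    have eq: "trees_over xs = (\<Union>j\<in>{1..<?n}. ?N j)"
    proof (intro equalityI subsetI)
      fix t assume "t \<in> trees_over xs"
      then have t: "indices t = xs" "no_mono_cherry t" by (auto simp: trees_over_def)
      then obtain s u where su: "t = Nd s u" using 4 by (cases t) auto
      define j where "j = length (indices s)"
      have xs: "xs = indices s @ indices u" using t su by simp
      have su_indices: "indices s = take j xs" "indices u = drop j xs" "length xs = j + length (indices u)"
        unfolding j_def xs by simp_all
      have "s \<in> trees_over (take j xs)" "u \<in> trees_over (drop j xs)"
        using t(2) su_indices(1,2) unfolding su trees_over_def by simp_all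
      moreover have "j \<in> {1..<?n}"
        using length_indices_pos[of s] length_indices_pos[of u] su_indices(3) by (simp add: j_def Suc_le_eq)
      ultimately show "t \<in> (\<Union>j\<in>{1..<?n}. ?N j)" unfolding su by blast
    next
      fix t assume "t \<in> (\<Union>j\<in>{1..<?n}. ?N j)"
      then obtain j s u where j: "1 \<le> j" "j < ?n" "s \<in> trees_over (take j xs)" "u \<in> trees_over (drop j xs)" "t = Nd s u"
        by auto
      then have indices: "indices s @ indices u = xs" "no_mono_cherry s" "no_mono_cherry u" by (auto simp: trees_over_def)
      \<comment> \<open>Both children are leaves only over a word of length 2, so here the root
        imposes no colour condition.\<close>
      have "cherry_ok s u"
      proof (cases "\<exists>a b. s = Lf a \<and> u = Lf b")
        case True
        then have "length xs = 2" using indices(1) by auto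
        then show ?thesis using 4 by simp
      next
        case False
        then show ?thesis by (cases s; cases u) auto
      qed
      then show "t \<in> trees_over xs" using indices j(5) by (simp add: trees_over_def)
    qed
    have IH: "finite (trees_over (take j xs)) \<and> card (trees_over (take j xs)) = num_trees j"
      "finite (trees_over (drop j xs)) \<and> card (trees_over (drop j xs)) = num_trees (?n - j)"
      if "j \<in> {1..<?n}" for j
      using less[of "take j xs"] less[of "drop j xs"] that by auto
    have cN: "card (?N j) = num_trees j * num_trees (?n - j)" if "j \<in> {1..<?n}" for j
    proof -
      have "card (?N j) = card (trees_over (take j xs) \<times> trees_over (drop j xs))"
        by (rule card_image) (auto simp: inj_on_def)
      then show ?thesis using IH[OF that] by (simp add: card_cartesian_product)
    qed
    have disj: "?N i \<inter> ?N j = {}" if "i \<in> {1..<?n}" "j \<in> {1..<?n}" "i \<noteq> j" for i j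
    proof (rule equals0I)
      fix t assume "t \<in> ?N i \<inter> ?N j"
      then obtain s u where "s \<in> trees_over (take i xs)" "s \<in> trees_over (take j xs)" by auto
      then have "length (take i xs) = length (take j xs)" by (auto simp: trees_over_def)
      then show False using that by simp
    qed
    have "card (trees_over xs) = (\<Sum>j\<in>{1..<?n}. card (?N j))"
      unfolding eq by (rule card_UN_disjoint) (use IH disj in auto)
    also have "\<dots> = (\<Sum>j\<in>{1..<?n}. num_trees j * num_trees (?n - j))"
      by (rule sum.cong[OF refl]) (rule cN)
    also have "\<dots> = num_trees ?n" using 4 by (subst num_trees.simps) simp
    finally show ?thesis unfolding eq using IH by auto
  qed
qed

lemma card_forests_over:
  "finite (forests_over xs) \<and> card (forests_over xs) = num_forests (length xs)"
proof (induction "length xs" arbitrary: xs rule: less_induct)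
  case less
  let ?n = "length xs"
  let ?N = "\<lambda>j. (\<lambda>(t, ts). t # ts) ` (trees_over (take j xs) \<times> forests_over (drop j xs))"
  let ?S = "(\<lambda>t. [t]) ` trees_over xs"
  have eq: "forests_over xs = ?S \<union> (\<Union>j\<in>{1..<?n}. ?N j)"
  proof (intro equalityI subsetI)
    fix ts assume "ts \<in> forests_over xs"
    then have ts: "ts \<noteq> []" "concat (map indices ts) = xs" "\<forall>t\<in>set ts. no_mono_cherry t" by (auto simp: forests_over_def)
    then obtain t us where tu: "ts = t # us" by (cases ts) auto
    show "ts \<in> ?S \<union> (\<Union>j\<in>{1..<?n}. ?N j)"
    proof (cases "us = []")
      case True
      then show ?thesis using ts tu by (auto simp: trees_over_def)
    next
      case False
      define j where "j = length (indices t)"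
      have xs: "xs = indices t @ concat (map indices us)" using ts(2) tu by simp
      have tu_indices: "indices t = take j xs" "concat (map indices us) = drop j xs" "length xs = j + length (concat (map indices us))"
        unfolding j_def xs by simp_all
      have "t \<in> trees_over (take j xs)" "us \<in> forests_over (drop j xs)"
        using ts(3) False tu_indices(1,2) unfolding tu trees_over_def forests_over_def by simp_all
      moreover have "j \<in> {1..<?n}"
      proof -
        obtain u vs where "us = u # vs" using False by (cases us) auto
        then have "0 < length (concat (map indices us))" using length_indices_pos[of u] by simp
        then show ?thesis using length_indices_pos[of t] tu_indices(3)
          by (simp add: j_def Suc_le_eq)
      qed
      ultimately show ?thesis unfolding tu by blast
    qed
  next
    fix ts assume "ts \<in> ?S \<union> (\<Union>j\<in>{1..<?n}. ?N j)"
    then consider t where "t \<in> trees_over xs" "ts = [t]"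
      | j t us where "t \<in> trees_over (take j xs)" "us \<in> forests_over (drop j xs)" "ts = t # us" by auto
    then show "ts \<in> forests_over xs"
      by cases (auto simp: trees_over_def forests_over_def)
  qed
  have IH: "finite (forests_over (drop j xs)) \<and> card (forests_over (drop j xs)) = num_forests (?n - j)"
    if "j \<in> {1..<?n}" for j
    using less[of "drop j xs"] that by auto
  have T: "finite (trees_over (take j xs)) \<and> card (trees_over (take j xs)) = num_trees j" if "j \<in> {1..<?n}" for j
    using card_trees_over[of "take j xs"] that by simp
  have cN: "card (?N j) = num_trees j * num_forests (?n - j)" if "j \<in> {1..<?n}" for j
  proof -
    have "card (?N j) = card (trees_over (take j xs) \<times> forests_over (drop j xs))"
      by (rule card_image) (auto simp: inj_on_def)
    then show ?thesis using IH[OF that] T[OF that] by (simp add: card_cartesian_product)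
  qed
  have disj: "?N i \<inter> ?N j = {}" if "i \<in> {1..<?n}" "j \<in> {1..<?n}" "i \<noteq> j" for i j
  proof (rule equals0I)
    fix ts assume "ts \<in> ?N i \<inter> ?N j"
    then obtain t where "t \<in> trees_over (take i xs)" "t \<in> trees_over (take j xs)" by auto
    then have "length (take i xs) = length (take j xs)" by (auto simp: trees_over_def)
    then show False using that by simp
  qed
  have "card (\<Union>j\<in>{1..<?n}. ?N j) = (\<Sum>j\<in>{1..<?n}. card (?N j))"
    by (rule card_UN_disjoint) (use IH T disj in auto)
  also have "\<dots> = (\<Sum>j\<in>{1..<?n}. num_trees j * num_forests (?n - j))"
    by (rule sum.cong[OF refl]) (rule cN)
  finally have cU: "card (\<Union>j\<in>{1..<?n}. ?N j) = (\<Sum>j\<in>{1..<?n}. num_trees j * num_forests (?n - j))" .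
  have finU: "finite (\<Union>j\<in>{1..<?n}. ?N j)" using IH T by auto
  have cS: "finite ?S" "card ?S = num_trees ?n"
    using card_trees_over[of xs] by (auto simp: card_image inj_on_def)
  have "?S \<inter> (\<Union>j\<in>{1..<?n}. ?N j) = {}"
    by (auto simp: forests_over_def)
  then have "card (forests_over xs) = num_trees ?n + (\<Sum>j\<in>{1..<?n}. num_trees j * num_forests (?n - j))"
    unfolding eq using cS cU finU by (simp add: card_Un_disjoint)
  also have "\<dots> = num_forests ?n" by (subst (2) num_forests.simps) simp
  finally show ?case unfolding eq using cS finU by simp
qed

lemma Codes_eq: "Codes n = (\<Union>xs\<in>permutations_of_set {1..n}. forests_over xs)"
  by (auto simp: Codes_def forests_over_def permutations_of_set_def)

lemma single_Codes_eq:
  "{ts \<in> Codes n. length ts = 1} = (\<Union>xs\<in>permutations_of_set {1..n}. (\<lambda>t. [t]) ` trees_over xs)"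
proof (intro equalityI subsetI)
  fix ts assume "ts \<in> {ts \<in> Codes n. length ts = 1}"
  moreover from this obtain t where "ts = [t]" by (auto simp: length_Suc_conv)
  ultimately show "ts \<in> (\<Union>xs\<in>permutations_of_set {1..n}. (\<lambda>t. [t]) ` trees_over xs)"
    by (auto simp: Codes_def trees_over_def permutations_of_set_def)
next
  fix ts assume "ts \<in> (\<Union>xs\<in>permutations_of_set {1..n}. (\<lambda>t. [t]) ` trees_over xs)"
  then obtain xs t where "xs \<in> permutations_of_set {1..n}" "t \<in> trees_over xs" "ts = [t]" by blast
  then show "ts \<in> {ts \<in> Codes n. length ts = 1}"
    by (simp add: Codes_def trees_over_def permutations_of_set_def)
qed

lemma card_over_permutations:
  assumes "\<And>xs. length xs = n \<Longrightarrow> finite (f xs) \<and> card (f xs) = c"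
    and "\<And>xs ys. xs \<noteq> ys \<Longrightarrow> f xs \<inter> f ys = {}"
  shows "card (\<Union>xs\<in>permutations_of_set {1..n}. f xs) = fact n * c"
proof -
  have len: "length xs = n" if "xs \<in> permutations_of_set {1..n}" for xs
    using length_finite_permutations_of_set[OF that] by simp
  have "card (\<Union>xs\<in>permutations_of_set {1..n}. f xs) = (\<Sum>xs\<in>permutations_of_set {1..n}. card (f xs))"
    by (rule card_UN_disjoint) (use assms len in auto)
  also have "\<dots> = (\<Sum>xs\<in>permutations_of_set {1..n}. c)"
    by (rule sum.cong[OF refl]) (use assms(1) len in blast)
  finally show ?thesis by simp
qed

lemma finite_Codes: "finite (Codes n)"
  unfolding Codes_eq using card_forests_over by auto

lemma card_Codes: "card (Codes n) = fact n * num_forests n"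
  unfolding Codes_eq by (rule card_over_permutations) (use card_forests_over in \<open>auto simp: forests_over_def\<close>)

lemma card_single_Codes: "card {ts \<in> Codes n. length ts = 1} = fact n * num_trees n"
  unfolding single_Codes_eq
proof (rule card_over_permutations)
  show "finite ((\<lambda>t. [t]) ` trees_over xs) \<and> card ((\<lambda>t. [t]) ` trees_over xs) = num_trees n" if "length xs = n" for xs
    using card_trees_over[of xs] that by (auto simp: card_image inj_on_def)
qed (auto simp: trees_over_def)

text \<open>Twice the codes of length 1 plus the longer ones is all codes plus those of length 1,
  which is where the sum \<open>num_trees n + num_forests n\<close> comes from.\<close>

lemma num_regular_symbic_trees_eq:
  assumes "1 \<le> n"
  shows "2 ^ Suc n * num_regular_symbic_trees n = fact n * (num_trees n + num_forests n)"
proof -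
  have "Codes n = {ts \<in> Codes n. length ts = 1} \<union> {ts \<in> Codes n. length ts \<noteq> 1}" by blast
  then have "card (Codes n) = card {ts \<in> Codes n. length ts = 1} + card {ts \<in> Codes n. length ts \<noteq> 1}"
    using finite_Codes[of n] card_Un_disjoint[of "{ts \<in> Codes n. length ts = 1}" "{ts \<in> Codes n. length ts \<noteq> 1}"]
    by (metis (no_types, lifting) disjoint_iff finite_Un mem_Collect_eq)
  then have "2 ^ Suc n * num_regular_symbic_trees n = fact n * num_trees n + fact n * num_forests n"
    using card_code_sides_Codes[OF finite_Codes, of n]
    unfolding num_eq_card_code_sides[OF assms] card_Codes card_single_Codes by linarith
  then show ?thesis by (simp only: distrib_left)
qed

section \<open>Generating functions\<close>

text \<open>This ordinary series fits the exponential one: the orders of the indices contribute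
  \<open>fact n\<close>, which cancels the factorial there, and \<open>2 ^ n\<close> divides out the
  choices of twins.\<close>

definition tree_fps :: "real fps" where
  "tree_fps = Abs_fps (\<lambda>n. real (num_trees n) / 2 ^ n)"

definition forest_fps :: "real fps" where
  "forest_fps = Abs_fps (\<lambda>n. real (num_forests n) / 2 ^ n)"

lemma num_trees_0 [simp]: "num_trees 0 = 0"
  by (simp add: num_trees.simps)

lemma num_forests_0 [simp]: "num_forests 0 = 0"
  by (subst num_forests.simps) simp

lemma convolution_scaled:
  fixes f g :: "nat \<Rightarrow> nat"
  assumes "f 0 = 0" "g 0 = 0"
  shows "fps_nth (Abs_fps (\<lambda>n. real (f n) / 2 ^ n) * Abs_fps (\<lambda>n. real (g n) / 2 ^ n)) n
    = real (\<Sum>j\<in>{1..<n}. f j * g (n - j)) / 2 ^ n"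
proof -
  have "fps_nth (Abs_fps (\<lambda>n. real (f n) / 2 ^ n) * Abs_fps (\<lambda>n. real (g n) / 2 ^ n)) n
    = (\<Sum>j=0..n. real (f j) / 2 ^ j * (real (g (n - j)) / 2 ^ (n - j)))"
    by (simp add: fps_mult_nth)
  also have "\<dots> = (\<Sum>j\<in>{1..<n}. real (f j) / 2 ^ j * (real (g (n - j)) / 2 ^ (n - j)))"
  proof (rule sum.mono_neutral_right)
    show "\<forall>j\<in>{0..n} - {1..<n}. real (f j) / 2 ^ j * (real (g (n - j)) / 2 ^ (n - j)) = 0"
    proof
      fix j assume "j \<in> {0..n} - {1..<n}"
      then have "j = 0 \<or> n - j = 0" by auto
      then show "real (f j) / 2 ^ j * (real (g (n - j)) / 2 ^ (n - j)) = 0" using assms by auto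
    qed
  qed auto
  also have "\<dots> = (\<Sum>j\<in>{1..<n}. real (f j * g (n - j)) / 2 ^ n)"
    by (rule sum.cong[OF refl]) (simp flip: power_add)
  finally show ?thesis by (simp add: sum_divide_distrib)
qed

lemma tree_fps_nth [simp]: "fps_nth tree_fps n = real (num_trees n) / 2 ^ n"
  by (simp add: tree_fps_def)

lemma forest_fps_nth [simp]: "fps_nth forest_fps n = real (num_forests n) / 2 ^ n"
  by (simp add: forest_fps_def)

text \<open>Only degrees 1 and 2 depart from the convolution. The coefficient of the single leaf is
  2/2, and for two leaves the square gives 4/4 where the true value is 2/4.\<close>

lemma tree_fps_eq: "tree_fps = fps_X + tree_fps * tree_fps - fps_const (1 / 2) * fps_X ^ 2"
proof (rule fps_ext)
  fix n
  have conv: "fps_nth (tree_fps * tree_fps) n = real (\<Sum>j\<in>{1..<n}. num_trees j * num_trees (n - j)) / 2 ^ n"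
    unfolding tree_fps_def by (rule convolution_scaled) simp_all
  consider "n = 0" | "n = 1" | "n = 2" | "3 \<le> n" by linarith
  then show "fps_nth tree_fps n = fps_nth (fps_X + tree_fps * tree_fps - fps_const (1 / 2) * fps_X ^ 2) n"
  proof cases
    case 3
    have "{1..<2::nat} = {1}" by auto
    then show ?thesis using conv 3
      by (simp add: fps_X_power_nth num_trees.simps[of 2] num_trees.simps[of 1] num_trees.simps[of "Suc 0"])
  next
    case 4
    then show ?thesis using conv 4
      by (simp add: fps_X_power_nth num_trees.simps[of n])
  qed (simp_all add: fps_X_power_nth num_trees.simps[of "Suc 0"])
qed

lemma forest_fps_eq: "forest_fps = tree_fps + tree_fps * forest_fps"
proof (rule fps_ext)
  fix n
  have "fps_nth (tree_fps * forest_fps) n = real (\<Sum>j\<in>{1..<n}. num_trees j * num_forests (n - j)) / 2 ^ n"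
    unfolding tree_fps_def forest_fps_def by (rule convolution_scaled) simp_all
  then show "fps_nth forest_fps n = fps_nth (tree_fps + tree_fps * forest_fps) n"
    by (simp add: num_forests.simps[of n] add_divide_distrib)
qed

text \<open>Both series start in degree 1, so the summand 1 carries the convention for
  \<open>n = 0\<close>.\<close>

lemma egf_eq: "egf num_regular_symbic_trees = 1 + fps_const (1 / 2) * (tree_fps + forest_fps)"
proof (rule fps_ext)
  fix n
  show "fps_nth (egf num_regular_symbic_trees) n = fps_nth (1 + fps_const (1 / 2) * (tree_fps + forest_fps)) n"
  proof (cases "n = 0")
    case True
    then show ?thesis by (simp add: egf_def num_regular_symbic_trees_def)
  next
    case False
    then have "real (2 ^ Suc n * num_regular_symbic_trees n) = real (fact n * (num_trees n + num_forests n))"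
      using num_regular_symbic_trees_eq[of n] by simp
    then have "2 * 2 ^ n * real (num_regular_symbic_trees n) = fact n * (real (num_trees n) + real (num_forests n))"
      by simp
    then have "real (num_regular_symbic_trees n) / fact n = (real (num_trees n) + real (num_forests n)) / (2 * 2 ^ n)"
      by (simp add: field_simps)
    then show ?thesis using False
      by (simp add: egf_def add_divide_distrib)
  qed
qed

text \<open>The equation for \<open>tree_fps\<close> is solved by completing the square. Of the two
  square roots, the one with constant coefficient 1 is \<open>1 - 2 * tree_fps\<close>.\<close>

lemma fps_sqrt_eq: "fps_sqrt (1 - 4 * fps_X + 2 * fps_X ^ 2) = 1 - 2 * tree_fps"
proof -
  have "(1 - 2 * tree_fps) ^ 2 = 1 - 4 * (tree_fps - tree_fps * tree_fps)"
    by (simp add: power2_eq_square algebra_simps)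
  also have "tree_fps - tree_fps * tree_fps = fps_X - fps_const (1 / 2) * fps_X ^ 2"
    using tree_fps_eq by (simp add: algebra_simps)
  also have "1 - 4 * (fps_X - fps_const (1 / 2) * fps_X ^ 2) = 1 - 4 * fps_X + (2 :: real fps) * fps_X ^ 2"
  proof -
    have "4 * fps_const (1 / 2) = (2 :: real fps)"
      by (simp add: numeral_fps_const)
    then have "4 * (fps_const (1 / 2) * fps_X ^ 2) = (2 :: real fps) * fps_X ^ 2"
      by (metis mult.assoc)
    then show ?thesis by (simp add: algebra_simps)
  qed
  finally have sq: "(1 - 2 * tree_fps) ^ Suc 1 = 1 - 4 * fps_X + 2 * fps_X ^ 2"
    by (simp add: numeral_2_eq_2)
  have c0: "fps_nth (1 - 4 * fps_X + 2 * fps_X ^ 2 :: real fps) 0 = 1" "fps_nth (1 - 2 * tree_fps) 0 = 1"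
    by (simp_all)
  have "1 - 2 * tree_fps = fps_radical root (Suc 1) (1 - 4 * fps_X + 2 * fps_X ^ 2)"
    by (rule radical_unique[THEN iffD1, OF _ _ _ sq]) (simp_all only: c0, simp_all)
  then show ?thesis by (simp add: fps_sqrt_def numeral_2_eq_2)
qed

theorem theorem5p3:
  shows "egf num_regular_symbic_trees =
           fps_const (3 / 4)
           - fps_const (1 / 4) * fps_sqrt (1 - 4 * fps_X + 2 * fps_X ^ 2)
           + 1 / (1 + fps_sqrt (1 - 4 * fps_X + 2 * fps_X ^ 2))"
proof -
  have half: "fps_const (1 / 2) * 2 = (1 :: real fps)" by (simp add: numeral_fps_const)
  \<comment> \<open>With B and F for the tree and the forest series, the denominator is 2(1 - B),
    and \<open>forest_fps_eq\<close> says that (1 - B)(1 + F) = 1.\<close>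
  have "(1 + (1 - 2 * tree_fps)) * (fps_const (1 / 2) * (1 + forest_fps))
      = (fps_const (1 / 2) * 2) * ((1 - tree_fps) * (1 + forest_fps))"
    by (simp add: algebra_simps)
  also have "\<dots> = 1 + (forest_fps - (tree_fps + tree_fps * forest_fps))"
    unfolding half by (simp add: algebra_simps)
  also have "\<dots> = 1" using forest_fps_eq by simp
  finally have "inverse (1 + (1 - 2 * tree_fps)) = fps_const (1 / 2) * (1 + forest_fps)"
    by (rule fps_inverse_unique)
  moreover have "fps_nth (1 + (1 - 2 * tree_fps)) 0 \<noteq> 0" by (simp)
  ultimately have inv: "1 / (1 + (1 - 2 * tree_fps)) = fps_const (1 / 2) * (1 + forest_fps)"
    by (simp add: fps_divide_unit)
  have c: "fps_const (3 / 4) - fps_const (1 / 4) + fps_const (1 / 2) = (1 :: real fps)"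
    "fps_const (1 / 4) * 2 = (fps_const (1 / 2) :: real fps)"
    by (simp_all add: numeral_fps_const)
  \<comment> \<open>Collecting terms explains the constants: 3/4 - 1/4 + 1/2 is the leading 1, while
    2/4 and 1/2 are the coefficients of the tree and the forest series in
    \<open>egf_eq\<close>.\<close>
  have "fps_const (3 / 4) - fps_const (1 / 4) * (1 - 2 * tree_fps) + fps_const (1 / 2) * (1 + forest_fps)
     = (fps_const (3 / 4) - fps_const (1 / 4) + fps_const (1 / 2))
       + (fps_const (1 / 4) * 2) * tree_fps + fps_const (1 / 2) * forest_fps"
    by (simp add: algebra_simps)
  also have "\<dots> = egf num_regular_symbic_trees"
    unfolding c egf_eq by (simp add: algebra_simps)
  finally show ?thesis unfolding fps_sqrt_eq inv by simp
qed

end
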